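(* Suppose that $r\ge n$. Then the $\mathcal{K}$-algebra homomorphism $\varphi:\mathcal{E}^{\mathcal{K}}_n(q)\to\mathcal{Y}^{\mathcal{K}}_{r,n}(q)$ determined by $\varphi(g_i)=g_i$ and $\varphi(e_i)=e_i$ for $1\le i\le n-1$ is an embedding (injective).
   Context: Let $n,r\ge 1$ be integers, $\xi=e^{2\pi i/r}\in\mathbb{C}$, $\Delta=\prod_{0\le i<j\le r-1}(\xi^i-\xi^j)$, $q$ an indeterminate, $R=\mathbb{Z}[q,q^{-1},\xi,r^{-1},\Delta^{-1}]$ and $S=\mathbb{Z}[q,q^{-1}]$. The symmetric group $\mathfrak{S}_n$ acts on the right on $\{1,\dots,n\}$ and $s_i=(i,i+1)$. The Yokonuma-Hecke algebra $\mathcal{Y}_{r,n}(q)$ is the associative unital $R$-algebra generated by $g_1,\dots,g_{n-1},t_1,\dots,t_n$ with relations: $t_i^r=1$; $t_it_j=t_jt_i$; $t_jg_i=g_it_{js_i}$ for all $i,j$; $g_ig_j=g_jg_i$ for $|i-j|>1$; $g_ig_{i+1}g_i=g_{i+1}g_ig_{i+1}$; and $g_i^2=1+(q-q^{-1})e_ig_i$, where $e_i=\frac1r\sum_{s=0}^{r-1}t_i^st_{i+1}^{-s}$. The algebra of braids and ties $\mathcal{E}_n(q)$ is the associative unital $S$-algebra generated by $g_1,\dots,g_{n-1},e_1,\dots,e_{n-1}$ with relations: $g_ig_j=g_jg_i$ for $|i-j|>1$; $g_ie_i=e_ig_i$; $g_ig_jg_i=g_jg_ig_j$ for $|i-j|=1$;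 $e_ig_jg_i=g_jg_ie_j$ for $|i-j|=1$; $e_ie_jg_j=e_ig_je_i=g_je_ie_j$ for $|i-j|=1$; $e_ie_j=e_je_i$ for all $i,j$; $g_ie_j=e_jg_i$ for $|i-j|>1$; $e_i^2=e_i$; $g_i^2=1+(q-q^{-1})e_ig_i$. $\mathcal{K}$ is a commutative ring with elements $q,\xi\in\mathcal{K}^{\times}$ such that $\xi$ is an $r$-th root of unity and $r$ and $\prod_{0\le i<j\le r-1}(\xi^i-\xi^j)$ are invertible in $\mathcal{K}$; it is an $R$-algebra (and $S$-algebra) via $q\mapsto q$, $\xi\mapsto\xi$. Set $\mathcal{Y}^{\mathcal{K}}_{r,n}(q)=\mathcal{Y}_{r,n}(q)\otimes_R\mathcal{K}$ and $\mathcal{E}^{\mathcal{K}}_n(q)=\mathcal{E}_n(q)\otimes_S\mathcal{K}$. The homomorphism $\varphi$ exists because the defining relations of $\mathcal{E}_n(q)$ hold in the Yokonuma-Hecke algebra. *)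

theory Defs
  imports Complex_Main "HOL-Algebra.Algebra" "HOL-Algebra.Algebraic_Closure_Type"
    "HOL-Combinatorics.Transposition"
begin

section \<open>Monoid algebras\<close>

text \<open>The monoid algebra of \<open>M\<close> over \<open>A\<close>: finitely supported functions from the carrier of \<open>M\<close> to
  \<open>A\<close>, extended by zero outside the carrier, under convolution.\<close>

definition monom_elem :: "('a, 'm) ring_scheme \<Rightarrow> 'b \<Rightarrow> 'a \<Rightarrow> 'b \<Rightarrow> 'a" where
  "monom_elem A m a = (\<lambda>x. if x = m then a else \<zero>\<^bsub>A\<^esub>)"

definition monoid_algebra :: "('a, 'm) ring_scheme \<Rightarrow> ('b, 'p) monoid_scheme \<Rightarrow> ('b \<Rightarrow> 'a) ring" where
  "monoid_algebra A M =
    \<lparr> carrier = {f. range f \<subseteq> carrier A \<and> finite {x. f x \<noteq> \<zero>\<^bsub>A\<^esub>} \<and> {x. f x \<noteq> \<zero>\<^bsub>A\<^esub>} \<subseteq> carrier M},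
      monoid.mult = (\<lambda>f g m. finsum A (\<lambda>(x, y). f x \<otimes>\<^bsub>A\<^esub> g y)
                  {(x, y). f x \<noteq> \<zero>\<^bsub>A\<^esub> \<and> g y \<noteq> \<zero>\<^bsub>A\<^esub> \<and> x \<otimes>\<^bsub>M\<^esub> y = m}),
      one = monom_elem A \<one>\<^bsub>M\<^esub> \<one>\<^bsub>A\<^esub>,
      ring.zero = (\<lambda>_. \<zero>\<^bsub>A\<^esub>),
      add = (\<lambda>f g m. f m \<oplus>\<^bsub>A\<^esub> g m) \<rparr>"


section \<open>Algebras given by generators and relations\<close>

definition free_monoid :: "'x set \<Rightarrow> 'x list monoid" where
  "free_monoid G = \<lparr> carrier = lists G, monoid.mult = (@), one = [] \<rparr>"

definition free_algebra :: "('a, 'm) ring_scheme \<Rightarrow> 'x set \<Rightarrow> ('x list \<Rightarrow> 'a) ring" where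
  "free_algebra A G = monoid_algebra A (free_monoid G)"

definition free_gen :: "('a, 'm) ring_scheme \<Rightarrow> 'x \<Rightarrow> 'x list \<Rightarrow> 'a" where
  "free_gen A x = monom_elem A [x] \<one>\<^bsub>A\<^esub>"

definition free_const :: "('a, 'm) ring_scheme \<Rightarrow> 'a \<Rightarrow> 'x list \<Rightarrow> 'a" where
  "free_const A a = monom_elem A [] a"

text \<open>A relation \<open>u = v\<close> is the pair \<open>(u, v)\<close>; the ideal is two-sided.\<close>

definition relation_ideal ::
  "('a, 'm) ring_scheme \<Rightarrow> 'x set \<Rightarrow> (('x list \<Rightarrow> 'a) \<times> ('x list \<Rightarrow> 'a)) set \<Rightarrow> ('x list \<Rightarrow> 'a) set" where
  "relation_ideal A G Rel =
     Idl\<^bsub>free_algebra A G\<^esub> ((\<lambda>(u, v). u \<ominus>\<^bsub>free_algebra A G\<^esub> v) ` Rel)"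

definition presented_algebra ::
  "('a, 'm) ring_scheme \<Rightarrow> 'x set \<Rightarrow> (('x list \<Rightarrow> 'a) \<times> ('x list \<Rightarrow> 'a)) set \<Rightarrow> ('x list \<Rightarrow> 'a) set ring" where
  "presented_algebra A G Rel = free_algebra A G Quot relation_ideal A G Rel"

definition presented_class ::
  "('a, 'm) ring_scheme \<Rightarrow> 'x set \<Rightarrow> (('x list \<Rightarrow> 'a) \<times> ('x list \<Rightarrow> 'a)) set \<Rightarrow>
   ('x list \<Rightarrow> 'a) \<Rightarrow> ('x list \<Rightarrow> 'a) set" where
  "presented_class A G Rel u = relation_ideal A G Rel +>\<^bsub>free_algebra A G\<^esub> u"


section \<open>Extension of scalars\<close>

text \<open>An algebra over a commutative ring \<open>A\<close> is a ring \<open>B\<close> with a structure map \<open>\<eta>\<close> from \<open>A\<close> into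
  the centre of \<open>B\<close>. For a homomorphism \<open>h\<close> from \<open>A\<close> to a commutative ring \<open>K\<close>, the
  tensor product of \<open>B\<close> and \<open>K\<close> over \<open>A\<close> is the free abelian group on \<open>B \<times> K\<close> modulo the usual
  bilinearity relations. The product \<open>(x \<otimes> k)(y \<otimes> l) = xy \<otimes> kl\<close> is the one induced from the
  monoid ring of \<open>B \<times> K\<close> over the integers; the subgroup spanned by the bilinearity relations is
  already an ideal of that ring.\<close>

definition tensor_relations ::
  "('a, 'm) ring_scheme \<Rightarrow> ('b, 'n) ring_scheme \<Rightarrow> ('a \<Rightarrow> 'b) \<Rightarrow> ('k, 'p) ring_scheme \<Rightarrow> ('a \<Rightarrow> 'k) \<Rightarrow>
   ('b \<times> 'k \<Rightarrow> int) set" where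
  "tensor_relations A B \<eta> K h =
     (let F = monoid_algebra \<Z> (B \<times>\<times> K); d = (\<lambda>x k. monom_elem \<Z> (x, k) 1) in
       {d (x \<oplus>\<^bsub>B\<^esub> y) k \<ominus>\<^bsub>F\<^esub> (d x k \<oplus>\<^bsub>F\<^esub> d y k) | x y k.
          x \<in> carrier B \<and> y \<in> carrier B \<and> k \<in> carrier K} \<union>
       {d x (k \<oplus>\<^bsub>K\<^esub> l) \<ominus>\<^bsub>F\<^esub> (d x k \<oplus>\<^bsub>F\<^esub> d x l) | x k l.
          x \<in> carrier B \<and> k \<in> carrier K \<and> l \<in> carrier K} \<union>
       {d (\<eta> a \<otimes>\<^bsub>B\<^esub> x) k \<ominus>\<^bsub>F\<^esub> d x (h a \<otimes>\<^bsub>K\<^esub> k) | a x k.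
          a \<in> carrier A \<and> x \<in> carrier B \<and> k \<in> carrier K})"

definition tensor_ideal ::
  "('a, 'm) ring_scheme \<Rightarrow> ('b, 'n) ring_scheme \<Rightarrow> ('a \<Rightarrow> 'b) \<Rightarrow> ('k, 'p) ring_scheme \<Rightarrow> ('a \<Rightarrow> 'k) \<Rightarrow>
   ('b \<times> 'k \<Rightarrow> int) set" where
  "tensor_ideal A B \<eta> K h = Idl\<^bsub>monoid_algebra \<Z> (B \<times>\<times> K)\<^esub> (tensor_relations A B \<eta> K h)"

definition base_change ::
  "('a, 'm) ring_scheme \<Rightarrow> ('b, 'n) ring_scheme \<Rightarrow> ('a \<Rightarrow> 'b) \<Rightarrow> ('k, 'p) ring_scheme \<Rightarrow> ('a \<Rightarrow> 'k) \<Rightarrow>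
   ('b \<times> 'k \<Rightarrow> int) set ring" where
  "base_change A B \<eta> K h = monoid_algebra \<Z> (B \<times>\<times> K) Quot tensor_ideal A B \<eta> K h"

definition pure_tensor ::
  "('a, 'm) ring_scheme \<Rightarrow> ('b, 'n) ring_scheme \<Rightarrow> ('a \<Rightarrow> 'b) \<Rightarrow> ('k, 'p) ring_scheme \<Rightarrow> ('a \<Rightarrow> 'k) \<Rightarrow>
   'b \<Rightarrow> 'k \<Rightarrow> ('b \<times> 'k \<Rightarrow> int) set" where
  "pure_tensor A B \<eta> K h x k =
     tensor_ideal A B \<eta> K h +>\<^bsub>monoid_algebra \<Z> (B \<times>\<times> K)\<^esub> monom_elem \<Z> (x, k) 1"

definition algebra_hom ::
  "('k, 'p) ring_scheme \<Rightarrow> ('b, 'm) ring_scheme \<Rightarrow> ('k \<Rightarrow> 'b) \<Rightarrow> ('c, 'n) ring_scheme \<Rightarrow> ('k \<Rightarrow> 'c) \<Rightarrow>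
   ('b \<Rightarrow> 'c) set" where
  "algebra_hom K B \<eta> C \<theta> = {\<phi> \<in> ring_hom B C. \<forall>k \<in> carrier K. \<phi> (\<eta> k) = \<theta> k}"


section \<open>The ground rings\<close>

text \<open>Both ground rings are subrings of the field of rational functions over the complex numbers
  in the indeterminate \<open>q\<close>.\<close>

definition indet_q :: "complex poly fract" where
  "indet_q = Fraction_Field.Fract [:0, 1:] 1"

definition const_fract :: "complex \<Rightarrow> complex poly fract" where
  "const_fract c = Fraction_Field.Fract [:c:] 1"

definition root_xi :: "nat \<Rightarrow> complex" where
  "root_xi r = exp (2 * of_real pi * \<i> / of_nat r)"

definition Delta :: "nat \<Rightarrow> complex" where
  "Delta r = (\<Prod>(i, j) \<in> {(i, j). i < j \<and> j < r}. root_xi r ^ i - root_xi r ^ j)"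

definition generated_ring :: "complex poly fract set \<Rightarrow> complex poly fract ring" where
  "generated_ring H = ring_of_type_algebra \<lparr> carrier := generate_ring ring_of_type_algebra H \<rparr>"

definition ring_R :: "nat \<Rightarrow> complex poly fract ring" where
  "ring_R r = generated_ring
     {indet_q, inverse indet_q, const_fract (root_xi r), inverse (of_nat r),
      inverse (const_fract (Delta r))}"

definition ring_S :: "complex poly fract ring" where
  "ring_S = generated_ring {indet_q, inverse indet_q}"


section \<open>The Yokonuma-Hecke algebra\<close>

datatype yh_gen = YG nat | YT nat

definition yh_gens :: "nat \<Rightarrow> yh_gen set" where
  "yh_gens n = YG ` {1..<n} \<union> YT ` {1..n}"

text \<open>In the presence of \<open>t\<^sup>r = 1\<close> the inverse power \<open>t\<^sup>-\<^sup>s\<close>, for \<open>0 \<le> s < r\<close>, is \<open>t\<^sup>r\<^sup>-\<^sup>s\<close>. The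
  argument \<open>c\<close> stands for \<open>1/r\<close>.\<close>

definition yh_idem :: "('b, 'm) ring_scheme \<Rightarrow> nat \<Rightarrow> 'b \<Rightarrow> (nat \<Rightarrow> 'b) \<Rightarrow> nat \<Rightarrow> 'b" where
  "yh_idem B r c t i =
     c \<otimes>\<^bsub>B\<^esub> (\<Oplus>\<^bsub>B\<^esub>s \<in> {..<r}. t i [^]\<^bsub>B\<^esub> s \<otimes>\<^bsub>B\<^esub> t (i + 1) [^]\<^bsub>B\<^esub> (r - s))"

text \<open>The relations between elements \<open>g\<close>, \<open>t\<close> of a ring, with \<open>z\<close> standing for \<open>q - q\<^sup>-\<^sup>1\<close>.\<close>

definition yh_relations ::
  "('b, 'm) ring_scheme \<Rightarrow> nat \<Rightarrow> nat \<Rightarrow> 'b \<Rightarrow> 'b \<Rightarrow> (nat \<Rightarrow> 'b) \<Rightarrow> (nat \<Rightarrow> 'b) \<Rightarrow> ('b \<times> 'b) set" where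
  "yh_relations B r n c z g t =
     {(t i [^]\<^bsub>B\<^esub> r, \<one>\<^bsub>B\<^esub>) | i. i \<in> {1..n}} \<union>
     {(t i \<otimes>\<^bsub>B\<^esub> t j, t j \<otimes>\<^bsub>B\<^esub> t i) | i j. i \<in> {1..n} \<and> j \<in> {1..n}} \<union>
     {(t j \<otimes>\<^bsub>B\<^esub> g i, g i \<otimes>\<^bsub>B\<^esub> t (Transposition.transpose i (i + 1) j)) | i j.
        i \<in> {1..<n} \<and> j \<in> {1..n}} \<union>
     {(g i \<otimes>\<^bsub>B\<^esub> g j, g j \<otimes>\<^bsub>B\<^esub> g i) | i j.
        i \<in> {1..<n} \<and> j \<in> {1..<n} \<and> \<bar>int i - int j\<bar> > 1} \<union>
     {(g i \<otimes>\<^bsub>B\<^esub> g (i + 1) \<otimes>\<^bsub>B\<^esub> g i, g (i + 1) \<otimes>\<^bsub>B\<^esub> g i \<otimes>\<^bsub>B\<^esub> g (i + 1)) | i.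
        i \<in> {1..<n} \<and> i + 1 \<in> {1..<n}} \<union>
     {(g i [^]\<^bsub>B\<^esub> (2::nat), \<one>\<^bsub>B\<^esub> \<oplus>\<^bsub>B\<^esub> z \<otimes>\<^bsub>B\<^esub> (yh_idem B r c t i \<otimes>\<^bsub>B\<^esub> g i)) | i. i \<in> {1..<n}}"

definition YH_rels ::
  "nat \<Rightarrow> nat \<Rightarrow> ((yh_gen list \<Rightarrow> complex poly fract) \<times> (yh_gen list \<Rightarrow> complex poly fract)) set" where
  "YH_rels r n =
     yh_relations (free_algebra (ring_R r) (yh_gens n)) r n
       (free_const (ring_R r) (inverse (of_nat r)))
       (free_const (ring_R r) (indet_q - inverse indet_q))
       (\<lambda>i. free_gen (ring_R r) (YG i)) (\<lambda>i. free_gen (ring_R r) (YT i))"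

definition YH :: "nat \<Rightarrow> nat \<Rightarrow> (yh_gen list \<Rightarrow> complex poly fract) set ring" where
  "YH r n = presented_algebra (ring_R r) (yh_gens n) (YH_rels r n)"

definition YH_class ::
  "nat \<Rightarrow> nat \<Rightarrow> (yh_gen list \<Rightarrow> complex poly fract) \<Rightarrow> (yh_gen list \<Rightarrow> complex poly fract) set" where
  "YH_class r n = presented_class (ring_R r) (yh_gens n) (YH_rels r n)"

definition YH_scalar :: "nat \<Rightarrow> nat \<Rightarrow> complex poly fract \<Rightarrow> (yh_gen list \<Rightarrow> complex poly fract) set" where
  "YH_scalar r n a = YH_class r n (free_const (ring_R r) a)"

definition YH_g :: "nat \<Rightarrow> nat \<Rightarrow> nat \<Rightarrow> (yh_gen list \<Rightarrow> complex poly fract) set" where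
  "YH_g r n i = YH_class r n (free_gen (ring_R r) (YG i))"

definition YH_t :: "nat \<Rightarrow> nat \<Rightarrow> nat \<Rightarrow> (yh_gen list \<Rightarrow> complex poly fract) set" where
  "YH_t r n i = YH_class r n (free_gen (ring_R r) (YT i))"

definition YH_e :: "nat \<Rightarrow> nat \<Rightarrow> nat \<Rightarrow> (yh_gen list \<Rightarrow> complex poly fract) set" where
  "YH_e r n i = yh_idem (YH r n) r (YH_scalar r n (inverse (of_nat r))) (YH_t r n) i"


section \<open>The algebra of braids and ties\<close>

datatype bt_gen = BG nat | BE nat

definition bt_gens :: "nat \<Rightarrow> bt_gen set" where
  "bt_gens n = BG ` {1..<n} \<union> BE ` {1..<n}"

definition bt_relations ::
  "('b, 'm) ring_scheme \<Rightarrow> nat \<Rightarrow> 'b \<Rightarrow> (nat \<Rightarrow> 'b) \<Rightarrow> (nat \<Rightarrow> 'b) \<Rightarrow> ('b \<times> 'b) set" where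
  "bt_relations B n z g e =
     (let far = {(i, j). i \<in> {1..<n} \<and> j \<in> {1..<n} \<and> \<bar>int i - int j\<bar> > 1};
          near = {(i, j). i \<in> {1..<n} \<and> j \<in> {1..<n} \<and> \<bar>int i - int j\<bar> = 1} in
     {(g i \<otimes>\<^bsub>B\<^esub> g j, g j \<otimes>\<^bsub>B\<^esub> g i) | i j. (i, j) \<in> far} \<union>
     {(g i \<otimes>\<^bsub>B\<^esub> e i, e i \<otimes>\<^bsub>B\<^esub> g i) | i. i \<in> {1..<n}} \<union>
     {(g i \<otimes>\<^bsub>B\<^esub> g j \<otimes>\<^bsub>B\<^esub> g i, g j \<otimes>\<^bsub>B\<^esub> g i \<otimes>\<^bsub>B\<^esub> g j) | i j. (i, j) \<in> near} \<union>
     {(e i \<otimes>\<^bsub>B\<^esub> g j \<otimes>\<^bsub>B\<^esub> g i, g j \<otimes>\<^bsub>B\<^esub> g i \<otimes>\<^bsub>B\<^esub> e j) | i j. (i, j) \<in> near} \<union>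
     {(e i \<otimes>\<^bsub>B\<^esub> e j \<otimes>\<^bsub>B\<^esub> g j, e i \<otimes>\<^bsub>B\<^esub> g j \<otimes>\<^bsub>B\<^esub> e i) | i j. (i, j) \<in> near} \<union>
     {(e i \<otimes>\<^bsub>B\<^esub> g j \<otimes>\<^bsub>B\<^esub> e i, g j \<otimes>\<^bsub>B\<^esub> e i \<otimes>\<^bsub>B\<^esub> e j) | i j. (i, j) \<in> near} \<union>
     {(e i \<otimes>\<^bsub>B\<^esub> e j, e j \<otimes>\<^bsub>B\<^esub> e i) | i j. i \<in> {1..<n} \<and> j \<in> {1..<n}} \<union>
     {(g i \<otimes>\<^bsub>B\<^esub> e j, e j \<otimes>\<^bsub>B\<^esub> g i) | i j. (i, j) \<in> far} \<union>
     {(e i [^]\<^bsub>B\<^esub> (2::nat), e i) | i. i \<in> {1..<n}} \<union>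
     {(g i [^]\<^bsub>B\<^esub> (2::nat), \<one>\<^bsub>B\<^esub> \<oplus>\<^bsub>B\<^esub> z \<otimes>\<^bsub>B\<^esub> (e i \<otimes>\<^bsub>B\<^esub> g i)) | i. i \<in> {1..<n}})"

definition BT_rels ::
  "nat \<Rightarrow> ((bt_gen list \<Rightarrow> complex poly fract) \<times> (bt_gen list \<Rightarrow> complex poly fract)) set" where
  "BT_rels n =
     bt_relations (free_algebra ring_S (bt_gens n)) n
       (free_const ring_S (indet_q - inverse indet_q))
       (\<lambda>i. free_gen ring_S (BG i)) (\<lambda>i. free_gen ring_S (BE i))"

definition BT :: "nat \<Rightarrow> (bt_gen list \<Rightarrow> complex poly fract) set ring" where
  "BT n = presented_algebra ring_S (bt_gens n) (BT_rels n)"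

definition BT_class ::
  "nat \<Rightarrow> (bt_gen list \<Rightarrow> complex poly fract) \<Rightarrow> (bt_gen list \<Rightarrow> complex poly fract) set" where
  "BT_class n = presented_class ring_S (bt_gens n) (BT_rels n)"

definition BT_scalar :: "nat \<Rightarrow> complex poly fract \<Rightarrow> (bt_gen list \<Rightarrow> complex poly fract) set" where
  "BT_scalar n a = BT_class n (free_const ring_S a)"

definition BT_g :: "nat \<Rightarrow> nat \<Rightarrow> (bt_gen list \<Rightarrow> complex poly fract) set" where
  "BT_g n i = BT_class n (free_gen ring_S (BG i))"

definition BT_e :: "nat \<Rightarrow> nat \<Rightarrow> (bt_gen list \<Rightarrow> complex poly fract) set" where
  "BT_e n i = BT_class n (free_gen ring_S (BE i))"


section \<open>Specialisation to \<open>K\<close>\<close>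

text \<open>The ground ring of \<open>BT\<close> is a subring of that of \<open>YH\<close>, so one structure map \<open>h\<close>, defined on
  the larger ring, makes \<open>K\<close> an algebra over both.\<close>

type_synonym 'k yhK = "((yh_gen list \<Rightarrow> complex poly fract) set \<times> 'k \<Rightarrow> int) set"
type_synonym 'k btK = "((bt_gen list \<Rightarrow> complex poly fract) set \<times> 'k \<Rightarrow> int) set"

definition YHK :: "nat \<Rightarrow> nat \<Rightarrow> 'k ring \<Rightarrow> (complex poly fract \<Rightarrow> 'k) \<Rightarrow> 'k yhK ring" where
  "YHK r n K h = base_change (ring_R r) (YH r n) (YH_scalar r n) K h"

definition YHK_tensor ::
  "nat \<Rightarrow> nat \<Rightarrow> 'k ring \<Rightarrow> (complex poly fract \<Rightarrow> 'k) \<Rightarrow>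
   (yh_gen list \<Rightarrow> complex poly fract) set \<Rightarrow> 'k \<Rightarrow> 'k yhK" where
  "YHK_tensor r n K h = pure_tensor (ring_R r) (YH r n) (YH_scalar r n) K h"

definition BTK :: "nat \<Rightarrow> 'k ring \<Rightarrow> (complex poly fract \<Rightarrow> 'k) \<Rightarrow> 'k btK ring" where
  "BTK n K h = base_change ring_S (BT n) (BT_scalar n) K h"

definition BTK_tensor ::
  "nat \<Rightarrow> 'k ring \<Rightarrow> (complex poly fract \<Rightarrow> 'k) \<Rightarrow>
   (bt_gen list \<Rightarrow> complex poly fract) set \<Rightarrow> 'k \<Rightarrow> 'k btK" where
  "BTK_tensor n K h = pure_tensor ring_S (BT n) (BT_scalar n) K h"

definition is_phi ::
  "nat \<Rightarrow> nat \<Rightarrow> 'k ring \<Rightarrow> (complex poly fract \<Rightarrow> 'k) \<Rightarrow> ('k btK \<Rightarrow> 'k yhK) \<Rightarrow> bool" where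
  "is_phi r n K h \<phi> \<longleftrightarrow>
     \<phi> \<in> algebra_hom K (BTK n K h) (\<lambda>k. BTK_tensor n K h \<one>\<^bsub>BT n\<^esub> k)
                      (YHK r n K h) (\<lambda>k. YHK_tensor r n K h \<one>\<^bsub>YH r n\<^esub> k) \<and>
     (\<forall>i \<in> {1..<n}.
        \<phi> (BTK_tensor n K h (BT_g n i) \<one>\<^bsub>K\<^esub>) = YHK_tensor r n K h (YH_g r n i) \<one>\<^bsub>K\<^esub> \<and>
        \<phi> (BTK_tensor n K h (BT_e n i) \<one>\<^bsub>K\<^esub>) = YHK_tensor r n K h (YH_e r n i) \<one>\<^bsub>K\<^esub>)"

end

theory Submission
  imports Defs
begin

text \<open>The elements \<open>e\<^sub>i\<close> generate, under conjugation by the \<open>g\<^sub>k\<close>, commuting idempotents \<open>e\<^sub>i\<^sub>j\<close> with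
  \<open>e\<^sub>i\<^sub>j e\<^sub>j\<^sub>k = e\<^sub>i\<^sub>j e\<^sub>i\<^sub>k\<close>. Hence the product \<open>e\<^sub>A\<close> of the \<open>e\<^sub>i\<^sub>j\<close> with \<open>i\<close>, \<open>j\<close> in a common block of a set
  partition \<open>A\<close> of \<open>{1..n}\<close> makes sense, and the \<open>e\<^sub>A g\<^sub>w\<close>, with one reduced word for each
  permutation \<open>w\<close>, span the algebra of braids and ties. For the linear independence of their images,
  colour the labels \<open>1, \<dots>, n\<close> with \<open>r\<close> colours and let the Yokonuma-Hecke algebra act on functions on
  permutations: \<open>t\<^sub>j\<close> multiplies by the power of \<open>\<xi>\<close> given by the colour of the \<open>j\<close>-th label, and \<open>g\<^sub>i\<close>
  exchanges the labels at positions \<open>i\<close> and \<open>i + 1\<close>, with the Hecke correction term if their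
  colours agree. Evaluated at the identity permutation, \<open>e\<^sub>A g\<^sub>w\<close> becomes evaluation at \<open>w\<close> or zero,
  according to whether or not the colouring is constant on the blocks of \<open>A\<close>. Since \<open>r \<ge> n\<close>, every
  set partition consists of the colour classes of some colouring, so the coefficients of a linear
  relation vanish by induction along the refinement order.\<close>


section \<open>Monoid algebras and their universal property\<close>

text \<open>\<open>K\<close> is only a commutative ring and the tied algebra is given only by a
  presentation, so dimensions cannot be counted. A spanning family and enough linear functionals
  take the place of a basis: the functionals factor through \<open>\<phi>\<close>, so they control
  its kernel without any basis of the Yokonuma-Hecke algebra. The modules imitate the regular module
  of a Hecke algebra, with the correction q - q^-1 placed at descents. A reduced word started at the
  identity meets ascents only, so no correction term ever appears. Ties act by indicator functions
  because differences of distinct powers of \<open>\<xi>\<close> are units, so that character sums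
  are 0 or 1 over any such \<open>K\<close>. For a colouring with classes \<open>Y\<close>, the
  functional at \<open>w\<close> returns the sum of the coefficients at \<open>(Z, w)\<close> over
  all \<open>Z \<subseteq> Y\<close>; this is the triangular shape behind the final induction. On
  the tied side the main labour is with ties of non-adjacent labels. They arise by conjugation, but
  \<open>g k\<close> is not an involution, so it must be proved that conjugation by
  \<open>g k\<close> and by its inverse have the same effect on ties.\<close>

lemma ring_hom_a_minus:
  assumes "ring A" "ring B" "f \<in> ring_hom A B" "x \<in> carrier A" "y \<in> carrier A"
  shows "f (x \<ominus>\<^bsub>A\<^esub> y) = f x \<ominus>\<^bsub>B\<^esub> f y"
proof -
  interpret ring_hom_ring A B f using assms by (intro ring_hom_ringI2)
  show ?thesis using assms(4,5) by (simp add: R.minus_eq S.minus_eq)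
qed

locale monoid_alg = A?: ring A + M: monoid M
  for A :: "('a, 'm) ring_scheme" (structure) and M :: "('b, 'p) monoid_scheme"
begin

abbreviation "F \<equiv> monoid_algebra A M"
abbreviation supp :: "('b \<Rightarrow> 'a) \<Rightarrow> 'b set" where "supp f \<equiv> {x. f x \<noteq> \<zero>}"

lemma F_carrier: "f \<in> carrier F \<longleftrightarrow> (\<forall>x. f x \<in> carrier A) \<and> finite (supp f) \<and> supp f \<subseteq> carrier M"
  by (auto simp: monoid_algebra_def)

lemma F_coeff [simp, intro]: "f \<in> carrier F \<Longrightarrow> f x \<in> carrier A"
  by (simp add: F_carrier)

lemma F_zero: "\<zero>\<^bsub>F\<^esub> = (\<lambda>_. \<zero>)" and F_one: "\<one>\<^bsub>F\<^esub> = monom_elem A \<one>\<^bsub>M\<^esub> \<one>"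
  and F_add: "f \<oplus>\<^bsub>F\<^esub> g = (\<lambda>m. f m \<oplus> g m)"
  by (simp_all add: monoid_algebra_def)

lemma monom_closed [simp, intro]: "m \<in> carrier M \<Longrightarrow> a \<in> carrier A \<Longrightarrow> monom_elem A m a \<in> carrier F"
  by (auto simp: F_carrier monom_elem_def)

lemma F_add_closed: "f \<in> carrier F \<Longrightarrow> g \<in> carrier F \<Longrightarrow> f \<oplus>\<^bsub>F\<^esub> g \<in> carrier F"
  unfolding F_carrier F_add
  by (auto intro!: finite_subset[of "{x. f x \<oplus> g x \<noteq> \<zero>}" "supp f \<union> supp g"]) (metis (mono_tags, lifting) l_zero mem_Collect_eq subsetD zero_closed)

lemma F_abelian: "abelian_group F"
proof (rule abelian_groupI)
  fix f assume f: "f \<in> carrier F"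
  have "(\<lambda>x. \<ominus> f x) \<in> carrier F" using f unfolding F_carrier
    by (auto elim!: finite_subset[rotated])
  then show "\<exists>g\<in>carrier F. g \<oplus>\<^bsub>F\<^esub> f = \<zero>\<^bsub>F\<^esub>"
    using f by (intro bexI[of _ "\<lambda>x. \<ominus> f x"]) (auto simp: F_add F_zero l_neg)
qed (auto simp: F_add_closed[unfolded F_add] F_add F_zero a_ac, auto simp: F_carrier)

text \<open>The defining sum runs over the exact supports, which shrink under cancellation. Allowing
  any finite \<open>U\<close> and \<open>Y\<close> around them puts several products over one index
  set, and distributivity becomes a termwise identity.\<close>

lemma F_mult:
  assumes "f \<in> carrier F" "g \<in> carrier F" "finite U" "supp f \<subseteq> U" "finite Y" "supp g \<subseteq> Y"
  shows "(f \<otimes>\<^bsub>F\<^esub> g) m = (\<Oplus>p\<in>{p \<in> U \<times> Y. fst p \<otimes>\<^bsub>M\<^esub> snd p = m}. f (fst p) \<otimes> g (snd p))"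
proof -
  have "(f \<otimes>\<^bsub>F\<^esub> g) m = finsum A (\<lambda>p. f (fst p) \<otimes> g (snd p))
     {(x, y). f x \<noteq> \<zero> \<and> g y \<noteq> \<zero> \<and> x \<otimes>\<^bsub>M\<^esub> y = m}"
    by (simp add: monoid_algebra_def case_prod_unfold)
  also have "\<dots> = (\<Oplus>p\<in>{p \<in> U \<times> Y. fst p \<otimes>\<^bsub>M\<^esub> snd p = m}. f (fst p) \<otimes> g (snd p))"
    using assms by (intro add.finprod_mono_neutral_cong_left) auto
  finally show ?thesis .
qed

lemma F_mult_closed:
  assumes "f \<in> carrier F" "g \<in> carrier F"
  shows "f \<otimes>\<^bsub>F\<^esub> g \<in> carrier F"
proof -
  have fin: "finite (supp f)" "finite (supp g)" and sub: "supp f \<subseteq> carrier M" "supp g \<subseteq> carrier M"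
    using assms by (auto simp: F_carrier)
  note e = F_mult[OF assms fin(1) subset_refl fin(2) subset_refl]
  have sup: "supp (f \<otimes>\<^bsub>F\<^esub> g) \<subseteq> (\<lambda>p. fst p \<otimes>\<^bsub>M\<^esub> snd p) ` (supp f \<times> supp g)"
  proof
    fix m assume m: "m \<in> supp (f \<otimes>\<^bsub>F\<^esub> g)"
    then have "{p \<in> supp f \<times> supp g. fst p \<otimes>\<^bsub>M\<^esub> snd p = m} \<noteq> {}"
      unfolding e by (intro notI) (simp del: ex_simps)
    then show "m \<in> (\<lambda>p. fst p \<otimes>\<^bsub>M\<^esub> snd p) ` (supp f \<times> supp g)" by blast
  qed
  also have "\<dots> \<subseteq> carrier M" using sub by (force intro: M.m_closed)
  finally have "supp (f \<otimes>\<^bsub>F\<^esub> g) \<subseteq> carrier M" .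
  moreover have "finite (supp (f \<otimes>\<^bsub>F\<^esub> g))"
    by (rule finite_subset[OF sup]) (simp add: fin)
  moreover have "(f \<otimes>\<^bsub>F\<^esub> g) x \<in> carrier A" for x
    unfolding e using assms by (intro finsum_closed) auto
  ultimately show ?thesis by (auto simp: F_carrier)
qed

lemma F_finite_supp: "f \<in> carrier F \<Longrightarrow> finite (supp f)"
  by (simp add: F_carrier)

lemma F_l_distr:
  assumes "f \<in> carrier F" "g \<in> carrier F" "h \<in> carrier F"
  shows "(f \<oplus>\<^bsub>F\<^esub> g) \<otimes>\<^bsub>F\<^esub> h = f \<otimes>\<^bsub>F\<^esub> h \<oplus>\<^bsub>F\<^esub> g \<otimes>\<^bsub>F\<^esub> h"
proof
  fix m
  define P where "P = {p \<in> (supp f \<union> supp g) \<times> supp h. fst p \<otimes>\<^bsub>M\<^esub> snd p = m}"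
  have fin: "finite (supp f \<union> supp g)" "finite (supp h)" using assms by (auto simp: F_carrier)
  have fg: "f \<oplus>\<^bsub>F\<^esub> g \<in> carrier F" using assms F_add_closed by blast
  have "((f \<oplus>\<^bsub>F\<^esub> g) \<otimes>\<^bsub>F\<^esub> h) m = (\<Oplus>p\<in>P. (f \<oplus>\<^bsub>F\<^esub> g) (fst p) \<otimes> h (snd p))"
    unfolding P_def by (rule F_mult[OF fg assms(3) fin(1) _ fin(2)]) (auto simp: F_add)
  also have "\<dots> = (\<Oplus>p\<in>P. f (fst p) \<otimes> h (snd p) \<oplus> g (fst p) \<otimes> h (snd p))"
    using assms by (intro finsum_cong') (auto simp: F_add l_distr)
  also have "\<dots> = (\<Oplus>p\<in>P. f (fst p) \<otimes> h (snd p)) \<oplus> (\<Oplus>p\<in>P. g (fst p) \<otimes> h (snd p))"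
    using assms by (intro finsum_addf) auto
  also have "(\<Oplus>p\<in>P. f (fst p) \<otimes> h (snd p)) = (f \<otimes>\<^bsub>F\<^esub> h) m"
    unfolding P_def by (rule F_mult[OF assms(1) assms(3) fin(1) _ fin(2), symmetric]) auto
  also have "(\<Oplus>p\<in>P. g (fst p) \<otimes> h (snd p)) = (g \<otimes>\<^bsub>F\<^esub> h) m"
    unfolding P_def by (rule F_mult[OF assms(2) assms(3) fin(1) _ fin(2), symmetric]) auto
  finally show "((f \<oplus>\<^bsub>F\<^esub> g) \<otimes>\<^bsub>F\<^esub> h) m = (f \<otimes>\<^bsub>F\<^esub> h \<oplus>\<^bsub>F\<^esub> g \<otimes>\<^bsub>F\<^esub> h) m" by (simp add: F_add)
qed

lemma F_r_distr:
  assumes "f \<in> carrier F" "g \<in> carrier F" "h \<in> carrier F"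
  shows "h \<otimes>\<^bsub>F\<^esub> (f \<oplus>\<^bsub>F\<^esub> g) = h \<otimes>\<^bsub>F\<^esub> f \<oplus>\<^bsub>F\<^esub> h \<otimes>\<^bsub>F\<^esub> g"
proof
  fix m
  define P where "P = {p \<in> supp h \<times> (supp f \<union> supp g). fst p \<otimes>\<^bsub>M\<^esub> snd p = m}"
  have fin: "finite (supp f \<union> supp g)" "finite (supp h)" using assms by (auto simp: F_carrier)
  have fg: "f \<oplus>\<^bsub>F\<^esub> g \<in> carrier F" using assms F_add_closed by blast
  have "(h \<otimes>\<^bsub>F\<^esub> (f \<oplus>\<^bsub>F\<^esub> g)) m = (\<Oplus>p\<in>P. h (fst p) \<otimes> (f \<oplus>\<^bsub>F\<^esub> g) (snd p))"
    unfolding P_def by (rule F_mult[OF assms(3) fg fin(2) _ fin(1)]) (auto simp: F_add)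
  also have "\<dots> = (\<Oplus>p\<in>P. h (fst p) \<otimes> f (snd p) \<oplus> h (fst p) \<otimes> g (snd p))"
    using assms by (intro finsum_cong') (auto simp: F_add r_distr)
  also have "\<dots> = (\<Oplus>p\<in>P. h (fst p) \<otimes> f (snd p)) \<oplus> (\<Oplus>p\<in>P. h (fst p) \<otimes> g (snd p))"
    using assms by (intro finsum_addf) auto
  also have "(\<Oplus>p\<in>P. h (fst p) \<otimes> f (snd p)) = (h \<otimes>\<^bsub>F\<^esub> f) m"
    unfolding P_def by (rule F_mult[OF assms(3) assms(1) fin(2) _ fin(1), symmetric]) auto
  also have "(\<Oplus>p\<in>P. h (fst p) \<otimes> g (snd p)) = (h \<otimes>\<^bsub>F\<^esub> g) m"
    unfolding P_def by (rule F_mult[OF assms(3) assms(2) fin(2) _ fin(1), symmetric]) auto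
  finally show "(h \<otimes>\<^bsub>F\<^esub> (f \<oplus>\<^bsub>F\<^esub> g)) m = (h \<otimes>\<^bsub>F\<^esub> f \<oplus>\<^bsub>F\<^esub> h \<otimes>\<^bsub>F\<^esub> g) m" by (simp add: F_add)
qed

lemma monom_mult:
  assumes "m \<in> carrier M" "a \<in> carrier A" "m' \<in> carrier M" "b \<in> carrier A"
  shows "monom_elem A m a \<otimes>\<^bsub>F\<^esub> monom_elem A m' b = monom_elem A (m \<otimes>\<^bsub>M\<^esub> m') (a \<otimes> b)"
proof
  fix x
  have "(monom_elem A m a \<otimes>\<^bsub>F\<^esub> monom_elem A m' b) x
     = (\<Oplus>p\<in>{p \<in> {m} \<times> {m'}. fst p \<otimes>\<^bsub>M\<^esub> snd p = x}. monom_elem A m a (fst p) \<otimes> monom_elem A m' b (snd p))"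
    using assms by (intro F_mult monom_closed) (auto simp: monom_elem_def)
  also have "{p \<in> {m} \<times> {m'}. fst p \<otimes>\<^bsub>M\<^esub> snd p = x} = (if m \<otimes>\<^bsub>M\<^esub> m' = x then {(m, m')} else {})"
    by auto
  finally show "(monom_elem A m a \<otimes>\<^bsub>F\<^esub> monom_elem A m' b) x = monom_elem A (m \<otimes>\<^bsub>M\<^esub> m') (a \<otimes> b) x"
    using assms by (auto simp: monom_elem_def finsum_insert)
qed

lemma monom_add:
  "a \<in> carrier A \<Longrightarrow> b \<in> carrier A \<Longrightarrow>
    monom_elem A m a \<oplus>\<^bsub>F\<^esub> monom_elem A m b = monom_elem A m (a \<oplus> b)"
  by (auto simp: F_add monom_elem_def)

lemma monom_zero: "monom_elem A m \<zero> = \<zero>\<^bsub>F\<^esub>"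
  by (auto simp: F_zero monom_elem_def)

text \<open>Induction on the support: one monomial is split off and the rest has one support point
  less. Identities that are additive in each argument are thereby reduced to monomials.\<close>

lemma F_induct [consumes 1, case_names zero add]:
  assumes "f \<in> carrier F" and "P \<zero>\<^bsub>F\<^esub>"
    and "\<And>m a g. m \<in> carrier M \<Longrightarrow> a \<in> carrier A \<Longrightarrow> g \<in> carrier F \<Longrightarrow> P g \<Longrightarrow>
           g m = \<zero> \<Longrightarrow> P (monom_elem A m a \<oplus>\<^bsub>F\<^esub> g)"
  shows "P f"
proof -
  have "finite U \<Longrightarrow> f \<in> carrier F \<Longrightarrow> supp f = U \<Longrightarrow> P f" for f U
  proof (induction U arbitrary: f rule: finite_induct)
    case empty
    then have "f = \<zero>\<^bsub>F\<^esub>" by (auto simp: F_zero)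
    then show ?case using assms(2) by simp
  next
    case (insert m U)
    define g where "g = f(m := \<zero>)"
    have sg: "supp g = U" using insert unfolding g_def by auto
    have g: "g \<in> carrier F" using insert(1,4,5) sg unfolding F_carrier by (auto simp: g_def)
    have m: "m \<in> carrier M" using insert(4,5) by (auto simp: F_carrier)
    have f: "f = monom_elem A m (f m) \<oplus>\<^bsub>F\<^esub> g"
      using insert(4) by (auto simp: F_add g_def monom_elem_def)
    have "P g" using insert.IH g sg by blast
    then show ?case
      using assms(3)[OF m _ g, of "f m"] f insert(4) by (simp add: g_def)
  qed
  then show ?thesis using assms(1) F_finite_supp by blast
qed

lemma F_zero_mult: "f \<in> carrier F \<Longrightarrow> \<zero>\<^bsub>F\<^esub> \<otimes>\<^bsub>F\<^esub> f = \<zero>\<^bsub>F\<^esub>" "f \<in> carrier F \<Longrightarrow> f \<otimes>\<^bsub>F\<^esub> \<zero>\<^bsub>F\<^esub> = \<zero>\<^bsub>F\<^esub>"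
  by (auto simp: monoid_algebra_def)

text \<open>On monomials associativity is that of \<open>M\<close> and \<open>A\<close>. Additivity
  extends it to an arbitrary third, then second, then first factor (\<open>mm\<close>,
  \<open>ma\<close>, \<open>assoc\<close>).\<close>

lemma F_ring: "ring F"
proof -
  interpret G: abelian_group F by (rule F_abelian)
  note cl = F_mult_closed F_add_closed
  have mm: "monom_elem A m a \<otimes>\<^bsub>F\<^esub> monom_elem A m' b \<otimes>\<^bsub>F\<^esub> h =
      monom_elem A m a \<otimes>\<^bsub>F\<^esub> (monom_elem A m' b \<otimes>\<^bsub>F\<^esub> h)"
    if "m \<in> carrier M" "a \<in> carrier A" "m' \<in> carrier M" "b \<in> carrier A" "h \<in> carrier F" for m a m' b h
    using that(5,1-4)
    by (induction rule: F_induct) (simp_all add: monom_mult F_zero_mult F_r_distr cl M.m_assoc m_assoc)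
  have ma: "monom_elem A m a \<otimes>\<^bsub>F\<^esub> g \<otimes>\<^bsub>F\<^esub> h = monom_elem A m a \<otimes>\<^bsub>F\<^esub> (g \<otimes>\<^bsub>F\<^esub> h)"
    if "m \<in> carrier M" "a \<in> carrier A" "g \<in> carrier F" "h \<in> carrier F" for m a g h
    using that(3,1,2,4)
    by (induction rule: F_induct) (simp_all add: F_zero_mult F_r_distr F_l_distr cl mm)
  have assoc: "f \<otimes>\<^bsub>F\<^esub> g \<otimes>\<^bsub>F\<^esub> h = f \<otimes>\<^bsub>F\<^esub> (g \<otimes>\<^bsub>F\<^esub> h)"
    if "f \<in> carrier F" "g \<in> carrier F" "h \<in> carrier F" for f g h
    using that
    by (induction rule: F_induct) (simp_all add: F_zero_mult F_l_distr cl ma)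
  have 1: "\<one>\<^bsub>F\<^esub> \<in> carrier F" by (simp add: F_one)
  have l: "\<one>\<^bsub>F\<^esub> \<otimes>\<^bsub>F\<^esub> f = f" if "f \<in> carrier F" for f
    using that 1 by (induction rule: F_induct) (simp_all add: F_zero_mult F_r_distr, simp add: F_one monom_mult)
  have r: "f \<otimes>\<^bsub>F\<^esub> \<one>\<^bsub>F\<^esub> = f" if "f \<in> carrier F" for f
    using that 1 by (induction rule: F_induct) (simp_all add: F_zero_mult F_l_distr, simp add: F_one monom_mult)
  show ?thesis
    by (intro ringI monoidI F_abelian F_mult_closed 1 assoc l r F_l_distr F_r_distr)
qed

text \<open>Universal property of the monoid algebra. The hypothesis \<open>comm\<close> lets
  \<open>\<eta> b\<close> move past \<open>\<mu> m\<close>, which is what makes the extension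
  multiplicative into a possibly noncommutative target.\<close>

lemma F_lift:
  assumes B: "ring B" and \<eta>: "\<eta> \<in> ring_hom A B" and \<mu>: "\<mu> \<in> hom M B" and \<mu>1: "\<mu> \<one>\<^bsub>M\<^esub> = \<one>\<^bsub>B\<^esub>"
    and comm: "\<And>a m. a \<in> carrier A \<Longrightarrow> m \<in> carrier M \<Longrightarrow> \<eta> a \<otimes>\<^bsub>B\<^esub> \<mu> m = \<mu> m \<otimes>\<^bsub>B\<^esub> \<eta> a"
  obtains \<Phi> where "\<Phi> \<in> ring_hom F B"
    "\<And>m a. m \<in> carrier M \<Longrightarrow> a \<in> carrier A \<Longrightarrow> \<Phi> (monom_elem A m a) = \<eta> a \<otimes>\<^bsub>B\<^esub> \<mu> m"
proof -
  interpret B: ring B by (rule B)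
  interpret F: ring F by (rule F_ring)
  interpret \<eta>: ring_hom_ring A B \<eta> using \<eta> by (intro ring_hom_ringI2) unfold_locales
  have \<mu>c[simp]: "m \<in> carrier M \<Longrightarrow> \<mu> m \<in> carrier B" for m using \<mu> by (auto simp: hom_def)
  have \<mu>m: "m \<in> carrier M \<Longrightarrow> m' \<in> carrier M \<Longrightarrow> \<mu> (m \<otimes>\<^bsub>M\<^esub> m') = \<mu> m \<otimes>\<^bsub>B\<^esub> \<mu> m'" for m m'
    using \<mu> by (auto simp: hom_def)
  define \<Phi> where "\<Phi> f = (\<Oplus>\<^bsub>B\<^esub>m\<in>supp f. \<eta> (f m) \<otimes>\<^bsub>B\<^esub> \<mu> m)" for f
  have Phi_eq: "\<Phi> f = (\<Oplus>\<^bsub>B\<^esub>m\<in>U. \<eta> (f m) \<otimes>\<^bsub>B\<^esub> \<mu> m)"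
    if "f \<in> carrier F" "finite U" "supp f \<subseteq> U" "U \<subseteq> carrier M" for f U
    unfolding \<Phi>_def using that by (intro B.add.finprod_mono_neutral_cong_left) auto
  have cl: "\<Phi> f \<in> carrier B" if "f \<in> carrier F" for f
    unfolding \<Phi>_def using that by (intro B.finsum_closed) (auto simp: F_carrier)
  have mon: "\<Phi> (monom_elem A m a) = \<eta> a \<otimes>\<^bsub>B\<^esub> \<mu> m" if "m \<in> carrier M" "a \<in> carrier A" for m a
    using that by (subst Phi_eq[of _ "{m}", OF monom_closed]) (auto simp: monom_elem_def)
  have add: "\<Phi> (f \<oplus>\<^bsub>F\<^esub> g) = \<Phi> f \<oplus>\<^bsub>B\<^esub> \<Phi> g" if f: "f \<in> carrier F" and g: "g \<in> carrier F" for f g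
  proof -
    define U where "U = supp f \<union> supp g"
    have U: "finite U" "supp f \<subseteq> U" "supp g \<subseteq> U" "supp (f \<oplus>\<^bsub>F\<^esub> g) \<subseteq> U" "U \<subseteq> carrier M"
      unfolding U_def using f g by (auto simp: F_carrier F_add)
    have "\<Phi> (f \<oplus>\<^bsub>F\<^esub> g) = (\<Oplus>\<^bsub>B\<^esub>m\<in>U. \<eta> (f m) \<otimes>\<^bsub>B\<^esub> \<mu> m \<oplus>\<^bsub>B\<^esub> \<eta> (g m) \<otimes>\<^bsub>B\<^esub> \<mu> m)"
      using f g U(5) by (subst Phi_eq[OF F_add_closed[OF f g] U(1,4,5)], intro B.finsum_cong')
        (auto simp: F_add B.l_distr subset_eq)
    also have "\<dots> = \<Phi> f \<oplus>\<^bsub>B\<^esub> \<Phi> g" unfolding Phi_eq[OF f U(1,2,5)] Phi_eq[OF g U(1,3,5)]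
      using f g U(5) by (intro B.finsum_addf) auto
    finally show ?thesis .
  qed
  have z: "\<Phi> \<zero>\<^bsub>F\<^esub> = \<zero>\<^bsub>B\<^esub>" by (simp add: \<Phi>_def F_zero)
  have mult1: "\<Phi> (monom_elem A m a \<otimes>\<^bsub>F\<^esub> g) = \<Phi> (monom_elem A m a) \<otimes>\<^bsub>B\<^esub> \<Phi> g"
    if "m \<in> carrier M" "a \<in> carrier A" "g \<in> carrier F" for m a g
    using that(3,1,2)
  proof (induction rule: F_induct)
    case zero then show ?case by (simp add: cl z)
  next
    case (add m' b g)
    have "\<Phi> (monom_elem A m a \<otimes>\<^bsub>F\<^esub> monom_elem A m' b) =
       \<Phi> (monom_elem A m a) \<otimes>\<^bsub>B\<^esub> \<Phi> (monom_elem A m' b)"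
    proof -
      have "\<eta> a \<otimes>\<^bsub>B\<^esub> \<eta> b \<otimes>\<^bsub>B\<^esub> (\<mu> m \<otimes>\<^bsub>B\<^esub> \<mu> m') = \<eta> a \<otimes>\<^bsub>B\<^esub> (\<eta> b \<otimes>\<^bsub>B\<^esub> \<mu> m) \<otimes>\<^bsub>B\<^esub> \<mu> m'"
        using add by (simp add: B.m_assoc)
      also have "\<dots> = \<eta> a \<otimes>\<^bsub>B\<^esub> \<mu> m \<otimes>\<^bsub>B\<^esub> (\<eta> b \<otimes>\<^bsub>B\<^esub> \<mu> m')"
        using add by (simp only: comm[of b m]) (simp add: B.m_assoc)
      finally show ?thesis using add by (simp add: monom_mult mon \<mu>m)
    qed
    then show ?case using add
      by (simp add: F.r_distr \<open>\<And>f g. f \<in> carrier F \<Longrightarrow> g \<in> carrier F \<Longrightarrow> \<Phi> (f \<oplus>\<^bsub>F\<^esub> g) = \<Phi> f \<oplus>\<^bsub>B\<^esub> \<Phi> g\<close> cl B.r_distr)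
  qed
  have mult: "\<Phi> (f \<otimes>\<^bsub>F\<^esub> g) = \<Phi> f \<otimes>\<^bsub>B\<^esub> \<Phi> g" if "f \<in> carrier F" "g \<in> carrier F" for f g
    using that
    by (induction rule: F_induct) (simp_all add: cl z F.l_distr add mult1 B.l_distr)
  have "\<Phi> \<in> ring_hom F B"
    by (intro ring_hom_memI cl mult add) (auto simp: F_one mon \<mu>1)
  then show thesis using mon that by blast
qed

end

section \<open>Quotients and presented algebras\<close>

lemma quotient_lift:
  assumes "ring F" "ring B" and \<Phi>: "\<Phi> \<in> ring_hom F B" and S: "S \<subseteq> carrier F"
    and ann: "\<And>s. s \<in> S \<Longrightarrow> \<Phi> s = \<zero>\<^bsub>B\<^esub>"
  obtains \<Psi> where "\<Psi> \<in> ring_hom (F Quot Idl\<^bsub>F\<^esub> S) B"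
    "\<And>x. x \<in> carrier F \<Longrightarrow> \<Psi> (Idl\<^bsub>F\<^esub> S +>\<^bsub>F\<^esub> x) = \<Phi> x"
proof -
  interpret R: ring F by fact
  interpret B: ring B by fact
  define I where "I = Idl\<^bsub>F\<^esub> S"
  have I: "ideal I F" unfolding I_def by (rule R.genideal_ideal[OF S])
  interpret I: ideal I F by (rule I)
  have "S \<subseteq> a_kernel F B \<Phi>"
    unfolding a_kernel_def' using S ann by blast
  then have "I \<subseteq> a_kernel F B \<Phi>"
    unfolding I_def using assms
    by (intro R.genideal_minimal ring_hom_ring.kernel_is_ideal ring_hom_ringI2)
  then have ker: "\<Phi> i = \<zero>\<^bsub>B\<^esub>" if "i \<in> I" for i using that unfolding a_kernel_def' by blast
  \<comment> \<open>\<open>\<Phi>\<close> takes a single value on each coset because the ideal lies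
    in its kernel, so the image of a coset is a singleton and no representative has to be
    chosen.\<close>
  define \<Psi> where "\<Psi> U = the_elem (\<Phi> ` U)" for U
  have img: "\<Phi> ` (I +>\<^bsub>F\<^esub> x) = {\<Phi> x}" if x: "x \<in> carrier F" for x
  proof -
    have "x \<in> I +>\<^bsub>F\<^esub> x" using x by (rule I.a_rcos_self)
    moreover have "\<Phi> y = \<Phi> x" if y: "y \<in> I +>\<^bsub>F\<^esub> x" for y
    proof -
      have "\<exists>i\<in>I. y = i \<oplus>\<^bsub>F\<^esub> x" using y by (simp only: a_r_coset_def') simp
      then obtain i where i: "i \<in> I" "y = i \<oplus>\<^bsub>F\<^esub> x" by blast
      then show ?thesis
        using x ker[OF i(1)] I.a_Hcarr[OF i(1)] ring_hom_add[OF \<Phi>, of i x] ring_hom_closed[OF \<Phi>, of x]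
        by simp
    qed
    ultimately show ?thesis by blast
  qed
  have \<Psi>: "\<Psi> (I +>\<^bsub>F\<^esub> x) = \<Phi> x" if "x \<in> carrier F" for x
    using img[OF that] by (simp add: \<Psi>_def)
  note q = I.rcos_ring_hom
  have c: "\<exists>x\<in>carrier F. U = I +>\<^bsub>F\<^esub> x" if "U \<in> carrier (F Quot I)" for U
    using that unfolding FactRing_def A_RCOSETS_def' by simp
  have "\<Psi> \<in> ring_hom (F Quot I) B"
  proof (rule ring_hom_memI)
    fix U assume "U \<in> carrier (F Quot I)"
    from c[OF this] obtain x where "x \<in> carrier F" "U = I +>\<^bsub>F\<^esub> x" ..
    then show "\<Psi> U \<in> carrier B" using \<Psi> ring_hom_closed[OF \<Phi>] by simp
  next
    fix U V assume U: "U \<in> carrier (F Quot I)" and V: "V \<in> carrier (F Quot I)"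
    from c[OF U] c[OF V] obtain x y
      where xy: "x \<in> carrier F" "U = I +>\<^bsub>F\<^esub> x" "y \<in> carrier F" "V = I +>\<^bsub>F\<^esub> y"
      by auto
    then have "U \<otimes>\<^bsub>F Quot I\<^esub> V = I +>\<^bsub>F\<^esub> (x \<otimes>\<^bsub>F\<^esub> y)" "U \<oplus>\<^bsub>F Quot I\<^esub> V = I +>\<^bsub>F\<^esub> (x \<oplus>\<^bsub>F\<^esub> y)"
      using ring_hom_mult[OF q] ring_hom_add[OF q] by simp_all
    then show "\<Psi> (U \<otimes>\<^bsub>F Quot I\<^esub> V) = \<Psi> U \<otimes>\<^bsub>B\<^esub> \<Psi> V" "\<Psi> (U \<oplus>\<^bsub>F Quot I\<^esub> V) = \<Psi> U \<oplus>\<^bsub>B\<^esub> \<Psi> V"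
      using xy \<Psi> ring_hom_add[OF \<Phi>] ring_hom_mult[OF \<Phi>] by simp_all
  next
    show "\<Psi> \<one>\<^bsub>F Quot I\<^esub> = \<one>\<^bsub>B\<^esub>"
      using \<Psi>[OF R.one_closed] ring_hom_one[OF q] ring_hom_one[OF \<Phi>] by simp
  qed
  then show thesis using \<Psi> unfolding I_def by (rule that)
qed

lemma quotient_eq_iff:
  assumes "ring F" "ideal I F" "x \<in> carrier F" "y \<in> carrier F" "x \<ominus>\<^bsub>F\<^esub> y \<in> I"
  shows "I +>\<^bsub>F\<^esub> x = I +>\<^bsub>F\<^esub> y"
  using ring.quotient_eq_iff_same_a_r_cos[OF assms(1-4)] assms(5) by blast

section \<open>Algebras by generators and relations: induction and universal property\<close>

locale presented = A: cring A for A :: "('a, 'm) ring_scheme" and G :: "'x set"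
  and Rel :: "(('x list \<Rightarrow> 'a) \<times> ('x list \<Rightarrow> 'a)) set" +
  assumes Rel: "(u, v) \<in> Rel \<Longrightarrow> u \<in> carrier (free_algebra A G) \<and> v \<in> carrier (free_algebra A G)"
begin

abbreviation "F \<equiv> free_algebra A G"
abbreviation "P \<equiv> presented_algebra A G Rel"
abbreviation "cls \<equiv> presented_class A G Rel"
abbreviation "I \<equiv> relation_ideal A G Rel"

lemma free_monoid_simps [simp]:
  "w \<in> carrier (free_monoid G) \<longleftrightarrow> set w \<subseteq> G" "v \<otimes>\<^bsub>free_monoid G\<^esub> w = v @ w" "\<one>\<^bsub>free_monoid G\<^esub> = []"
  by (auto simp: free_monoid_def)

sublocale M: monoid "free_monoid G"
  by unfold_locales auto

sublocale F: monoid_alg A "free_monoid G"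
  by unfold_locales

lemma F_eq: "F.F = F" by (simp add: free_algebra_def)

sublocale R: ring F
  using F.F_ring by (simp add: F_eq)

lemma rel_sub: "(\<lambda>(u, v). u \<ominus>\<^bsub>F\<^esub> v) ` Rel \<subseteq> carrier F"
  using Rel by auto

lemma I_ideal: "ideal I F"
  unfolding relation_ideal_def by (rule R.genideal_ideal[OF rel_sub])

sublocale I: ideal I F by (rule I_ideal)

sublocale P: ring P
  unfolding presented_algebra_def by (rule I.quotient_is_ring)

lemma cls_hom: "cls \<in> ring_hom F P"
proof -
  have "cls = (+>\<^bsub>F\<^esub>) I" by (rule ext) (simp add: presented_class_def)
  then show ?thesis using I.rcos_ring_hom by (simp add: presented_algebra_def)
qed

sublocale cls: ring_hom_ring F P cls
  by (intro ring_hom_ringI2 cls_hom) unfold_locales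

lemma cls_rel: "(u, v) \<in> Rel \<Longrightarrow> cls u = cls v"
  unfolding presented_class_def
  using Rel[of u v] R.genideal_self[OF rel_sub]
  by (intro quotient_eq_iff R.ring_axioms I_ideal) (auto simp: relation_ideal_def image_def)

lemma cls_surj: "x \<in> carrier P \<Longrightarrow> \<exists>u\<in>carrier F. x = cls u"
  by (auto simp: presented_algebra_def presented_class_def FactRing_def A_RCOSETS_def')

lemma const_closed [simp, intro]: "a \<in> carrier A \<Longrightarrow> free_const A a \<in> carrier F"
  unfolding free_const_def F_eq[symmetric] by (rule F.monom_closed) auto

lemma gen_closed [simp, intro]: "x \<in> G \<Longrightarrow> free_gen A x \<in> carrier F"
  unfolding free_gen_def F_eq[symmetric] by (rule F.monom_closed) auto

lemma monom_const:
  "a \<in> carrier A \<Longrightarrow> set w \<subseteq> G \<Longrightarrow>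
    monom_elem A w a = free_const A a \<otimes>\<^bsub>F\<^esub> monom_elem A w \<one>\<^bsub>A\<^esub>"
  by (simp add: free_const_def F_eq[symmetric] F.monom_mult)

lemma monom_Cons:
  "set w \<subseteq> G \<Longrightarrow> x \<in> G \<Longrightarrow>
    monom_elem A (x # w) \<one>\<^bsub>A\<^esub> = free_gen A x \<otimes>\<^bsub>F\<^esub> monom_elem A w \<one>\<^bsub>A\<^esub>"
  by (simp add: free_gen_def F_eq[symmetric] F.monom_mult)

lemma F_one_const: "free_const A \<one>\<^bsub>A\<^esub> = \<one>\<^bsub>F\<^esub>"
  by (simp add: free_const_def F_eq[symmetric] F.F_one)

lemma monom_in: "set w \<subseteq> G \<Longrightarrow> a \<in> carrier A \<Longrightarrow> monom_elem A w a \<in> carrier F"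
  unfolding F_eq[symmetric] by (rule F.monom_closed) auto

lemma const_hom: "free_const A \<in> ring_hom A F"
  by (rule ring_hom_memI) (simp_all add: F_one_const, simp_all add: free_const_def F_eq[symmetric] F.monom_mult F.monom_add)

lemma scalar_hom: "(\<lambda>a. cls (free_const A a)) \<in> ring_hom A P"
  using ring_hom_trans[OF const_hom cls_hom] by (simp add: comp_def)

text \<open>Every word arises from the empty one by left multiplication with generators, so
  one-sided multiplication suffices. Zero has no case of its own: it is the constant 0 times the
  unit.\<close>

lemma free_induct:
  assumes u: "u \<in> carrier F"
    and one: "Q \<one>\<^bsub>F\<^esub>"
    and add: "\<And>x y. x \<in> carrier F \<Longrightarrow> y \<in> carrier F \<Longrightarrow> Q x \<Longrightarrow> Q y \<Longrightarrow> Q (x \<oplus>\<^bsub>F\<^esub> y)"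
    and const: "\<And>a x. a \<in> carrier A \<Longrightarrow> x \<in> carrier F \<Longrightarrow> Q x \<Longrightarrow> Q (free_const A a \<otimes>\<^bsub>F\<^esub> x)"
    and gen: "\<And>g x. g \<in> G \<Longrightarrow> x \<in> carrier F \<Longrightarrow> Q x \<Longrightarrow> Q (free_gen A g \<otimes>\<^bsub>F\<^esub> x)"
  shows "Q u"
proof -
  have m: "Q (monom_elem A w \<one>\<^bsub>A\<^esub>)" if "set w \<subseteq> G" for w
    using that
  proof (induction w)
    case Nil
    then show ?case using one by (simp add: F_one_const[symmetric] free_const_def)
  next
    case (Cons x w)
    then show ?case using gen[OF _ monom_in[OF _ A.one_closed], of x w] monom_Cons[of w x] by simp
  qed
  have m': "Q (monom_elem A w a)" if "set w \<subseteq> G" "a \<in> carrier A" for w a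
    unfolding monom_const[OF that(2,1)]
    by (rule const[OF that(2) monom_in[OF that(1) A.one_closed] m[OF that(1)]])
  have z: "Q \<zero>\<^bsub>F\<^esub>"
    using const[OF A.zero_closed R.one_closed one]
    by (simp add: free_const_def F.monom_zero[unfolded F_eq])
  have "u \<in> carrier F.F" using u by (simp add: F_eq)
  then show ?thesis
  proof (induction rule: F.F_induct)
    case zero
    then show ?case using z by (simp add: F_eq)
  next
    case (add m a g)
    then have m: "set m \<subseteq> G" by auto
    show ?case unfolding F_eq
      by (rule assms(3)[OF monom_in[OF m add(2)] add(3)[unfolded F_eq] m'[OF m add(2)] add(5)])
  qed
qed

lemma presented_induct [consumes 1, case_names one add const gen]:
  assumes u: "u \<in> carrier P"
    and one: "Q \<one>\<^bsub>P\<^esub>"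
    and add: "\<And>x y. x \<in> carrier P \<Longrightarrow> y \<in> carrier P \<Longrightarrow> Q x \<Longrightarrow> Q y \<Longrightarrow> Q (x \<oplus>\<^bsub>P\<^esub> y)"
    and const: "\<And>a x. a \<in> carrier A \<Longrightarrow> x \<in> carrier P \<Longrightarrow> Q x \<Longrightarrow> Q (cls (free_const A a) \<otimes>\<^bsub>P\<^esub> x)"
    and gen: "\<And>g x. g \<in> G \<Longrightarrow> x \<in> carrier P \<Longrightarrow> Q x \<Longrightarrow> Q (cls (free_gen A g) \<otimes>\<^bsub>P\<^esub> x)"
  shows "Q u"
proof -
  obtain v where v: "v \<in> carrier F" "u = cls v" using cls_surj[OF u] by blast
  have "Q (cls v)"
    by (rule free_induct[OF v(1)])
      (simp_all add: one add const gen)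
  then show ?thesis using v by simp
qed

text \<open>The obligation \<open>rel\<close> speaks of an arbitrary \<open>\<Phi>\<close> with the
  prescribed values because the relations are written inside the free algebra: their images can be
  computed from \<open>\<eta>\<close> and \<open>\<gamma>\<close> alone.\<close>

lemma presented_lift:
  assumes B: "ring B" and \<eta>: "\<eta> \<in> ring_hom A B" and \<gamma>: "\<And>x. x \<in> G \<Longrightarrow> \<gamma> x \<in> carrier B"
    and comm: "\<And>a x. a \<in> carrier A \<Longrightarrow> x \<in> G \<Longrightarrow> \<eta> a \<otimes>\<^bsub>B\<^esub> \<gamma> x = \<gamma> x \<otimes>\<^bsub>B\<^esub> \<eta> a"
    and rel: "\<And>\<Phi> u v. \<Phi> \<in> ring_hom F B \<Longrightarrow> (\<And>a. a \<in> carrier A \<Longrightarrow> \<Phi> (free_const A a) = \<eta> a) \<Longrightarrow>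
       (\<And>x. x \<in> G \<Longrightarrow> \<Phi> (free_gen A x) = \<gamma> x) \<Longrightarrow> (u, v) \<in> Rel \<Longrightarrow> \<Phi> u = \<Phi> v"
  obtains \<Psi> where "\<Psi> \<in> ring_hom P B" "\<And>a. a \<in> carrier A \<Longrightarrow> \<Psi> (cls (free_const A a)) = \<eta> a"
    "\<And>x. x \<in> G \<Longrightarrow> \<Psi> (cls (free_gen A x)) = \<gamma> x"
proof -
  interpret B: ring B by (rule B)
  define \<mu> where "\<mu> w = foldr (\<lambda>x y. \<gamma> x \<otimes>\<^bsub>B\<^esub> y) w \<one>\<^bsub>B\<^esub>" for w
  have \<mu>c: "\<mu> w \<in> carrier B" if "set w \<subseteq> G" for w
    using that by (induction w) (auto simp: \<mu>_def \<gamma>)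
  have \<mu>a: "\<mu> (w @ w') = \<mu> w \<otimes>\<^bsub>B\<^esub> \<mu> w'" if "set w \<subseteq> G" "set w' \<subseteq> G" for w w'
    using that(1)
  proof (induction w)
    case Nil then show ?case using \<mu>c[OF that(2)] by (simp add: \<mu>_def)
  next
    case (Cons x w)
    have "\<mu> (x # u) = \<gamma> x \<otimes>\<^bsub>B\<^esub> \<mu> u" for u by (simp add: \<mu>_def)
    then show ?case using Cons \<mu>c[OF that(2)] \<mu>c[of w] by (simp add: B.m_assoc \<gamma>)
  qed
  have \<eta>c: "a \<in> carrier A \<Longrightarrow> \<eta> a \<in> carrier B" for a using \<eta> by (rule ring_hom_closed)
  have \<mu>comm: "\<eta> a \<otimes>\<^bsub>B\<^esub> \<mu> w = \<mu> w \<otimes>\<^bsub>B\<^esub> \<eta> a" if "set w \<subseteq> G" "a \<in> carrier A" for a w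
    using that(1)
  proof (induction w)
    case Nil then show ?case using \<eta>c[OF that(2)] by (simp add: \<mu>_def)
  next
    case (Cons x w)
    have e: "\<mu> (x # u) = \<gamma> x \<otimes>\<^bsub>B\<^esub> \<mu> u" for u by (simp add: \<mu>_def)
    have w: "\<mu> w \<in> carrier B" "\<gamma> x \<in> carrier B" "\<eta> a \<in> carrier B" using Cons \<mu>c \<gamma> \<eta>c that by auto
    have "\<eta> a \<otimes>\<^bsub>B\<^esub> (\<gamma> x \<otimes>\<^bsub>B\<^esub> \<mu> w) = (\<eta> a \<otimes>\<^bsub>B\<^esub> \<gamma> x) \<otimes>\<^bsub>B\<^esub> \<mu> w"
      using w by (simp add: B.m_assoc)
    also have "\<dots> = \<gamma> x \<otimes>\<^bsub>B\<^esub> (\<eta> a \<otimes>\<^bsub>B\<^esub> \<mu> w)"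
      using w comm[OF that(2), of x] Cons by (simp add: B.m_assoc)
    also have "\<eta> a \<otimes>\<^bsub>B\<^esub> \<mu> w = \<mu> w \<otimes>\<^bsub>B\<^esub> \<eta> a" using Cons by simp
    finally show ?case using w by (simp add: e B.m_assoc)
  qed
  obtain \<Phi> where \<Phi>: "\<Phi> \<in> ring_hom F.F B"
    "\<And>m a. m \<in> carrier (free_monoid G) \<Longrightarrow> a \<in> carrier A \<Longrightarrow> \<Phi> (monom_elem A m a) = \<eta> a \<otimes>\<^bsub>B\<^esub> \<mu> m"
    by (rule F.F_lift[OF B \<eta>, of \<mu>])
      (auto simp: hom_def \<mu>c \<mu>a \<mu>comm lists_eq_set, simp_all add: \<mu>_def)
  have h: "\<Phi> \<in> ring_hom F B" using \<Phi>(1) by (simp add: F_eq)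
  have c: "\<Phi> (free_const A a) = \<eta> a" if "a \<in> carrier A" for a
    using that \<eta>c by (simp add: free_const_def \<Phi>(2)) (simp add: \<mu>_def)
  have g: "\<Phi> (free_gen A x) = \<gamma> x" if "x \<in> G" for x
    using that \<gamma> by (simp add: free_gen_def \<Phi>(2) ring_hom_one[OF \<eta>]) (simp add: \<mu>_def)
  obtain \<Psi> where \<Psi>: "\<Psi> \<in> ring_hom (F Quot I) B" "\<And>x. x \<in> carrier F \<Longrightarrow> \<Psi> (I +>\<^bsub>F\<^esub> x) = \<Phi> x"
    unfolding relation_ideal_def
  proof (rule quotient_lift[OF R.ring_axioms B h rel_sub])
    fix s assume "s \<in> (\<lambda>(u, v). u \<ominus>\<^bsub>F\<^esub> v) ` Rel"
    then obtain u v where uv: "(u, v) \<in> Rel" "s = u \<ominus>\<^bsub>F\<^esub> v" by auto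
    have "\<Phi> u = \<Phi> v" by (rule rel[OF h c g uv(1)])
    moreover have "\<Phi> v \<in> carrier B" using Rel[OF uv(1)] h by (auto simp: ring_hom_def)
    ultimately show "\<Phi> s = \<zero>\<^bsub>B\<^esub>"
      using Rel[OF uv(1)] uv(2) ring_hom_a_minus[OF R.ring_axioms B h, of u v]
      by (auto simp: B.r_neg B.minus_eq)
  qed blast
  show thesis
    by (rule that[of \<Psi>]) (use \<Psi> c g in \<open>auto simp: presented_algebra_def presented_class_def\<close>)
qed

end

section \<open>Extension of scalars\<close>

lemma int_scalar_hom:
  assumes "ring C"
  shows "(\<lambda>z::int. [z] \<cdot>\<^bsub>C\<^esub> \<one>\<^bsub>C\<^esub>) \<in> ring_hom \<Z> C"
proof -
  interpret C: ring C by fact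
  show ?thesis
    by (rule ring_hom_memI)
      (simp_all add: C.add.int_pow_mult C.add_pow_ldistr_int C.add.int_pow_pow mult.commute)
qed

section \<open>The tensor product: bilinearity, induction on pure tensors, universal
  property\<close>

locale base_change_alg = A: ring A + B: ring B + K: cring K
  for A :: "('a, 'm) ring_scheme" and B :: "('b, 'n) ring_scheme" and \<eta> :: "'a \<Rightarrow> 'b"
  and K :: "('k, 'p) ring_scheme" and h :: "'a \<Rightarrow> 'k" +
  assumes \<eta>_hom: "\<eta> \<in> ring_hom A B" and h_hom: "h \<in> ring_hom A K"
begin

abbreviation "F \<equiv> monoid_algebra \<Z> (B \<times>\<times> K)"
abbreviation "T \<equiv> base_change A B \<eta> K h"
abbreviation "I \<equiv> tensor_ideal A B \<eta> K h"
abbreviation "pt \<equiv> pure_tensor A B \<eta> K h"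
abbreviation "d x k \<equiv> monom_elem \<Z> (x, k) (1::int)"

sublocale M: monoid "B \<times>\<times> K"
  by (rule DirProd_monoid) unfold_locales

sublocale F: monoid_alg \<Z> "B \<times>\<times> K"
  using int_is_cring by (simp add: monoid_alg_def cring_def M.monoid_axioms)

sublocale R: ring F by (rule F.F_ring)

lemma d_closed [simp, intro]: "x \<in> carrier B \<Longrightarrow> k \<in> carrier K \<Longrightarrow> d x k \<in> carrier F"
  by (rule F.monom_closed) auto

lemma rel_sub: "tensor_relations A B \<eta> K h \<subseteq> carrier F"
  using ring_hom_closed[OF \<eta>_hom] ring_hom_closed[OF h_hom]
  by (auto simp: tensor_relations_def Let_def intro!: R.minus_closed R.a_closed d_closed)

lemma I_ideal: "ideal I F"
  unfolding tensor_ideal_def by (rule R.genideal_ideal[OF rel_sub])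

sublocale I: ideal I F by (rule I_ideal)

sublocale T: ring T
  unfolding base_change_def by (rule I.quotient_is_ring)

definition cls where "cls u = I +>\<^bsub>F\<^esub> u"

lemma cls_hom: "cls \<in> ring_hom F T"
proof -
  have "cls = (+>\<^bsub>F\<^esub>) I" by (rule ext) (simp add: cls_def)
  then show ?thesis using I.rcos_ring_hom by (simp add: base_change_def)
qed

sublocale cls: ring_hom_ring F T cls
  by (intro ring_hom_ringI2 cls_hom) unfold_locales

lemma pt_cls: "pt x k = cls (d x k)"
  by (simp add: pure_tensor_def cls_def)

lemma pt_closed [simp, intro]: "x \<in> carrier B \<Longrightarrow> k \<in> carrier K \<Longrightarrow> pt x k \<in> carrier T"
  by (simp add: pt_cls)

lemma cls_eq: "u \<ominus>\<^bsub>F\<^esub> v \<in> tensor_relations A B \<eta> K h \<Longrightarrow> u \<in> carrier F \<Longrightarrow> v \<in> carrier F \<Longrightarrow> cls u = cls v"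
  unfolding cls_def
  using R.genideal_self[OF rel_sub]
  by (intro quotient_eq_iff R.ring_axioms I_ideal) (auto simp: tensor_ideal_def)

lemma pt_add_left:
  assumes "x \<in> carrier B" "y \<in> carrier B" "k \<in> carrier K"
  shows "pt (x \<oplus>\<^bsub>B\<^esub> y) k = pt x k \<oplus>\<^bsub>T\<^esub> pt y k"
proof -
  have "cls (d (x \<oplus>\<^bsub>B\<^esub> y) k) = cls (d x k \<oplus>\<^bsub>F\<^esub> d y k)"
    using assms by (intro cls_eq) (auto simp: tensor_relations_def Let_def simp del: One_nat_def)
  then show ?thesis using assms by (simp add: pt_cls)
qed

lemma pt_add_right:
  assumes "x \<in> carrier B" "k \<in> carrier K" "l \<in> carrier K"
  shows "pt x (k \<oplus>\<^bsub>K\<^esub> l) = pt x k \<oplus>\<^bsub>T\<^esub> pt x l"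
proof -
  have "cls (d x (k \<oplus>\<^bsub>K\<^esub> l)) = cls (d x k \<oplus>\<^bsub>F\<^esub> d x l)"
    using assms by (intro cls_eq) (auto simp: tensor_relations_def Let_def)
  then show ?thesis using assms by (simp add: pt_cls)
qed

lemma pt_balanced:
  assumes "a \<in> carrier A" "x \<in> carrier B" "k \<in> carrier K"
  shows "pt (\<eta> a \<otimes>\<^bsub>B\<^esub> x) k = pt x (h a \<otimes>\<^bsub>K\<^esub> k)"
proof -
  have "cls (d (\<eta> a \<otimes>\<^bsub>B\<^esub> x) k) = cls (d x (h a \<otimes>\<^bsub>K\<^esub> k))"
    using assms ring_hom_closed[OF \<eta>_hom assms(1)] ring_hom_closed[OF h_hom assms(1)]
    by (intro cls_eq) (auto simp: tensor_relations_def Let_def)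
  then show ?thesis by (simp add: pt_cls)
qed

lemma pt_mult:
  assumes "x \<in> carrier B" "k \<in> carrier K" "y \<in> carrier B" "l \<in> carrier K"
  shows "pt x k \<otimes>\<^bsub>T\<^esub> pt y l = pt (x \<otimes>\<^bsub>B\<^esub> y) (k \<otimes>\<^bsub>K\<^esub> l)"
proof -
  have "d x k \<otimes>\<^bsub>F\<^esub> d y l = d (x \<otimes>\<^bsub>B\<^esub> y) (k \<otimes>\<^bsub>K\<^esub> l)"
    using assms F.monom_mult[of "(x, k)" 1 "(y, l)" 1] by simp
  then show ?thesis using assms by (simp add: pt_cls flip: cls.hom_mult)
qed

lemma T_one: "\<one>\<^bsub>T\<^esub> = pt \<one>\<^bsub>B\<^esub> \<one>\<^bsub>K\<^esub>"
  using ring_hom_one[OF cls_hom] by (simp add: F.F_one pt_cls)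

abbreviation "\<iota> x \<equiv> pt x \<one>\<^bsub>K\<^esub>"
abbreviation "\<kappa> k \<equiv> pt \<one>\<^bsub>B\<^esub> k"

lemma \<iota>_hom: "(\<lambda>x. \<iota> x) \<in> ring_hom B T"
  by (rule ring_hom_memI) (simp_all add: pt_mult pt_add_left T_one)

lemma \<kappa>_hom: "(\<lambda>k. \<kappa> k) \<in> ring_hom K T"
  by (rule ring_hom_memI) (simp_all add: pt_mult pt_add_right T_one)

lemma pt_eq: "x \<in> carrier B \<Longrightarrow> k \<in> carrier K \<Longrightarrow> pt x k = \<kappa> k \<otimes>\<^bsub>T\<^esub> \<iota> x"
  by (simp add: pt_mult)

lemma \<iota>_\<eta>: "a \<in> carrier A \<Longrightarrow> \<iota> (\<eta> a) = \<kappa> (h a)"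
  using pt_balanced[of a "\<one>\<^bsub>B\<^esub>" "\<one>\<^bsub>K\<^esub>"] ring_hom_closed[OF \<eta>_hom] ring_hom_closed[OF h_hom] by simp

text \<open>A general element is an integer combination of symbols \<open>(x, k)\<close>. Positive
  multiples are repeated sums of pure tensors, and a negative multiple of \<open>(x, k)\<close> has
  the class of a positive multiple of \<open>(x, \<ominus> k)\<close>; hence sums and pure tensors
  are the only cases.\<close>

lemma tensor_induct [consumes 1, case_names add pure]:
  assumes u: "u \<in> carrier T"
    and add: "\<And>x y. x \<in> carrier T \<Longrightarrow> y \<in> carrier T \<Longrightarrow> Q x \<Longrightarrow> Q y \<Longrightarrow> Q (x \<oplus>\<^bsub>T\<^esub> y)"
    and pure: "\<And>x k. x \<in> carrier B \<Longrightarrow> k \<in> carrier K \<Longrightarrow> Q (pt x k)"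
  shows "Q u"
proof -
  obtain v where v: "v \<in> carrier F" "u = cls v"
    using u by (auto simp: base_change_def FactRing_def A_RCOSETS_def' cls_def)
  have z: "Q \<zero>\<^bsub>T\<^esub>"
  proof -
    have "pt \<zero>\<^bsub>B\<^esub> \<one>\<^bsub>K\<^esub> = \<zero>\<^bsub>T\<^esub>" using ring_hom_zero[OF \<iota>_hom B.ring_axioms T.ring_axioms] .
    then show ?thesis using pure[of "\<zero>\<^bsub>B\<^esub>" "\<one>\<^bsub>K\<^esub>"] by simp
  qed
  have mn: "Q (cls (monom_elem \<Z> (x, k) (int n)))" if "x \<in> carrier B" "k \<in> carrier K" for x k n
  proof (induction n)
    case 0
    then show ?case using z F.monom_zero cls.hom_zero by simp
  next
    case (Suc n)
    have "monom_elem \<Z> (x, k) (int (Suc n)) = d x k \<oplus>\<^bsub>F\<^esub> monom_elem \<Z> (x, k) (int n)"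
      by (subst F.monom_add) auto
    moreover have "monom_elem \<Z> (x, k) (int n) \<in> carrier F"
      using that by (intro F.monom_closed) auto
    ultimately show ?case
      using that Suc pure[of x k] by (simp add: pt_cls add)
  qed
  have mz: "Q (cls (monom_elem \<Z> (x, k) z))" if xk: "x \<in> carrier B" "k \<in> carrier K" for x k z
  proof (cases "z \<ge> 0")
    case True
    then show ?thesis using mn[OF that, of "nat z"] by simp
  next
    case False
    have k: "\<ominus>\<^bsub>K\<^esub> k \<in> carrier K" using xk by simp
    have "pt x k \<oplus>\<^bsub>T\<^esub> pt x (\<ominus>\<^bsub>K\<^esub> k) = \<zero>\<^bsub>T\<^esub>"
    proof -
      have "pt x k \<oplus>\<^bsub>T\<^esub> pt x (\<ominus>\<^bsub>K\<^esub> k) = \<kappa> \<zero>\<^bsub>K\<^esub> \<otimes>\<^bsub>T\<^esub> \<iota> x"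
        using xk by (simp add: pt_add_right[symmetric] K.r_neg pt_mult)
      also have "\<kappa> \<zero>\<^bsub>K\<^esub> = \<zero>\<^bsub>T\<^esub>" using ring_hom_zero[OF \<kappa>_hom K.ring_axioms T.ring_axioms] .
      finally show ?thesis using xk by simp
    qed
    then have neg: "cls (d x k) \<oplus>\<^bsub>T\<^esub> cls (d x (\<ominus>\<^bsub>K\<^esub> k)) = \<zero>\<^bsub>T\<^esub>" by (simp add: pt_cls)
    have mc: "monom_elem \<Z> (x, l) w \<in> carrier F" if "l \<in> carrier K" for l w
      using that xk by (intro F.monom_closed) auto
    \<comment> \<open>When n grows by one, the left side loses the class of \<open>(x, k)\<close>
      and the right side gains that of its negative; by \<open>neg\<close> this is the same
      change.\<close>
    have "cls (monom_elem \<Z> (x, k) (- int n)) = cls (monom_elem \<Z> (x, \<ominus>\<^bsub>K\<^esub> k) (int n))" for n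
    proof (induction n)
      case 0
      then show ?case using F.monom_zero by simp
    next
      case (Suc n)
      have 1: "cls (monom_elem \<Z> (x, \<ominus>\<^bsub>K\<^esub> k) (int (Suc n))) =
         cls (d x (\<ominus>\<^bsub>K\<^esub> k)) \<oplus>\<^bsub>T\<^esub> cls (monom_elem \<Z> (x, \<ominus>\<^bsub>K\<^esub> k) (int n))"
      proof -
        have "monom_elem \<Z> (x, \<ominus>\<^bsub>K\<^esub> k) (int (Suc n)) = d x (\<ominus>\<^bsub>K\<^esub> k) \<oplus>\<^bsub>F\<^esub> monom_elem \<Z> (x, \<ominus>\<^bsub>K\<^esub> k) (int n)"
          by (subst F.monom_add) auto
        then show ?thesis using mc[OF k] by simp
      qed
      have 2: "cls (monom_elem \<Z> (x, k) (- int n)) =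
         cls (d x k) \<oplus>\<^bsub>T\<^esub> cls (monom_elem \<Z> (x, k) (- int (Suc n)))"
      proof -
        have "monom_elem \<Z> (x, k) (- int n) = d x k \<oplus>\<^bsub>F\<^esub> monom_elem \<Z> (x, k) (- int (Suc n))"
          by (subst F.monom_add) auto
        then show ?thesis using mc[OF xk(2)] by simp
      qed
      have c: "cls (d x k) \<in> carrier T" "cls (d x (\<ominus>\<^bsub>K\<^esub> k)) \<in> carrier T"
        "cls (monom_elem \<Z> (x, k) (- int (Suc n))) \<in> carrier T" using mc k xk by auto
      have "cls (monom_elem \<Z> (x, \<ominus>\<^bsub>K\<^esub> k) (int (Suc n))) =
        cls (d x (\<ominus>\<^bsub>K\<^esub> k)) \<oplus>\<^bsub>T\<^esub> (cls (d x k) \<oplus>\<^bsub>T\<^esub> cls (monom_elem \<Z> (x, k) (- int (Suc n))))"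
        unfolding 1 Suc[symmetric] 2 ..
      also have "\<dots> = cls (monom_elem \<Z> (x, k) (- int (Suc n)))"
        using neg c by (simp add: T.a_assoc[symmetric] T.a_comm[of "cls (d x (\<ominus>\<^bsub>K\<^esub> k))" "cls (d x k)"])
      finally show ?case ..
    qed
    from this[of "nat (- z)"] show ?thesis using mn[OF xk(1) k, of "nat (- z)"] False by simp
  qed
  have "Q (cls v)" using v(1)
  proof (induction rule: F.F_induct)
    case zero
    then show ?case using z by simp
  next
    case (add m a g)
    obtain x k where m: "m = (x, k)" "x \<in> carrier B" "k \<in> carrier K" using add(1) by auto
    have "monom_elem \<Z> m a \<in> carrier F" using add by (intro F.monom_closed) auto
    then show ?case using add mz[OF m(2,3), of a] m(1) assms(2) by simp
  qed
  then show ?thesis using v by simp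
qed

lemma \<kappa>_central:
  assumes "k \<in> carrier K" "u \<in> carrier T"
  shows "\<kappa> k \<otimes>\<^bsub>T\<^esub> u = u \<otimes>\<^bsub>T\<^esub> \<kappa> k"
  using assms(2)
proof (induction rule: tensor_induct)
  case (add x y)
  then show ?case using assms by (simp add: T.l_distr T.r_distr)
next
  case (pure x l)
  then show ?case using assms by (simp add: pt_mult K.m_comm)
qed

text \<open>Universal property, obtained from that of the monoid ring over the integers: commuting
  images make \<open>\<alpha> x \<otimes> \<beta> k\<close> multiplicative in the pair, and the
  three kinds of bilinearity relation are sent to zero.\<close>

lemma base_change_lift:
  assumes C: "ring C" and \<alpha>: "\<alpha> \<in> ring_hom B C" and \<beta>: "\<beta> \<in> ring_hom K C"
    and comm: "\<And>x k. x \<in> carrier B \<Longrightarrow> k \<in> carrier K \<Longrightarrow> \<alpha> x \<otimes>\<^bsub>C\<^esub> \<beta> k = \<beta> k \<otimes>\<^bsub>C\<^esub> \<alpha> x"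
    and comp: "\<And>a. a \<in> carrier A \<Longrightarrow> \<alpha> (\<eta> a) = \<beta> (h a)"
  obtains \<Psi> where "\<Psi> \<in> ring_hom T C"
    "\<And>x k. x \<in> carrier B \<Longrightarrow> k \<in> carrier K \<Longrightarrow> \<Psi> (pt x k) = \<alpha> x \<otimes>\<^bsub>C\<^esub> \<beta> k"
proof -
  interpret C: ring C by (rule C)
  define \<mu> where "\<mu> m = \<alpha> (fst m) \<otimes>\<^bsub>C\<^esub> \<beta> (snd m)" for m
  note [simp] = ring_hom_closed[OF \<alpha>] ring_hom_closed[OF \<beta>] ring_hom_mult[OF \<alpha>] ring_hom_mult[OF \<beta>]
    ring_hom_add[OF \<alpha>] ring_hom_add[OF \<beta>] ring_hom_one[OF \<alpha>] ring_hom_one[OF \<beta>]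
    ring_hom_closed[OF \<eta>_hom] ring_hom_closed[OF h_hom]
  have \<mu>c: "\<mu> m \<in> carrier C" if "m \<in> carrier (B \<times>\<times> K)" for m
    using that by (auto simp: \<mu>_def)
  have \<mu>h: "\<mu> \<in> hom (B \<times>\<times> K) C"
  proof (rule homI)
    fix m m' assume "m \<in> carrier (B \<times>\<times> K)" "m' \<in> carrier (B \<times>\<times> K)"
    then obtain x k y l where e: "m = (x, k)" "m' = (y, l)" "x \<in> carrier B" "y \<in> carrier B" "k \<in> carrier K" "l \<in> carrier K"
      by auto
    have "\<alpha> x \<otimes>\<^bsub>C\<^esub> (\<alpha> y \<otimes>\<^bsub>C\<^esub> \<beta> k) \<otimes>\<^bsub>C\<^esub> \<beta> l = \<alpha> x \<otimes>\<^bsub>C\<^esub> (\<beta> k \<otimes>\<^bsub>C\<^esub> \<alpha> y) \<otimes>\<^bsub>C\<^esub> \<beta> l"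
      using e comm[of y k] by simp
    then show "\<mu> (m \<otimes>\<^bsub>B \<times>\<times> K\<^esub> m') = \<mu> m \<otimes>\<^bsub>C\<^esub> \<mu> m'"
      using e by (simp add: \<mu>_def C.m_assoc)
  qed (rule \<mu>c)
  have zc: "[z] \<cdot>\<^bsub>C\<^esub> \<one>\<^bsub>C\<^esub> \<otimes>\<^bsub>C\<^esub> y = y \<otimes>\<^bsub>C\<^esub> [z] \<cdot>\<^bsub>C\<^esub> \<one>\<^bsub>C\<^esub>" if "y \<in> carrier C" for y and z :: int
    using that by (simp add: C.add_pow_ldistr_int C.add_pow_rdistr_int)
  obtain \<Phi> where \<Phi>: "\<Phi> \<in> ring_hom F C"
    "\<And>m a. m \<in> carrier (B \<times>\<times> K) \<Longrightarrow> a \<in> carrier \<Z> \<Longrightarrow>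
       \<Phi> (monom_elem \<Z> m a) = [a] \<cdot>\<^bsub>C\<^esub> \<one>\<^bsub>C\<^esub> \<otimes>\<^bsub>C\<^esub> \<mu> m"
    by (rule F.F_lift[OF C int_scalar_hom[OF C] \<mu>h])
      (auto simp: \<mu>c intro!: zc, simp add: \<mu>_def)
  have \<Phi>d: "\<Phi> (d x k) = \<alpha> x \<otimes>\<^bsub>C\<^esub> \<beta> k" if "x \<in> carrier B" "k \<in> carrier K" for x k
    using that \<Phi>(2)[of "(x, k)" 1] by (simp add: \<mu>_def)
  note hm = ring_hom_a_minus[OF R.ring_axioms C \<Phi>(1)] ring_hom_add[OF \<Phi>(1)]
  obtain \<Psi> where \<Psi>: "\<Psi> \<in> ring_hom (F Quot I) C" "\<And>x. x \<in> carrier F \<Longrightarrow> \<Psi> (I +>\<^bsub>F\<^esub> x) = \<Phi> x"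
    unfolding tensor_ideal_def
  proof (rule quotient_lift[OF R.ring_axioms C \<Phi>(1) rel_sub])
    fix s assume "s \<in> tensor_relations A B \<eta> K h"
    then consider (1) x y k where "s = d (x \<oplus>\<^bsub>B\<^esub> y) k \<ominus>\<^bsub>F\<^esub> (d x k \<oplus>\<^bsub>F\<^esub> d y k)" "x \<in> carrier B" "y \<in> carrier B" "k \<in> carrier K"
      | (2) x k l where "s = d x (k \<oplus>\<^bsub>K\<^esub> l) \<ominus>\<^bsub>F\<^esub> (d x k \<oplus>\<^bsub>F\<^esub> d x l)" "x \<in> carrier B" "k \<in> carrier K" "l \<in> carrier K"
      | (3) a x k where "s = d (\<eta> a \<otimes>\<^bsub>B\<^esub> x) k \<ominus>\<^bsub>F\<^esub> d x (h a \<otimes>\<^bsub>K\<^esub> k)" "a \<in> carrier A" "x \<in> carrier B" "k \<in> carrier K"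
      unfolding tensor_relations_def Let_def by blast
    then show "\<Phi> s = \<zero>\<^bsub>C\<^esub>"
    proof cases
      case 1
      then show ?thesis by (simp add: hm \<Phi>d C.l_distr C.r_neg C.minus_eq)
    next
      case 2
      then show ?thesis by (simp add: hm \<Phi>d C.r_distr C.r_neg C.minus_eq)
    next
      case 3
      then show ?thesis
        by (simp add: hm \<Phi>d comp comm[symmetric] C.m_assoc C.r_neg C.minus_eq)
    qed
  qed blast
  show thesis
    by (rule that[of \<Psi>]) (use \<Psi> \<Phi>d in \<open>auto simp: base_change_def pure_tensor_def\<close>)
qed

end

section \<open>The ties of the Yokonuma-Hecke algebra\<close>

abbreviation sw :: "nat \<Rightarrow> nat \<Rightarrow> nat" where "sw k \<equiv> Transposition.transpose k (Suc k)"

lemma sw_in: "k \<in> {1..<n} \<Longrightarrow> i \<in> {1..n} \<Longrightarrow> sw k i \<in> {1..n}"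
  by (auto simp: Transposition.transpose_def)

text \<open>The interface common to both algebras, with a tie for every pair of labels. Together
  with symmetry, idempotence and commutation, \<open>e_trans\<close> says that any two edges of a
  triangle have the same product, so that a product of ties depends only on the equivalence relation
  generated by its pairs.\<close>

locale ties = ring B for B :: "('b, 'm) ring_scheme" (structure) +
  fixes n :: nat and g :: "nat \<Rightarrow> 'b" and e :: "nat \<Rightarrow> nat \<Rightarrow> 'b"
  assumes g_closed [simp]: "k \<in> {1..<n} \<Longrightarrow> g k \<in> carrier B"
    and e_closed [simp]: "i \<in> {1..n} \<Longrightarrow> j \<in> {1..n} \<Longrightarrow> e i j \<in> carrier B"
    and e_conj: "k \<in> {1..<n} \<Longrightarrow> i \<in> {1..n} \<Longrightarrow> j \<in> {1..n} \<Longrightarrow> g k \<otimes> e i j = e (sw k i) (sw k j) \<otimes> g k"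
    and e_refl: "i \<in> {1..n} \<Longrightarrow> e i i = \<one>"
    and e_sym: "i \<in> {1..n} \<Longrightarrow> j \<in> {1..n} \<Longrightarrow> e i j = e j i"
    and e_idem: "i \<in> {1..n} \<Longrightarrow> j \<in> {1..n} \<Longrightarrow> e i j \<otimes> e i j = e i j"
    and e_comm: "i \<in> {1..n} \<Longrightarrow> j \<in> {1..n} \<Longrightarrow> k \<in> {1..n} \<Longrightarrow> l \<in> {1..n} \<Longrightarrow> e i j \<otimes> e k l = e k l \<otimes> e i j"
    and e_trans: "i \<in> {1..n} \<Longrightarrow> j \<in> {1..n} \<Longrightarrow> k \<in> {1..n} \<Longrightarrow> e i j \<otimes> e j k = e i j \<otimes> e i k"

text \<open>Far commutation, braid and quadratic relations are assumed; every other relation follows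
  from conjugation of ties and the triangle rule. The existence of \<open>\<phi>\<close> rests on
  this.\<close>

lemma (in ties) bt_relations_hold:
  assumes far: "\<And>i j. i \<in> {1..<n} \<Longrightarrow> j \<in> {1..<n} \<Longrightarrow> \<bar>int i - int j\<bar> > 1 \<Longrightarrow> g i \<otimes> g j = g j \<otimes> g i"
    and braid: "\<And>i. i \<in> {1..<n} \<Longrightarrow> Suc i \<in> {1..<n} \<Longrightarrow> g i \<otimes> g (Suc i) \<otimes> g i = g (Suc i) \<otimes> g i \<otimes> g (Suc i)"
    and quad: "\<And>i. i \<in> {1..<n} \<Longrightarrow> g i [^] (2::nat) = \<one> \<oplus> z \<otimes> (e i (Suc i) \<otimes> g i)"
    and uv: "(u, v) \<in> bt_relations B n z g (\<lambda>i. e i (Suc i))"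
  shows "u = v"
proof -
  note sws = Transposition.transpose_def
  have near: "(j = Suc i \<or> i = Suc j) \<and> i \<in> {1..<n} \<and> j \<in> {1..<n}"
    if "i \<in> {1..<n} \<and> j \<in> {1..<n} \<and> \<bar>int i - int j\<bar> = 1" for i j using that by auto
  have braid': "g i \<otimes> g j \<otimes> g i = g j \<otimes> g i \<otimes> g j"
    if "i \<in> {1..<n} \<and> j \<in> {1..<n} \<and> \<bar>int i - int j\<bar> = 1" for i j
    using near[OF that] braid by metis
  \<comment> \<open>The permutation attached to \<open>g j \<otimes> g i\<close> carries the pair
    {j, j+1} to {i, i+1}.\<close>
  have c2: "e i (Suc i) \<otimes> g j \<otimes> g i = g j \<otimes> g i \<otimes> e j (Suc j)"
    if "i \<in> {1..<n} \<and> j \<in> {1..<n} \<and> \<bar>int i - int j\<bar> = 1" for i j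
  proof -
    have ij: "i \<in> {1..<n}" "j \<in> {1..<n}" "i \<in> {1..n}" "Suc i \<in> {1..n}" "j \<in> {1..n}" "Suc j \<in> {1..n}"
      using that by auto
    have "g j \<otimes> g i \<otimes> e j (Suc j) = g j \<otimes> (e (sw i j) (sw i (Suc j)) \<otimes> g i)"
      using ij e_conj[of i j "Suc j"] by (simp add: m_assoc)
    also have "\<dots> = e (sw j (sw i j)) (sw j (sw i (Suc j))) \<otimes> (g j \<otimes> g i)"
      using ij e_conj[of j "sw i j" "sw i (Suc j)"] sw_in[of i n j] sw_in[of i n "Suc j"]
        sw_in[of j n "sw i j"] sw_in[of j n "sw i (Suc j)"]
      by (simp flip: m_assoc)
    also have "e (sw j (sw i j)) (sw j (sw i (Suc j))) = e i (Suc i)"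
      using near[OF that] ij e_sym[of i "Suc i"] by (auto simp: sws)
    finally show ?thesis using ij by (simp add: m_assoc)
  qed
  \<comment> \<open>Adjacent \<open>i\<close> and \<open>j\<close> involve three labels. The swap at
    \<open>j\<close> keeps the edge {j, j+1} and moves {i, i+1} to the third edge of the triangle,
    so the triangle rule applies.\<close>
  have c3: "e i (Suc i) \<otimes> e j (Suc j) = e i (Suc i) \<otimes> e (sw j i) (sw j (Suc i))"
    "e (sw j i) (sw j (Suc i)) \<otimes> e i (Suc i) = e (sw j i) (sw j (Suc i)) \<otimes> e j (Suc j)"
    if ij: "i \<in> {1..<n} \<and> j \<in> {1..<n} \<and> \<bar>int i - int j\<bar> = 1" for i j
  proof -
    have ij': "i \<in> {1..n}" "Suc i \<in> {1..n}" "j \<in> {1..n}" "Suc j \<in> {1..n}"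
      using that by auto
    have "j = Suc i \<or> i = Suc j" using ij by auto
    then consider "j = Suc i" | "i = Suc j" by blast
    then have "e i (Suc i) \<otimes> e j (Suc j) = e i (Suc i) \<otimes> e (sw j i) (sw j (Suc i)) \<and>
      e (sw j i) (sw j (Suc i)) \<otimes> e i (Suc i) = e (sw j i) (sw j (Suc i)) \<otimes> e j (Suc j)"
    proof cases
      case 1
      then have s: "sw j i = i" "sw j (Suc i) = Suc j" by (auto simp: sws)
      have "e i (Suc j) \<otimes> e i (Suc i) = e (Suc j) i \<otimes> e i (Suc i)"
        using ij' e_sym[of i "Suc j"] by simp
      also have "\<dots> = e i (Suc j) \<otimes> e j (Suc j)"
        using ij' 1 e_trans[of "Suc j" i "Suc i"] e_sym[of i "Suc j"] e_sym[of j "Suc j"] by simp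
      finally show ?thesis using e_trans[of i "Suc i" "Suc j"] ij' 1 s by simp
    next
      case 2
      then have s: "sw j i = j" "sw j (Suc i) = Suc i" by (auto simp: sws)
      have "e i (Suc i) \<otimes> e j (Suc j) = e (Suc i) i \<otimes> e i j"
        using ij' 2 e_sym[of i "Suc i"] e_sym[of j "Suc j"] by simp
      also have "\<dots> = e i (Suc i) \<otimes> e j (Suc i)"
        using ij' e_trans[of "Suc i" i j] e_sym[of i "Suc i"] e_sym[of j "Suc i"] by simp
      finally have A: "e i (Suc i) \<otimes> e j (Suc j) = e i (Suc i) \<otimes> e j (Suc i)" .
      have "e j (Suc i) \<otimes> e i (Suc i) = e j (Suc i) \<otimes> e (Suc i) i"
        using ij' e_sym[of i "Suc i"] by simp
      also have "\<dots> = e j (Suc i) \<otimes> e j i" using ij' by (simp add: e_trans)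
      finally show ?thesis using A 2 s by simp
    qed
    then show "e i (Suc i) \<otimes> e j (Suc j) = e i (Suc i) \<otimes> e (sw j i) (sw j (Suc i))"
      "e (sw j i) (sw j (Suc i)) \<otimes> e i (Suc i) = e (sw j i) (sw j (Suc i)) \<otimes> e j (Suc j)" by blast+
  qed
  have c4: "e i (Suc i) \<otimes> g j \<otimes> e i (Suc i) = e i (Suc i) \<otimes> e j (Suc j) \<otimes> g j"
    "g j \<otimes> e i (Suc i) \<otimes> e j (Suc j) = e i (Suc i) \<otimes> g j \<otimes> e i (Suc i)"
    if ij: "i \<in> {1..<n} \<and> j \<in> {1..<n} \<and> \<bar>int i - int j\<bar> = 1" for i j
  proof -
    have ij': "i \<in> {1..n}" "Suc i \<in> {1..n}" "j \<in> {1..n}" "Suc j \<in> {1..n}" "i \<in> {1..<n}" "j \<in> {1..<n}"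
      using that by auto
    have s: "sw j i \<in> {1..n}" "sw j (Suc i) \<in> {1..n}" using ij' sw_in by blast+
    define E F G where "E = e i (Suc i)" and "F = e j (Suc j)" and "G = e (sw j i) (sw j (Suc i))"
    have cl: "E \<in> carrier B" "F \<in> carrier B" "G \<in> carrier B" "g j \<in> carrier B"
      using ij' s by (auto simp: E_def F_def G_def)
    have gE: "g j \<otimes> E = G \<otimes> g j" unfolding E_def G_def using ij' by (simp add: e_conj)
    have gF: "g j \<otimes> F = F \<otimes> g j" unfolding F_def using ij' e_conj[of j j "Suc j"] e_sym[of j "Suc j"] by simp
    have EF: "E \<otimes> F = E \<otimes> G" "G \<otimes> E = G \<otimes> F" unfolding E_def F_def G_def using c3[OF ij] by blast+
    have GE: "G \<otimes> E = E \<otimes> G" unfolding E_def G_def using ij' s e_comm by blast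
    have "E \<otimes> g j \<otimes> E = E \<otimes> G \<otimes> g j" using gE cl by (simp add: m_assoc)
    then have 1: "E \<otimes> g j \<otimes> E = E \<otimes> F \<otimes> g j" using EF by simp
    have "g j \<otimes> E \<otimes> F = G \<otimes> (g j \<otimes> F)" using gE cl by (simp add: m_assoc)
    also have "\<dots> = G \<otimes> F \<otimes> g j" using gF cl by (simp add: m_assoc)
    also have "\<dots> = E \<otimes> G \<otimes> g j" using EF GE by simp
    finally have 2: "g j \<otimes> E \<otimes> F = E \<otimes> g j \<otimes> E" using 1 EF by simp
    show "e i (Suc i) \<otimes> g j \<otimes> e i (Suc i) = e i (Suc i) \<otimes> e j (Suc j) \<otimes> g j"
      "g j \<otimes> e i (Suc i) \<otimes> e j (Suc j) = e i (Suc i) \<otimes> g j \<otimes> e i (Suc i)"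
      using 1 2 unfolding E_def F_def by blast+
  qed
  have f: "g i \<otimes> e j (Suc j) = e j (Suc j) \<otimes> g i"
    if "i \<in> {1..<n}" "j \<in> {1..<n}" "\<bar>int i - int j\<bar> > 1" for i j
  proof -
    have "sw i j = j" "sw i (Suc j) = Suc j" using that by (auto simp: sws)
    then show ?thesis using e_conj[of i j "Suc j"] that by auto
  qed
  have o: "g i \<otimes> e i (Suc i) = e i (Suc i) \<otimes> g i" if "i \<in> {1..<n}" for i
    using that e_conj[of i i "Suc i"] e_sym[of i "Suc i"] by auto
  have cc: "e i (Suc i) \<otimes> e j (Suc j) = e j (Suc j) \<otimes> e i (Suc i)" if "i \<in> {1..<n}" "j \<in> {1..<n}" for i j
    using that by (intro e_comm) auto
  have ii: "e i (Suc i) [^] (2::nat) = e i (Suc i)" if "i \<in> {1..<n}" for i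
    using that e_idem[of i "Suc i"] by (auto simp: numeral_2_eq_2)
  from uv show ?thesis
    unfolding bt_relations_def Let_def Un_iff
  proof (elim disjE)
  qed (use far o braid' c2 c4 cc f ii quad in \<open>force+\<close>)
qed

text \<open>When \<open>f 0 = f m\<close> the two sums agree. This cyclic shift is what
  multiplication by an r-th root of 1 does to the averaging sums, both for ties and for
  characters.\<close>

lemma (in ring) finsum_shift:
  assumes "\<And>s. f s \<in> carrier R"
  shows "(\<Oplus>s\<in>{..<m::nat}. f (Suc s)) \<oplus> f 0 = (\<Oplus>s\<in>{..<m}. f s) \<oplus> f m"
proof (induction m)
  case (Suc m)
  have "(\<Oplus>s\<in>{..<Suc m}. f (Suc s)) \<oplus> f 0 = f (Suc m) \<oplus> ((\<Oplus>s\<in>{..<m}. f (Suc s)) \<oplus> f 0)"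
    using assms by (simp add: lessThan_Suc finsum_insert a_assoc finsum_closed Pi_def)
  also have "\<dots> = (\<Oplus>s\<in>{..<Suc m}. f s) \<oplus> f (Suc m)"
    unfolding Suc using assms by (simp add: lessThan_Suc finsum_insert a_ac finsum_closed Pi_def)
  finally show ?case .
qed (use assms in simp)

lemma (in monoid) pow_commute:
  assumes "x \<in> carrier G" "y \<in> carrier G" "y' \<in> carrier G" "x \<otimes> y = y' \<otimes> x"
  shows "x \<otimes> y [^] (s::nat) = y' [^] s \<otimes> x"
proof (induction s)
  case (Suc s)
  have "x \<otimes> y [^] Suc s = (x \<otimes> y [^] s) \<otimes> y" using assms by (simp add: m_assoc)
  also have "\<dots> = y' [^] s \<otimes> (x \<otimes> y)" using assms Suc by (simp add: m_assoc)
  also have "\<dots> = y' [^] Suc s \<otimes> x" using assms by (simp add: m_assoc)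
  finally show ?case .
qed (use assms in simp)

section \<open>Ties as averages over powers of the commuting generators \<open>t i\<close>\<close>

locale yh_rep = ring B for B :: "('b, 'm) ring_scheme" (structure) +
  fixes r n :: nat and c z :: 'b and g t :: "nat \<Rightarrow> 'b"
  assumes c_closed [simp]: "c \<in> carrier B"
    and c_central: "x \<in> carrier B \<Longrightarrow> c \<otimes> x = x \<otimes> c"
    and c_inv: "c \<otimes> [r] \<cdot> \<one> = \<one>"
    and g_closed [simp]: "k \<in> {1..<n} \<Longrightarrow> g k \<in> carrier B"
    and t_closed [simp]: "i \<in> {1..n} \<Longrightarrow> t i \<in> carrier B"
    and rels: "(u, v) \<in> yh_relations B r n c z g t \<Longrightarrow> u = v"
begin

lemma t_pow: "i \<in> {1..n} \<Longrightarrow> t i [^] r = \<one>"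
  by (rule rels) (unfold yh_relations_def, blast)

lemma t_comm: "i \<in> {1..n} \<Longrightarrow> j \<in> {1..n} \<Longrightarrow> t i \<otimes> t j = t j \<otimes> t i"
  by (rule rels) (unfold yh_relations_def, blast)

lemma t_g: "k \<in> {1..<n} \<Longrightarrow> j \<in> {1..n} \<Longrightarrow> t j \<otimes> g k = g k \<otimes> t (sw k j)"
  by (rule rels) (unfold yh_relations_def Suc_eq_plus1, blast)

lemma g_far: "i \<in> {1..<n} \<Longrightarrow> j \<in> {1..<n} \<Longrightarrow> \<bar>int i - int j\<bar> > 1 \<Longrightarrow> g i \<otimes> g j = g j \<otimes> g i"
  by (rule rels) (unfold yh_relations_def Suc_eq_plus1, blast)

lemma g_braid: "i \<in> {1..<n} \<Longrightarrow> Suc i \<in> {1..<n} \<Longrightarrow> g i \<otimes> g (Suc i) \<otimes> g i = g (Suc i) \<otimes> g i \<otimes> g (Suc i)"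
  by (rule rels) (unfold yh_relations_def Suc_eq_plus1, blast)

lemma g_quad: "i \<in> {1..<n} \<Longrightarrow> g i [^] (2::nat) = \<one> \<oplus> z \<otimes> (yh_idem B r c t i \<otimes> g i)"
  by (rule rels) (unfold yh_relations_def Suc_eq_plus1, blast)

definition e :: "nat \<Rightarrow> nat \<Rightarrow> 'b" where
  "e i j = c \<otimes> (\<Oplus>s\<in>{..<r}. t i [^] s \<otimes> t j [^] (r - s))"

lemma e_closed [simp]: "i \<in> {1..n} \<Longrightarrow> j \<in> {1..n} \<Longrightarrow> e i j \<in> carrier B"
  unfolding e_def by (intro m_closed finsum_closed) auto

lemma yh_idem_eq: "yh_idem B r c t = (\<lambda>i. e i (Suc i))"
  by (simp add: yh_idem_def e_def fun_eq_iff)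

text \<open>An intertwining relation with \<open>t i\<close> and \<open>t j\<close> passes to their
  powers and sums, and \<open>c\<close> is central. With \<open>x\<close> a \<open>t\<close>, a tie
  or a \<open>g\<close>, this one statement yields commutation as well as conjugation.\<close>

lemma e_commute:
  assumes x: "x \<in> carrier B" and i: "i \<in> {1..n}" "j \<in> {1..n}" "i' \<in> {1..n}" "j' \<in> {1..n}"
    and "x \<otimes> t i = t i' \<otimes> x" "x \<otimes> t j = t j' \<otimes> x"
  shows "x \<otimes> e i j = e i' j' \<otimes> x"
proof -
  have s: "x \<otimes> (t i [^] s \<otimes> t j [^] (r - s)) = (t i' [^] s \<otimes> t j' [^] (r - s)) \<otimes> x" for s
  proof -
    have "x \<otimes> (t i [^] s \<otimes> t j [^] (r - s)) = (x \<otimes> t i [^] s) \<otimes> t j [^] (r - s)"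
      using assms by (simp add: m_assoc)
    also have "\<dots> = t i' [^] s \<otimes> (x \<otimes> t j [^] (r - s))"
      using assms pow_commute[of x "t i" "t i'" s] by (simp add: m_assoc)
    also have "\<dots> = (t i' [^] s \<otimes> t j' [^] (r - s)) \<otimes> x"
      using assms pow_commute[of x "t j" "t j'" "r - s"] by (simp add: m_assoc)
    finally show ?thesis .
  qed
  have "x \<otimes> e i j = c \<otimes> (x \<otimes> (\<Oplus>s\<in>{..<r}. t i [^] s \<otimes> t j [^] (r - s)))"
    unfolding e_def using x i c_central[OF x]
    by (subst (1 2) m_assoc[symmetric]) (auto intro!: finsum_closed)
  also have "x \<otimes> (\<Oplus>s\<in>{..<r}. t i [^] s \<otimes> t j [^] (r - s)) =
      (\<Oplus>s\<in>{..<r}. x \<otimes> (t i [^] s \<otimes> t j [^] (r - s)))"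
    using x i by (intro finsum_rdistr) auto
  also have "\<dots> = (\<Oplus>s\<in>{..<r}. t i' [^] s \<otimes> t j' [^] (r - s)) \<otimes> x"
    unfolding s using x i by (intro finsum_ldistr[symmetric]) auto
  finally show ?thesis unfolding e_def using x i
    by (simp add: m_assoc finsum_closed Pi_def)
qed

lemma t_e_comm: "i \<in> {1..n} \<Longrightarrow> j \<in> {1..n} \<Longrightarrow> k \<in> {1..n} \<Longrightarrow> t k \<otimes> e i j = e i j \<otimes> t k"
  by (rule e_commute) (auto simp: t_comm)

lemma e_e_comm:
  assumes "i \<in> {1..n}" "j \<in> {1..n}" "k \<in> {1..n}" "l \<in> {1..n}"
  shows "e i j \<otimes> e k l = e k l \<otimes> e i j"
  using assms by (intro e_commute) (auto simp: t_e_comm)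

text \<open>Multiplying the average by \<open>t i\<close> or by \<open>t j\<close> gives the same
  terms up to a cyclic shift of the index.\<close>

lemma t_e:
  assumes i: "i \<in> {1..n}" "j \<in> {1..n}"
  shows "t i \<otimes> e i j = t j \<otimes> e i j"
proof -
  \<comment> \<open>One extra factor \<open>t j\<close> is built in: \<open>f s\<close> is
    \<open>t j\<close> times the s-th summand and \<open>f (Suc s)\<close> is \<open>t i\<close>
    times it. The two ends coincide since r-th powers are 1.\<close>
  define f where "f s = t i [^] s \<otimes> t j [^] (Suc r - s)" for s
  have f: "f s \<in> carrier B" for s using i by (simp add: f_def)
  have f0: "f 0 = t j" "f r = t j" using i t_pow by (simp_all add: f_def)
  have A: "t k \<otimes> e i j = c \<otimes> (\<Oplus>s\<in>{..<r}. t k \<otimes> (t i [^] s \<otimes> t j [^] (r - s)))" if k: "k \<in> {1..n}" for k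
  proof -
    have "t k \<otimes> e i j = c \<otimes> (t k \<otimes> (\<Oplus>s\<in>{..<r}. t i [^] s \<otimes> t j [^] (r - s)))"
      unfolding e_def using k i c_central[of "t k"]
      by (subst (1 2) m_assoc[symmetric]) (auto intro!: finsum_closed)
    then show ?thesis using k i by (subst (asm) finsum_rdistr) auto
  qed
  have "(\<Oplus>s\<in>{..<r}. t i \<otimes> (t i [^] s \<otimes> t j [^] (r - s))) = (\<Oplus>s\<in>{..<r}. f (Suc s))"
  proof (rule finsum_cong')
    fix s :: nat
    have "t i \<otimes> t i [^] s = t i [^] s \<otimes> t i" by (rule pow_commute) (use i in auto)
    then show "t i \<otimes> (t i [^] s \<otimes> t j [^] (r - s)) = f (Suc s)"
      using i by (simp add: f_def m_assoc[symmetric])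
  qed (use f in auto)
  also have "\<dots> = (\<Oplus>s\<in>{..<r}. f s)"
    using finsum_shift[of f r] f f0 i by (simp add: finsum_closed Pi_def)
  also have "\<dots> = (\<Oplus>s\<in>{..<r}. t j \<otimes> (t i [^] s \<otimes> t j [^] (r - s)))"
  proof (rule finsum_cong')
    fix s assume s: "s \<in> {..<r}"
    have "t j \<otimes> t i [^] s = t i [^] s \<otimes> t j" "t j \<otimes> t j [^] (r - s) = t j [^] (r - s) \<otimes> t j"
      using i t_comm by (auto intro!: pow_commute)
    then have "t j \<otimes> (t i [^] s \<otimes> t j [^] (r - s)) = t i [^] s \<otimes> (t j [^] (r - s) \<otimes> t j)"
      using i by (metis m_assoc nat_pow_closed t_closed)
    also have "\<dots> = f s" using s by (simp add: f_def Suc_diff_le)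
    finally show "f s = t j \<otimes> (t i [^] s \<otimes> t j [^] (r - s))" ..
  qed (use i in auto)
  finally show ?thesis using A i by simp
qed

text \<open>Where \<open>t i\<close> and \<open>t j\<close> act alike, each summand acts as the r-th
  power of \<open>t j\<close>, that is as 1, and \<open>c\<close> cancels the r equal terms. With
  \<open>t_e\<close> this identifies \<open>e i j\<close> as the projection onto the part where
  \<open>t i\<close> and \<open>t j\<close> agree.\<close>

lemma e_absorb:
  assumes i: "i \<in> {1..n}" "j \<in> {1..n}" and x: "x \<in> carrier B" "t i \<otimes> x = t j \<otimes> x"
  shows "e i j \<otimes> x = x"
proof -
  have p: "t i [^] s \<otimes> x = t j [^] s \<otimes> x" for s :: nat
  proof (induction s)
    case (Suc s)
    have "t i [^] Suc s \<otimes> x = t i [^] s \<otimes> (t j \<otimes> x)" using i x by (simp add: m_assoc)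
    also have "\<dots> = (t i [^] s \<otimes> t j) \<otimes> x" using i x by (simp add: m_assoc)
    also have "t i [^] s \<otimes> t j = t j \<otimes> t i [^] s" using i t_comm by (intro pow_commute[symmetric]) auto
    also have "\<dots> \<otimes> x = t j \<otimes> (t j [^] s \<otimes> x)" using i x Suc by (simp add: m_assoc)
    also have "\<dots> = (t j \<otimes> t j [^] s) \<otimes> x" using i x by (simp add: m_assoc)
    also have "t j \<otimes> t j [^] s = t j [^] s \<otimes> t j" using i by (intro pow_commute) auto
    finally show ?case using i by simp
  qed (use x in simp)
  have q: "t i [^] s \<otimes> t j [^] (r - s) \<otimes> x = x" if s: "s \<in> {..<r}" for s
  proof -
    have "t i [^] s \<otimes> t j [^] (r - s) = t j [^] (r - s) \<otimes> t i [^] s"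
      using i t_comm by (intro pow_commute pow_commute[symmetric]) auto
    then have "t i [^] s \<otimes> t j [^] (r - s) \<otimes> x = t j [^] (r - s) \<otimes> (t j [^] s \<otimes> x)"
      using i x p[of s] by (simp add: m_assoc)
    also have "\<dots> = t j [^] (r - s + s) \<otimes> x" using i x by (simp add: m_assoc flip: nat_pow_mult)
    finally show ?thesis using s i x t_pow by simp
  qed
  have "e i j \<otimes> x = c \<otimes> ((\<Oplus>s\<in>{..<r}. t i [^] s \<otimes> t j [^] (r - s)) \<otimes> x)"
    unfolding e_def using i x by (intro m_assoc) (auto intro!: finsum_closed)
  also have "(\<Oplus>s\<in>{..<r}. t i [^] s \<otimes> t j [^] (r - s)) \<otimes> x =
      (\<Oplus>s\<in>{..<r}. t i [^] s \<otimes> t j [^] (r - s) \<otimes> x)"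
    using i x by (intro finsum_ldistr) auto
  also have "\<dots> = (\<Oplus>s\<in>{..<r}. x)" using x q by (intro finsum_cong') auto
  also have "\<dots> = [r] \<cdot> x" using add.finprod_const[OF x(1), of "{..<r}"] by (simp add: add_pow_def)
  also have "\<dots> = ([r] \<cdot> \<one>) \<otimes> x" using x by (simp add: add_pow_ldistr)
  also have "c \<otimes> \<dots> = (c \<otimes> [r] \<cdot> \<one>) \<otimes> x" using x by (simp add: m_assoc)
  finally show ?thesis using x c_inv by simp
qed

sublocale ties B n g e
proof unfold_locales
  fix i j k l assume i: "i \<in> {1..n}" and j: "j \<in> {1..n}"
  show "e i i = \<one>" using e_absorb[OF i i, of \<one>] i by simp
  show "e i j \<otimes> e i j = e i j" using t_e[OF i j] i j by (intro e_absorb) auto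
  \<comment> \<open>Each of \<open>e i j\<close> and \<open>e j i\<close> absorbs the other, and
    they commute.\<close>
  have "e i j \<otimes> e j i = e j i" using t_e[OF j i] i j by (intro e_absorb) auto
  moreover have "e j i \<otimes> e i j = e i j" using t_e[OF i j] i j by (intro e_absorb) auto
  ultimately show "e i j = e j i" using e_e_comm[OF i j j i] by simp
  { assume k: "k \<in> {1..<n}"
    have "g k \<otimes> t i = t (sw k i) \<otimes> g k" if "i \<in> {1..n}" for i
      using t_g[OF k sw_in[OF k that]] by simp
    then show "g k \<otimes> e i j = e (sw k i) (sw k j) \<otimes> g k"
      using i j k sw_in[OF k] by (intro e_commute) auto }
  { assume k: "k \<in> {1..n}"
    define x y where "x = e i j \<otimes> e j k" and "y = e i j \<otimes> e i k"
    have te: "t l \<otimes> (e i j \<otimes> w) = e i j \<otimes> (t l \<otimes> w)" if "l \<in> {1..n}" "w \<in> carrier B" for l w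
      using that i j t_e_comm[OF i j that(1)] by (simp flip: m_assoc)
    have tij: "t i \<otimes> (e i j \<otimes> w) = t j \<otimes> (e i j \<otimes> w)" if "w \<in> carrier B" for w
      using that i j t_e[OF i j] by (simp flip: m_assoc)
    \<comment> \<open>On a product of two edges all three \<open>t\<close> agree, so it absorbs the
      missing edge; both products therefore equal the product of all three edges.\<close>
    have "t i \<otimes> x = t k \<otimes> x"
      unfolding x_def using i j k by (simp add: tij) (simp add: te t_e[OF j k])
    then have 1: "e i k \<otimes> x = x" using i j k by (intro e_absorb) (auto simp: x_def)
    have "t j \<otimes> y = t k \<otimes> y"
      unfolding y_def using i j k by (simp flip: tij) (simp add: te t_e[OF i k])
    then have 2: "e j k \<otimes> y = y" using i j k by (intro e_absorb) (auto simp: y_def)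
    have "e i k \<otimes> x = e i j \<otimes> (e i k \<otimes> e j k)"
      unfolding x_def using i j k e_e_comm[OF i k i j] by (simp flip: m_assoc)
    also have "\<dots> = e i j \<otimes> (e j k \<otimes> e i k)" using e_e_comm[OF i k j k] by simp
    also have "\<dots> = e j k \<otimes> y"
      unfolding y_def using i j k e_e_comm[OF j k i j] by (simp flip: m_assoc)
    finally show "e i j \<otimes> e j k = e i j \<otimes> e i k" using 1 2 x_def y_def by simp }
qed (auto simp: e_e_comm)

lemma bt_hold: "(u, v) \<in> bt_relations B n z g (yh_idem B r c t) \<Longrightarrow> u = v"
  unfolding yh_idem_eq
  by (rule bt_relations_hold) (use g_far g_braid g_quad yh_idem_eq in auto)

end

section \<open>The ties of the algebra of braids and ties\<close>

text \<open>Adjacent transpositions generate all: (a, a+d+1) is (a, a+d) conjugated by the adjacent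
  one at a+d. Four arguments are carried along so that a statement about two ties can be moved as a
  whole.\<close>

lemma transpose_invariant:
  fixes Q :: "nat \<Rightarrow> nat \<Rightarrow> nat \<Rightarrow> nat \<Rightarrow> bool"
  assumes inv: "\<And>m i j k l. m \<in> {1..<n} \<Longrightarrow> {i, j, k, l} \<subseteq> {1..n} \<Longrightarrow> Q i j k l \<Longrightarrow> Q (sw m i) (sw m j) (sw m k) (sw m l)"
    and ab: "a \<in> {1..n}" "b \<in> {1..n}"
    and "{i, j, k, l} \<subseteq> {1..n}" "Q i j k l"
  shows "Q (Transposition.transpose a b i) (Transposition.transpose a b j)
           (Transposition.transpose a b k) (Transposition.transpose a b l)"
proof -
  have *: "Q (Transposition.transpose a (a + d) i) (Transposition.transpose a (a + d) j)
           (Transposition.transpose a (a + d) k) (Transposition.transpose a (a + d) l)"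
    if "a \<ge> 1" "a + d \<le> n" "{i, j, k, l} \<subseteq> {1..n}" "Q i j k l" for a d i j k l
    using that
  proof (induction d arbitrary: i j k l)
    case 0
    then show ?case by simp
  next
    case (Suc d)
    show ?case
    \<comment> \<open>For d = 0 the inner transposition is trivial and conjugating it would give the
      identity; here the adjacent transposition itself is meant.\<close>
    proof (cases "d = 0")
      case True
      then show ?thesis using inv[of a i j k l] Suc.prems by simp
    next
      case False
      let ?b = "a + d"
      let ?t = "Transposition.transpose a ?b"
      have b: "?b \<in> {1..<n}" using Suc.prems by auto
      have e: "sw ?b (?t (sw ?b x)) = Transposition.transpose a (a + Suc d) x" for x
        using False by (auto simp: Transposition.transpose_def)
      have s: "{sw ?b i, sw ?b j, sw ?b k, sw ?b l} \<subseteq> {1..n}"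
        using Suc.prems sw_in[OF b] by simp
      have t: "x \<in> {1..n} \<Longrightarrow> ?t x \<in> {1..n}" for x
        using b Suc.prems(1) by (auto simp: Transposition.transpose_def)
      have "Q (sw ?b i) (sw ?b j) (sw ?b k) (sw ?b l)" using inv b Suc.prems by blast
      then have "Q (?t (sw ?b i)) (?t (sw ?b j)) (?t (sw ?b k)) (?t (sw ?b l))"
        using Suc.IH[OF _ _ s] Suc.prems by auto
      then have "Q (sw ?b (?t (sw ?b i))) (sw ?b (?t (sw ?b j))) (sw ?b (?t (sw ?b k))) (sw ?b (?t (sw ?b l)))"
        using s t by (intro inv[OF b]) blast+
      then show ?thesis unfolding e .
    qed
  qed
  show ?thesis
  proof (cases "a \<le> b")
    case True
    then show ?thesis using *[of a "b - a" i j k l] assms by auto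
  next
    case False
    then show ?thesis using *[of b "a - b" i j k l] assms
      by (simp add: Transposition.transpose_commute)
  qed
qed

text \<open>At most four transpositions move such labels to 1, 2, 3 and one of 2, 3, 4, and
  invariance carries the base case back. Commutation and transitivity of ties then need a check only
  for labels up to 4.\<close>

lemma transpose_transitive:
  fixes Q :: "nat \<Rightarrow> nat \<Rightarrow> nat \<Rightarrow> nat \<Rightarrow> bool"
  assumes inv: "\<And>m i j k l. m \<in> {1..<n} \<Longrightarrow> {i, j, k, l} \<subseteq> {1..n} \<Longrightarrow> Q i j k l \<Longrightarrow> Q (sw m i) (sw m j) (sw m k) (sw m l)"
    and ijk: "{i, j, k, l} \<subseteq> {1..n}" "distinct [i, j, k]" "l \<in> {j, k} \<or> l \<notin> {i, j, k}"
    and base: "Q 1 2 3 (if l = j then 2 else if l = k then 3 else 4)"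
  shows "Q i j k l"
proof -
  let ?t = "Transposition.transpose"
  have I: "Q (?t a b i) (?t a b j) (?t a b k) (?t a b l)"
    if "a \<in> {1..n}" "b \<in> {1..n}" "{i, j, k, l} \<subseteq> {1..n}" "Q i j k l" for a b i j k l
    using inv that by (rule transpose_invariant)
  have t: "x \<in> {1..n} \<Longrightarrow> a \<in> {1..n} \<Longrightarrow> b \<in> {1..n} \<Longrightarrow> ?t a b x \<in> {1..n}" for x a b :: nat
    by (auto simp: Transposition.transpose_def)
  have "card {i, j, k} \<le> card {1..n}" by (rule card_mono) (use ijk in auto)
  then have n3: "n \<ge> 3" using ijk(2) by simp
  have n4: "n \<ge> 4" if "l \<notin> {i, j, k}"
  proof -
    have "card {i, j, k, l} \<le> card {1..n}" by (rule card_mono) (use ijk in auto)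
    then show ?thesis using ijk(2) that by auto
  qed
  \<comment> \<open>Images under three successive transpositions, which place \<open>i\<close> at 1,
    the image of \<open>j\<close> at 2 and the image of \<open>k\<close> at 3, while
    \<open>l\<close> follows along.\<close>
  define j1 k1 l1 where "j1 = ?t 1 i j" and "k1 = ?t 1 i k" and "l1 = ?t 1 i l"
  define k2 l2 where "k2 = ?t 2 j1 k1" and "l2 = ?t 2 j1 l1"
  define l3 where "l3 = ?t 3 k2 l2"
  have n: "1 \<in> {1..n}" "2 \<in> {1..n}" "3 \<in> {1..n}" using n3 by auto
  have in0: "i \<in> {1..n}" "j \<in> {1..n}" "k \<in> {1..n}" "l \<in> {1..n}" using ijk(1) by auto
  have in1: "j1 \<in> {1..n}" "k1 \<in> {1..n}" "l1 \<in> {1..n}"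
    unfolding j1_def k1_def l1_def by (rule t[OF _ n(1) in0(1)] in0)+
  have in2: "k2 \<in> {1..n}" "l2 \<in> {1..n}"
    unfolding k2_def l2_def by (rule t[OF _ n(2) in1(1)] in1)+
  have in3: "l3 \<in> {1..n}" unfolding l3_def by (rule t[OF _ n(3) in2(1)] in2)+
  have d1: "distinct [1, j1, k1]" using ijk(2) unfolding j1_def k1_def
    by (auto simp: Transposition.transpose_def split: if_splits)
  have d2: "distinct [1, 2, k2]" using d1 unfolding k2_def
    by (auto simp: Transposition.transpose_def split: if_splits)
  have lj: "l3 = 2" if "l = j"
  proof -
    have "l2 = 2" using that by (simp add: l2_def l1_def j1_def)
    then show ?thesis using d2 by (simp add: l3_def Transposition.transpose_def)
  qed
  have lk: "l3 = 3" if "l = k"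
    using that by (simp add: l3_def l2_def k2_def l1_def k1_def)
  have ln: "l3 \<notin> {1, 2, 3}" if "l \<notin> {j, k}"
  proof -
    have "l \<notin> {i, j, k}" using that ijk(3) by blast
    then have "l1 \<notin> {1, j1, k1}" unfolding l1_def j1_def k1_def
      by (simp add: Transposition.transpose_def)
    then have "l2 \<notin> {1, 2, k2}" using d1 unfolding l2_def k2_def
      by (simp add: Transposition.transpose_def)
    then show ?thesis using d2 unfolding l3_def by (simp add: Transposition.transpose_def)
  qed
  have Q3: "Q 1 2 3 l3"
  proof (cases "l \<in> {j, k}")
    case True
    then show ?thesis using base lj lk by (auto split: if_splits)
  next
    case False
    then have l: "l3 \<notin> {1, 2, 3}" "n \<ge> 4" using ln n4 ijk(3) by auto
    have "Q (?t 4 l3 1) (?t 4 l3 2) (?t 4 l3 3) (?t 4 l3 4)"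
      by (rule I) (use False base in3 l in \<open>auto split: if_splits\<close>)
    then show ?thesis using l by (simp add: Transposition.transpose_def split: if_splits)
  qed
  \<comment> \<open>The transpositions are involutions, so applying them in reverse order leads back
    to the given labels.\<close>
  have "Q (?t 3 k2 1) (?t 3 k2 2) (?t 3 k2 3) (?t 3 k2 l3)"
    by (rule I) (use in2 in3 n Q3 in auto)
  moreover have "?t 3 k2 l3 = l2" by (simp add: l3_def)
  ultimately have Q2: "Q 1 2 k2 l2" using d2 by (simp add: Transposition.transpose_def split: if_splits)
  have "Q (?t 2 j1 1) (?t 2 j1 2) (?t 2 j1 k2) (?t 2 j1 l2)"
    by (rule I) (use in1 in2 n Q2 in auto)
  moreover have "?t 2 j1 k2 = k1" "?t 2 j1 l2 = l1" by (simp_all add: k2_def l2_def)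
  ultimately have Q1: "Q 1 j1 k1 l1" using d1 by (simp add: Transposition.transpose_def split: if_splits)
  have "Q (?t 1 i 1) (?t 1 i j1) (?t 1 i k1) (?t 1 i l1)"
    by (rule I) (use in1 in0 n Q1 in auto)
  moreover have "?t 1 i j1 = j" "?t 1 i k1 = k" "?t 1 i l1 = l" "?t 1 i 1 = i" by (simp_all add: j1_def k1_def l1_def)
  ultimately show ?thesis by simp
qed

context monoid
begin

lemma unit_rcancel: "u \<in> Units G \<Longrightarrow> x \<in> carrier G \<Longrightarrow> y \<in> carrier G \<Longrightarrow> x \<otimes> u = y \<otimes> u \<Longrightarrow> x = y"
  by (metis Units_closed Units_inv_closed Units_r_inv m_assoc r_one)

text \<open>\<open>y\<close> and \<open>y'\<close> are the conjugates of \<open>x\<close> and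
  \<open>x'\<close> by the unit \<open>u\<close>. Since \<open>v\<close> commutes with
  \<open>u\<close>, the way \<open>v\<close> passes \<open>x\<close> determines the way it passes
  \<open>y\<close>. This is the inductive step whenever a tie is lengthened by conjugation.\<close>

lemma conj_transport:
  assumes "u \<in> Units G" "v \<in> carrier G" "x \<in> carrier G" "x' \<in> carrier G" "y \<in> carrier G" "y' \<in> carrier G"
    and "u \<otimes> v = v \<otimes> u" "u \<otimes> x = y \<otimes> u" "u \<otimes> x' = y' \<otimes> u" "v \<otimes> x = x' \<otimes> v"
  shows "v \<otimes> y = y' \<otimes> v"
proof (rule unit_rcancel[OF assms(1)])
  note [simp] = assms(2-6) Units_closed[OF assms(1)]
  have "v \<otimes> y \<otimes> u = v \<otimes> u \<otimes> x" using assms(8) by (simp add: m_assoc)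
  also have "\<dots> = u \<otimes> (v \<otimes> x)" unfolding assms(7)[symmetric] by (simp add: m_assoc)
  also have "\<dots> = (u \<otimes> x') \<otimes> v" using assms(10) by (simp add: m_assoc)
  also have "\<dots> = y' \<otimes> (u \<otimes> v)" using assms(9) by (simp add: m_assoc)
  also have "\<dots> = y' \<otimes> v \<otimes> u" using assms(7) by (simp add: m_assoc)
  finally show "v \<otimes> y \<otimes> u = y' \<otimes> v \<otimes> u" .
qed (use assms in auto)

end

locale bt_rep = ring B for B :: "('b, 'm) ring_scheme" (structure) +
  fixes n :: nat and z :: 'b and g e :: "nat \<Rightarrow> 'b"
  assumes z_closed [simp]: "z \<in> carrier B"
    and z_central: "x \<in> carrier B \<Longrightarrow> z \<otimes> x = x \<otimes> z"
    and g_closed [simp]: "k \<in> {1..<n} \<Longrightarrow> g k \<in> carrier B"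
    and e_closed [simp]: "k \<in> {1..<n} \<Longrightarrow> e k \<in> carrier B"
    and rels: "(u, v) \<in> bt_relations B n z g e \<Longrightarrow> u = v"
begin

section \<open>The defining relations one by one, and invertibility of the braid generators\<close>

definition adj where "adj i j \<longleftrightarrow> i \<in> {1..<n} \<and> j \<in> {1..<n} \<and> \<bar>int i - int j\<bar> = 1"

lemma g_far: "i \<in> {1..<n} \<Longrightarrow> j \<in> {1..<n} \<Longrightarrow> \<bar>int i - int j\<bar> > 1 \<Longrightarrow> g i \<otimes> g j = g j \<otimes> g i"
  by (rule rels) (unfold bt_relations_def Let_def, blast)

lemma g_e: "i \<in> {1..<n} \<Longrightarrow> g i \<otimes> e i = e i \<otimes> g i"
  by (rule rels) (unfold bt_relations_def Let_def, blast)

lemma g_braid: "adj i j \<Longrightarrow> g i \<otimes> g j \<otimes> g i = g j \<otimes> g i \<otimes> g j"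
  by (rule rels) (unfold bt_relations_def Let_def adj_def, blast)

lemma e_g_g: "adj i j \<Longrightarrow> e i \<otimes> g j \<otimes> g i = g j \<otimes> g i \<otimes> e j"
  by (rule rels) (unfold bt_relations_def Let_def adj_def, blast)

lemma e_e_g: "adj i j \<Longrightarrow> e i \<otimes> e j \<otimes> g j = e i \<otimes> g j \<otimes> e i"
  by (rule rels) (unfold bt_relations_def Let_def adj_def, blast)

lemma e_g_e: "adj i j \<Longrightarrow> e i \<otimes> g j \<otimes> e i = g j \<otimes> e i \<otimes> e j"
  by (rule rels) (unfold bt_relations_def Let_def adj_def, blast)

lemma e_e: "i \<in> {1..<n} \<Longrightarrow> j \<in> {1..<n} \<Longrightarrow> e i \<otimes> e j = e j \<otimes> e i"
  by (rule rels) (unfold bt_relations_def Let_def, blast)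

lemma g_e_far: "i \<in> {1..<n} \<Longrightarrow> j \<in> {1..<n} \<Longrightarrow> \<bar>int i - int j\<bar> > 1 \<Longrightarrow> g i \<otimes> e j = e j \<otimes> g i"
  by (rule rels) (unfold bt_relations_def Let_def, blast)

lemma e_sq: "i \<in> {1..<n} \<Longrightarrow> e i \<otimes> e i = e i"
proof -
  assume i: "i \<in> {1..<n}"
  have "e i [^] (2::nat) = e i" by (rule rels) (unfold bt_relations_def Let_def, use i in blast)
  then show ?thesis using i by (simp add: numeral_2_eq_2)
qed

lemma g_sq: "i \<in> {1..<n} \<Longrightarrow> g i \<otimes> g i = \<one> \<oplus> z \<otimes> (e i \<otimes> g i)"
proof -
  assume i: "i \<in> {1..<n}"
  have "g i [^] (2::nat) = \<one> \<oplus> z \<otimes> (e i \<otimes> g i)"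
    by (rule rels) (unfold bt_relations_def Let_def, use i in blast)
  then show ?thesis using i by (simp add: numeral_2_eq_2)
qed

lemma g_unit [simp]: assumes i: "i \<in> {1..<n}" shows "g i \<in> Units B"
proof -
  \<comment> \<open>The quadratic relation can be read as g (g - z e) = 1, which names the
    inverse.\<close>
  define y where "y = g i \<ominus> z \<otimes> e i"
  have y: "y \<in> carrier B" using i by (simp add: y_def)
  have "g i \<otimes> y = g i \<otimes> g i \<ominus> (g i \<otimes> z) \<otimes> e i"
    using i by (simp add: y_def minus_eq r_distr r_minus m_assoc)
  also have "(g i \<otimes> z) \<otimes> e i = z \<otimes> (e i \<otimes> g i)"
    using i z_central[of "g i"] g_e[OF i] by (simp add: m_assoc flip: z_central)
  also have "g i \<otimes> g i \<ominus> z \<otimes> (e i \<otimes> g i) = \<one>"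
    unfolding g_sq[OF i] using i by (simp add: minus_eq a_assoc r_neg)
  finally have 1: "g i \<otimes> y = \<one>" .
  have "y \<otimes> g i = g i \<otimes> g i \<ominus> z \<otimes> (e i \<otimes> g i)"
    using i by (simp add: y_def minus_eq l_distr l_minus m_assoc)
  also have "\<dots> = \<one>"
    unfolding g_sq[OF i] using i by (simp add: minus_eq a_assoc r_neg)
  finally show ?thesis using 1 y i by (auto simp: Units_def)
qed

text \<open>By the quadratic relation this amounts to \<open>e k \<otimes> g k\<close> commuting
  with \<open>e i\<close>, which the mixed relations for adjacent indices provide. It makes
  conjugation by \<open>g k\<close> and by its inverse agree on \<open>e i\<close>.\<close>

lemma g_sq_e:
  assumes "adj i k"
  shows "(g k \<otimes> g k) \<otimes> e i = e i \<otimes> (g k \<otimes> g k)"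
proof -
  have ik: "i \<in> {1..<n}" "k \<in> {1..<n}" using assms by (auto simp: adj_def)
  have "e k \<otimes> g k \<otimes> e i = g k \<otimes> (e k \<otimes> e i)" using ik g_e by (simp add: m_assoc flip: g_e)
  also have "\<dots> = g k \<otimes> e i \<otimes> e k" using ik e_e[of i k] by (simp add: m_assoc)
  also have "\<dots> = e i \<otimes> (e k \<otimes> g k)" using e_e_g[OF assms] e_g_e[OF assms] ik by (simp add: m_assoc)
  finally have *: "e k \<otimes> g k \<otimes> e i = e i \<otimes> (e k \<otimes> g k)" .
  have "z \<otimes> (e k \<otimes> g k) \<otimes> e i = z \<otimes> (e i \<otimes> (e k \<otimes> g k))" using ik * by (simp add: m_assoc)
  also have "\<dots> = e i \<otimes> (z \<otimes> (e k \<otimes> g k))" using ik z_central[of "e i"] by (simp flip: m_assoc)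
  finally show ?thesis unfolding g_sq[OF ik(2)] using ik by (simp add: l_distr r_distr)
qed

section \<open>Ties of arbitrary pairs by conjugation, and how each braid generator moves
  them\<close>

primrec a :: "nat \<Rightarrow> nat \<Rightarrow> 'b" where
  "a i 0 = e i"
| "a i (Suc d) = g (Suc (i + d)) \<otimes> a i d \<otimes> inv g (Suc (i + d))"

text \<open>The second argument of \<open>a\<close> is the distance of the tied labels minus one:
  \<open>a i d\<close> joins \<open>i\<close> to \<open>i + d + 1\<close>, and each further
  conjugation moves the upper end up by one.\<close>

definition aij :: "nat \<Rightarrow> nat \<Rightarrow> 'b" where "aij i j = a i (j - Suc i)"

lemma aij_base: "aij i (Suc i) = e i"
  by (simp add: aij_def)

lemma a_closed' [simp]: "i \<ge> 1 \<Longrightarrow> i + d < n \<Longrightarrow> a i d \<in> carrier B"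
  by (induction d) auto

lemma aij_closed [simp]: "1 \<le> i \<Longrightarrow> i < j \<Longrightarrow> j \<le> n \<Longrightarrow> aij i j \<in> carrier B"
  by (simp add: aij_def)

lemma aij_up:
  assumes "1 \<le> i" "i < j" "j < n"
  shows "g j \<otimes> aij i j = aij i (Suc j) \<otimes> g j"
proof -
  have e: "Suc (i + (j - Suc i)) = j" "Suc j - Suc i = Suc (j - Suc i)" using assms by auto
  have "aij i (Suc j) = g j \<otimes> aij i j \<otimes> inv g j" unfolding aij_def e(2) a.simps e(1) ..
  then show ?thesis using assms by (simp add: m_assoc)
qed

lemma aij_commute_far:
  assumes "1 \<le> i" "i < j" "j \<le> n" "k \<in> {1..<n}" "k > j \<or> Suc k < i"
  shows "g k \<otimes> aij i j = aij i j \<otimes> g k"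
proof -
  have "Suc i \<le> j" using assms by simp
  then show ?thesis using assms(3,5)
  proof (induction j rule: dec_induct)
    case base
    have "g k \<otimes> e i = e i \<otimes> g k" by (rule g_e_far) (use base assms in auto)
    then show ?case by (simp add: aij_base)
  next
    case (step j)
    show ?case
    proof (rule conj_transport[of "g j" "g k" "aij i j" "aij i j"])
      show "g j \<otimes> g k = g k \<otimes> g j" using step assms by (intro g_far) auto
      show "g k \<otimes> aij i j = aij i j \<otimes> g k" using step by auto
    qed (use assms step in \<open>auto intro!: aij_up\<close>)
  qed
qed

text \<open>The tie over two steps is settled by \<open>e_g_g\<close> after cancelling
  \<open>g (Suc i)\<close>; longer ties follow because \<open>g i\<close> commutes with the
  generators that lengthen them further.\<close>

lemma aij_left:
  assumes "1 \<le> i" "Suc i < j" "j \<le> n"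
  shows "g i \<otimes> aij i j = aij (Suc i) j \<otimes> g i"
proof -
  have "Suc (Suc i) \<le> j" using assms by simp
  then show ?thesis using assms(3)
  proof (induction j rule: dec_induct)
    case base
    have i: "i \<in> {1..<n}" "Suc i \<in> {1..<n}" "adj (Suc i) i" using base assms by (auto simp: adj_def)
    show ?case
    proof (rule unit_rcancel[of "g (Suc i)"])
      have "g i \<otimes> aij i (Suc (Suc i)) \<otimes> g (Suc i) = g i \<otimes> (g (Suc i) \<otimes> aij i (Suc i))"
        using i aij_up[of i "Suc i"] by (simp add: m_assoc)
      also have "\<dots> = e (Suc i) \<otimes> g i \<otimes> g (Suc i)"
        using i e_g_g[OF i(3)] by (simp add: aij_base m_assoc)
      finally show "g i \<otimes> aij i (Suc (Suc i)) \<otimes> g (Suc i) = aij (Suc i) (Suc (Suc i)) \<otimes> g i \<otimes> g (Suc i)"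
        by (simp add: aij_base)
    qed (use i in \<open>auto simp: aij_base\<close>)
  next
    case (step j)
    show ?case
    proof (rule conj_transport[of "g j" "g i" "aij i j" "aij (Suc i) j"])
      show "g j \<otimes> g i = g i \<otimes> g j" using step assms by (intro g_far) auto
      show "g i \<otimes> aij i j = aij (Suc i) j \<otimes> g i" using step by auto
    qed (use assms step in \<open>auto intro!: aij_up\<close>)
  qed
qed

text \<open>For j = k + 2 the tie is the conjugate by \<open>v \<otimes> u\<close> of the tie of
  \<open>i\<close> and \<open>k\<close>, where \<open>u\<close> is \<open>g k\<close> and
  \<open>v\<close> is \<open>g (Suc k)\<close>. The braid relation turns \<open>u\<close> on the
  left of \<open>v \<otimes> u\<close> into \<open>v\<close> on its right, and \<open>v\<close>
  commutes with the shorter tie.\<close>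

lemma aij_middle:
  assumes "1 \<le> i" "i < k" "Suc k < j" "j \<le> n"
  shows "g k \<otimes> aij i j = aij i j \<otimes> g k"
proof -
  have "Suc (Suc k) \<le> j" using assms by simp
  then show ?thesis using assms(4)
  proof (induction j rule: dec_induct)
    case base
    define x y u v where "x = aij i k" and "y = aij i (Suc (Suc k))" and "u = g k" and "v = g (Suc k)"
    have k: "k \<in> {1..<n}" "Suc k \<in> {1..<n}" "adj k (Suc k)" using base assms by (auto simp: adj_def)
    have U: "u \<in> Units B" "v \<in> Units B" using k by (auto simp: u_def v_def)
    have cl[simp]: "x \<in> carrier B" "y \<in> carrier B" "u \<in> carrier B" "v \<in> carrier B"
      using k assms base by (auto simp: x_def y_def u_def v_def)
    have bc: "u \<otimes> v \<otimes> u = v \<otimes> u \<otimes> v" using g_braid[OF k(3)] by (simp add: u_def v_def)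
    have vx: "v \<otimes> x = x \<otimes> v" unfolding v_def x_def using assms base by (intro aij_commute_far) auto
    have c: "v \<otimes> u \<otimes> x = y \<otimes> (v \<otimes> u)"
    proof -
      have "u \<otimes> x = aij i (Suc k) \<otimes> u" "v \<otimes> aij i (Suc k) = y \<otimes> v" "aij i (Suc k) \<in> carrier B"
        unfolding u_def x_def y_def v_def using assms base by (auto intro!: aij_up)
      then show ?thesis by (simp add: m_assoc) (simp flip: m_assoc)
    qed
    have "u \<otimes> y = y \<otimes> u"
    proof (rule unit_rcancel[of "v \<otimes> u"])
      have "u \<otimes> y \<otimes> (v \<otimes> u) = u \<otimes> v \<otimes> u \<otimes> x" using c by (simp add: m_assoc)
      also have "\<dots> = v \<otimes> u \<otimes> (v \<otimes> x)" unfolding bc by (simp add: m_assoc)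
      also have "\<dots> = (v \<otimes> u \<otimes> x) \<otimes> v" unfolding vx by (simp add: m_assoc)
      also have "\<dots> = y \<otimes> (v \<otimes> u \<otimes> v)" unfolding c by (simp add: m_assoc)
      also have "\<dots> = y \<otimes> u \<otimes> (v \<otimes> u)" unfolding bc[symmetric] by (simp add: m_assoc)
      finally show "u \<otimes> y \<otimes> (v \<otimes> u) = y \<otimes> u \<otimes> (v \<otimes> u)" .
    qed (use U in auto)
    then show ?case by (simp add: u_def y_def)
  next
    case (step j)
    show ?case
    proof (rule conj_transport[of "g j" "g k" "aij i j" "aij i j"])
      show "g j \<otimes> g k = g k \<otimes> g j" using step assms by (intro g_far) auto
      show "g k \<otimes> aij i j = aij i j \<otimes> g k" using step by auto
    qed (use assms step in \<open>auto intro!: aij_up\<close>)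
  qed
qed

text \<open>The lower end descends from the adjacent case \<open>g_sq_e\<close>: conjugation by
  \<open>g i\<close>, which commutes with \<open>g k\<close>, carries the claim from
  \<open>Suc i\<close> to \<open>i\<close>.\<close>

lemma g_sq_aij_right:
  assumes "1 \<le> i" "i < k" "k < n"
  shows "(g k \<otimes> g k) \<otimes> aij i k = aij i k \<otimes> (g k \<otimes> g k)"
  using assms
proof (induction "k - Suc i" arbitrary: i)
  case 0
  then have "k = Suc i" by simp
  then show ?case using 0 by (simp add: aij_base) (rule g_sq_e, auto simp: adj_def)
next
  case (Suc d)
  define x x' u s where "x = aij i k" and "x' = aij (Suc i) k" and "u = g i" and "s = g k \<otimes> g k"
  have cl[simp]: "x \<in> carrier B" "x' \<in> carrier B" "u \<in> carrier B" "s \<in> carrier B" and U: "u \<in> Units B"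
    using Suc by (auto simp: x_def x'_def u_def s_def)
  have IH: "s \<otimes> x' = x' \<otimes> s" unfolding s_def x'_def using Suc by (intro Suc.hyps(1)) auto
  have ux: "u \<otimes> x = x' \<otimes> u" unfolding u_def x_def x'_def using Suc by (intro aij_left) auto
  have ug: "g i \<otimes> g k = g k \<otimes> g i" using Suc by (intro g_far) auto
  have us: "u \<otimes> s = s \<otimes> u"
  proof -
    have cl': "g i \<in> carrier B" "g k \<in> carrier B" using Suc by auto
    then show ?thesis unfolding u_def s_def using ug by (metis m_assoc)
  qed
  have "u \<otimes> (s \<otimes> x) = u \<otimes> (x \<otimes> s)"
  proof -
    have "u \<otimes> (s \<otimes> x) = s \<otimes> (u \<otimes> x)" using us by (simp flip: m_assoc)
    also have "\<dots> = s \<otimes> x' \<otimes> u" unfolding ux by (simp add: m_assoc)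
    also have "\<dots> = x' \<otimes> (s \<otimes> u)" unfolding IH by (simp add: m_assoc)
    also have "\<dots> = x' \<otimes> u \<otimes> s" unfolding us[symmetric] by (simp add: m_assoc)
    also have "\<dots> = u \<otimes> (x \<otimes> s)" unfolding ux[symmetric] by (simp add: m_assoc)
    finally show ?thesis .
  qed
  then have "s \<otimes> x = x \<otimes> s" using Units_l_cancel[OF U] by simp
  then show ?case by (simp add: s_def x_def)
qed

text \<open>Compared with \<open>aij_up\<close> the conjugation runs backwards. The two differ by
  the square of \<open>g k\<close>, which commutes with the shorter tie.\<close>

lemma aij_down:
  assumes "1 \<le> i" "i < k" "k < n"
  shows "g k \<otimes> aij i (Suc k) = aij i k \<otimes> g k"
proof (rule unit_rcancel[of "g k"])
  have k: "k \<in> {1..<n}" using assms by auto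
  have "g k \<otimes> aij i (Suc k) \<otimes> g k = (g k \<otimes> g k) \<otimes> aij i k"
    using assms k aij_up[OF assms] by (simp add: m_assoc)
  then show "g k \<otimes> aij i (Suc k) \<otimes> g k = aij i k \<otimes> g k \<otimes> g k"
    unfolding g_sq_aij_right[OF assms] using assms k by (simp add: m_assoc)
qed (use assms in auto)

text \<open>Under \<open>g k\<close> the tie over two steps is conjugate to
  \<open>e (Suc k)\<close>, to which \<open>g_sq_e\<close> applies; raising the upper end further
  uses generators far from \<open>g k\<close>.\<close>

lemma g_sq_aij_left:
  assumes "1 \<le> k" "Suc k < j" "j \<le> n"
  shows "(g k \<otimes> g k) \<otimes> aij k j = aij k j \<otimes> (g k \<otimes> g k)"
proof -
  have "Suc (Suc k) \<le> j" using assms by simp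
  then show ?thesis using assms(3)
  proof (induction j rule: dec_induct)
    case base
    have k: "k \<in> {1..<n}" "Suc k \<in> {1..<n}" "adj (Suc k) k" using base assms by (auto simp: adj_def)
    define x x' u where "x = aij k (Suc (Suc k))" and "x' = e (Suc k)" and "u = g k"
    have cl[simp]: "x \<in> carrier B" "x' \<in> carrier B" "u \<in> carrier B" and U: "u \<in> Units B"
      using k by (auto simp: x_def x'_def u_def)
    have c: "(u \<otimes> u) \<otimes> x' = x' \<otimes> (u \<otimes> u)" unfolding u_def x'_def by (rule g_sq_e[OF k(3)])
    have ux: "u \<otimes> x = x' \<otimes> u"
      unfolding u_def x_def x'_def using aij_left[of k "Suc (Suc k)"] k by (simp add: aij_base)
    have "u \<otimes> (u \<otimes> u \<otimes> x) = u \<otimes> (x \<otimes> (u \<otimes> u))"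
    proof -
      have "u \<otimes> (u \<otimes> u \<otimes> x) = (u \<otimes> u) \<otimes> (u \<otimes> x)" by (simp add: m_assoc)
      also have "\<dots> = (u \<otimes> u) \<otimes> x' \<otimes> u" unfolding ux by (simp add: m_assoc)
      also have "\<dots> = (x' \<otimes> u) \<otimes> (u \<otimes> u)" unfolding c by (simp add: m_assoc)
      also have "\<dots> = u \<otimes> (x \<otimes> (u \<otimes> u))" unfolding ux[symmetric] by (simp add: m_assoc)
      finally show ?thesis .
    qed
    then have "u \<otimes> u \<otimes> x = x \<otimes> (u \<otimes> u)" using Units_l_cancel[OF U] by simp
    then show ?case by (simp add: u_def x_def)
  next
    case (step j)
    show ?case
    proof (rule conj_transport[of "g j" _ "aij k j" "aij k j"])
      have "g j \<otimes> g k = g k \<otimes> g j" using step assms by (intro g_far) auto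
      moreover have "g j \<in> carrier B" "g k \<in> carrier B" using step assms by auto
      ultimately show "g j \<otimes> (g k \<otimes> g k) = g k \<otimes> g k \<otimes> g j"
        by (metis m_assoc)
      show "g k \<otimes> g k \<otimes> aij k j = aij k j \<otimes> (g k \<otimes> g k)" using step by auto
    qed (use assms step in \<open>auto intro!: aij_up\<close>)
  qed
qed

lemma aij_left':
  assumes "1 \<le> k" "Suc k < j" "j \<le> n"
  shows "g k \<otimes> aij (Suc k) j = aij k j \<otimes> g k"
proof (rule unit_rcancel[of "g k"])
  have k: "k \<in> {1..<n}" using assms by auto
  have "g k \<otimes> aij (Suc k) j \<otimes> g k = (g k \<otimes> g k) \<otimes> aij k j"
    using assms k aij_left[OF assms] by (simp add: m_assoc)
  then show "g k \<otimes> aij (Suc k) j \<otimes> g k = aij k j \<otimes> g k \<otimes> g k"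
    unfolding g_sq_aij_left[OF assms] using assms k by (simp add: m_assoc)
qed (use assms in auto)

section \<open>The tie axioms for the algebra of braids and ties\<close>

definition tie :: "nat \<Rightarrow> nat \<Rightarrow> 'b" where
  "tie i j = (if i = j then \<one> else aij (min i j) (max i j))"

lemma tie_closed [simp]: "i \<in> {1..n} \<Longrightarrow> j \<in> {1..n} \<Longrightarrow> tie i j \<in> carrier B"
  by (auto simp: tie_def min_def max_def)

lemma tie_sym: "tie i j = tie j i"
  by (simp add: tie_def min.commute max.commute)

lemma tie_Suc: "tie i (Suc i) = e i"
  by (simp add: tie_def aij_base)

text \<open>There are seven positions of \<open>k\<close> and \<open>Suc k\<close> relative to the
  two ends: one end moves up or down, both are exchanged, or the tie stays as it is.\<close>

lemma tie_conj_less: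
  assumes k: "k \<in> {1..<n}" and i: "1 \<le> i" "i < j" "j \<le> n"
  shows "g k \<otimes> tie i j = tie (sw k i) (sw k j) \<otimes> g k"
proof -
  have t: "tie i j = aij i j" using i by (simp add: tie_def)
  have k1: "1 \<le> k" "k < n" using k by auto
  consider "k = j" | "k = i" "j = Suc i" | "k = i" "Suc i < j" | "i = Suc k" | "Suc k = j" "i < k"
    | "k > j \<or> Suc k < i" | "i < k" "Suc k < j" by linarith
  then show ?thesis
  proof cases
    case 1
    have "sw k i = i" "sw k j = Suc j" using 1 i by (auto simp: Transposition.transpose_def)
    then show ?thesis using 1 i k1 aij_up[of i j] by (simp add: t) (simp add: tie_def)
  next
    case 2
    then show ?thesis using g_e[OF k] by (simp add: tie_Suc tie_sym[of "Suc i"])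
  next
    case 3
    have "sw k i = Suc i" "sw k j = j" using 3 i by (auto simp: Transposition.transpose_def)
    then show ?thesis using 3 i k1 aij_left[of i j] by (simp add: t) (simp add: tie_def)
  next
    case 4
    have "sw k i = k" "sw k j = j" using 4 i by (auto simp: Transposition.transpose_def)
    then show ?thesis using 4 i k1 aij_left'[of k j] by (simp add: t) (simp add: tie_def)
  next
    case 5
    have "sw k i = i" "sw k j = k" using 5 i by (auto simp: Transposition.transpose_def)
    then show ?thesis using 5 i k1 aij_down[of i k] by (simp add: t) (simp add: tie_def)
  next
    case 6
    have "sw k i = i" "sw k j = j" using 6 i by (auto simp: Transposition.transpose_def)
    then show ?thesis using 6 i k aij_commute_far[of i j k] by (simp add: t)
  next
    case 7
    have "sw k i = i" "sw k j = j" using 7 i by (auto simp: Transposition.transpose_def)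
    then show ?thesis using 7 i aij_middle[of i k j] by (simp add: t)
  qed
qed

lemma tie_conj:
  assumes k: "k \<in> {1..<n}" and i: "i \<in> {1..n}" "j \<in> {1..n}"
  shows "g k \<otimes> tie i j = tie (sw k i) (sw k j) \<otimes> g k"
proof -
  consider "i = j" | "i < j" | "j < i" by linarith
  then show ?thesis
  proof cases
    case 1
    then show ?thesis using k by (simp add: tie_def)
  next
    case 2
    then show ?thesis using tie_conj_less[OF k, of i j] i by simp
  next
    case 3
    then show ?thesis using tie_conj_less[OF k, of j i] i
      by (simp add: tie_sym[of i j] tie_sym[of "sw k i"])
  qed
qed

lemma tie_conj2:
  assumes k: "k \<in> {1..<n}" and i: "{i, j, i', j'} \<subseteq> {1..n}"
  shows "g k \<otimes> (tie i j \<otimes> tie i' j') = tie (sw k i) (sw k j) \<otimes> tie (sw k i') (sw k j') \<otimes> g k"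
proof -
  have s: "sw k x \<in> {1..n}" if "x \<in> {1..n}" for x by (rule sw_in[OF k that])
  have i': "i \<in> {1..n}" "j \<in> {1..n}" "i' \<in> {1..n}" "j' \<in> {1..n}" using i by auto
  have "g k \<otimes> (tie i j \<otimes> tie i' j') = tie (sw k i) (sw k j) \<otimes> (g k \<otimes> tie i' j')"
    using k i' s tie_conj[OF k i'(1,2)] by (simp flip: m_assoc)
  then show ?thesis using k i' s tie_conj[OF k i'(3,4)] by (simp add: m_assoc)
qed

lemma tie_idem:
  assumes i: "i \<in> {1..n}" "j \<in> {1..n}"
  shows "tie i j \<otimes> tie i j = tie i j"
proof -
  have *: "aij i (Suc i + d) \<otimes> aij i (Suc i + d) = aij i (Suc i + d)" if "1 \<le> i" "Suc i + d \<le> n" for i d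
    using that(2)
  proof (induction d)
    case 0
    then show ?case using that(1) e_sq[of i] by (simp add: aij_base)
  next
    case (Suc d)
    define k where "k = Suc i + d"
    have k: "k \<in> {1..<n}" "i < k" "Suc i + Suc d = Suc k" using Suc that by (auto simp: k_def)
    define x y where "x = aij i k" and "y = aij i (Suc k)"
    have cl: "x \<in> carrier B" "y \<in> carrier B" "g k \<in> carrier B" using k that by (auto simp: x_def y_def)
    have xy: "g k \<otimes> x = y \<otimes> g k" unfolding x_def y_def using k that by (intro aij_up) auto
    have xx: "x \<otimes> x = x" using Suc by (simp add: x_def k_def)
    have "y \<otimes> y = y"
    proof (rule unit_rcancel[of "g k"])
      have "y \<otimes> y \<otimes> g k = y \<otimes> (g k \<otimes> x)" using cl xy by (simp add: m_assoc)
      also have "\<dots> = (y \<otimes> g k) \<otimes> x" using cl by (simp add: m_assoc)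
      also have "\<dots> = (g k \<otimes> x) \<otimes> x" unfolding xy ..
      also have "\<dots> = g k \<otimes> (x \<otimes> x)" using cl by (simp add: m_assoc)
      also have "\<dots> = y \<otimes> g k" unfolding xx xy ..
      finally show "y \<otimes> y \<otimes> g k = y \<otimes> g k" .
    qed (use cl k in auto)
    then show ?case by (simp only: k(3) y_def)
  qed
  consider "i = j" | "i < j" | "j < i" by linarith
  then show ?thesis
  proof cases
    case 1
    then show ?thesis by (simp add: tie_def)
  next
    case 2
    then show ?thesis using *[of i "j - Suc i"] i by (simp add: tie_def)
  next
    case 3
    then show ?thesis using *[of j "i - Suc j"] i by (simp add: tie_def)
  qed
qed

text \<open>After transport the ties are \<open>e 1\<close> and either \<open>e 2\<close> or
  \<open>e 3\<close>, which commute by the presentation. The alternatives for \<open>l\<close>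
  describe two ties sharing one label and two disjoint ties.\<close>

lemma tie_comm_distinct:
  assumes i: "{i, j, k, l} \<subseteq> {1..n}" and d: "distinct [i, j, k]" and l: "l = j \<or> l \<notin> {i, j, k}"
  shows "tie i j \<otimes> tie k l = tie k l \<otimes> tie i j"
proof (rule transpose_transitive[where Q = "\<lambda>i j k l. tie i j \<otimes> tie k l = tie k l \<otimes> tie i j" and n = n])
  fix m i j k l assume m: "m \<in> {1..<n}" and i: "{i, j, k, l} \<subseteq> {1..n}"
    and eq: "tie i j \<otimes> tie k l = tie k l \<otimes> tie i j"
  have s: "sw m x \<in> {1..n}" if "x \<in> {1..n}" for x by (rule sw_in[OF m that])
  have "{k, l, i, j} \<subseteq> {1..n}" using i by auto
  then have "tie (sw m i) (sw m j) \<otimes> tie (sw m k) (sw m l) \<otimes> g m =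
      tie (sw m k) (sw m l) \<otimes> tie (sw m i) (sw m j) \<otimes> g m"
    using tie_conj2[OF m i] tie_conj2[OF m, of k l i j] eq by simp
  then show "tie (sw m i) (sw m j) \<otimes> tie (sw m k) (sw m l) = tie (sw m k) (sw m l) \<otimes> tie (sw m i) (sw m j)"
    by (rule unit_rcancel[rotated 3]) (use m i s in simp_all)
next
  have c3: "card {i, j, k} \<le> card {1..n}" by (rule card_mono) (use i in auto)
  then have n3: "n \<ge> 3" using d by simp
  have n4: "n \<ge> 4" if "l \<notin> {i, j, k}"
  proof -
    have "card {i, j, k, l} \<le> card {1..n}" by (rule card_mono) (use i in auto)
    then show ?thesis using d that by auto
  qed
  have 12: "tie 1 2 = e 1" using tie_Suc[of 1] by (simp add: numeral_2_eq_2)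
  have 23: "tie 3 2 = e 2" using tie_Suc[of 2] tie_sym[of 3 2] by (simp add: numeral_3_eq_3)
  have 34: "tie 3 4 = e 3" using tie_Suc[of 3] by simp
  show "tie 1 2 \<otimes> tie 3 (if l = j then 2 else if l = k then 3 else 4) =
    tie 3 (if l = j then 2 else if l = k then 3 else 4) \<otimes> tie 1 2"
    using l e_e[of 1 2] e_e[of 1 3] n3 n4 12 23 34 by auto
qed (use assms in auto)

lemma tie_comm:
  assumes i: "i \<in> {1..n}" "j \<in> {1..n}" "k \<in> {1..n}" "l \<in> {1..n}"
  shows "tie i j \<otimes> tie k l = tie k l \<otimes> tie i j"
proof -
  \<comment> \<open>Apart from trivial or equal ties, two ties share one label or are disjoint; the
    cases reorder arguments until a shared label stands where \<open>tie_comm_distinct\<close>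
    expects it.\<close>
  consider "i = j" | "k = l" | "i \<noteq> j" "k \<noteq> l" "{i, j} = {k, l}"
    | "i \<noteq> j" "k \<noteq> l" "i \<noteq> k" "j \<noteq> k" "l = j \<or> l \<notin> {i, j, k}"
    | "i \<noteq> j" "k \<noteq> l" "i \<noteq> k" "j \<noteq> k" "l = i"
    | "i \<noteq> j" "k \<noteq> l" "i = k" "j \<noteq> l" | "i \<noteq> j" "k \<noteq> l" "j = k" "i \<noteq> l" by blast
  then show ?thesis
  proof cases
    case 1 then show ?thesis using i by (simp add: tie_def)
  next
    case 2 then show ?thesis using i by (simp add: tie_def)
  next
    case 3 then show ?thesis using tie_sym[of i j] by (auto simp: doubleton_eq_iff)
  next
    case 4 then show ?thesis using tie_comm_distinct[of i j k l] i by auto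
  next
    case 5 then show ?thesis using tie_comm_distinct[of j i k l] i tie_sym[of i j] by auto
  next
    case 6 then show ?thesis using tie_comm_distinct[of j i l k] i tie_sym[of i j] tie_sym[of k l] by auto
  next
    case 7 then show ?thesis using tie_comm_distinct[of i j l k] i tie_sym[of k l] by auto
  qed
qed

text \<open>Transport leaves the triangle 1, 2, 3. There \<open>e_e_g\<close> turns
  \<open>e 1 \<otimes> e 2 \<otimes> g 2\<close> into
  \<open>e 1 \<otimes> g 2 \<otimes> e 1\<close>; moving \<open>g 2\<close> past the last factor
  produces the tie of 1 and 3, and \<open>g 2\<close> cancels.\<close>

lemma tie_trans_distinct:
  assumes i: "{i, j, k} \<subseteq> {1..n}" and d: "distinct [i, j, k]"
  shows "tie i j \<otimes> tie j k = tie i j \<otimes> tie i k"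
\<comment> \<open>Only three labels matter; the fourth argument is a dummy, filled with
  \<open>k\<close>.\<close>
proof (rule transpose_transitive[where Q = "\<lambda>i j k l. tie i j \<otimes> tie j k = tie i j \<otimes> tie i k" and n = n and l = k])
  fix m i j k l assume m: "m \<in> {1..<n}" and i: "{i, j, k, l} \<subseteq> {1..n}"
    and eq: "tie i j \<otimes> tie j k = tie i j \<otimes> tie i k"
  have s: "sw m x \<in> {1..n}" if "x \<in> {1..n}" for x by (rule sw_in[OF m that])
  have "{i, j, j, k} \<subseteq> {1..n}" "{i, j, i, k} \<subseteq> {1..n}" using i by auto
  then have "tie (sw m i) (sw m j) \<otimes> tie (sw m j) (sw m k) \<otimes> g m =
      tie (sw m i) (sw m j) \<otimes> tie (sw m i) (sw m k) \<otimes> g m"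
    using tie_conj2[OF m, of i j j k] tie_conj2[OF m, of i j i k] eq by simp
  then show "tie (sw m i) (sw m j) \<otimes> tie (sw m j) (sw m k) = tie (sw m i) (sw m j) \<otimes> tie (sw m i) (sw m k)"
    by (rule unit_rcancel[rotated 3]) (use m i s in simp_all)
next
  have c3: "card {i, j, k} \<le> card {1..n}" by (rule card_mono) (use i in auto)
  then have n3: "n \<ge> 3" using d by simp
  have 12: "tie 1 2 = e 1" using tie_Suc[of 1] by (simp add: numeral_2_eq_2)
  have 23: "tie 2 3 = e 2" using tie_Suc[of 2] by (simp add: numeral_3_eq_3)
  have 13: "tie 1 3 = aij 1 3" by (simp add: tie_def)
  have up: "g 2 \<otimes> e 1 = aij 1 3 \<otimes> g 2"
    using aij_up[of 1 2] n3 aij_base[of 1] by (simp add: numeral_2_eq_2 numeral_3_eq_3)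
  have cl: "e 1 \<in> carrier B" "e 2 \<in> carrier B" "aij 1 3 \<in> carrier B" "g 2 \<in> carrier B" using n3 by auto
  have "e 1 \<otimes> e 2 = e 1 \<otimes> aij 1 3"
  proof (rule unit_rcancel[of "g 2"])
    have "e 1 \<otimes> e 2 \<otimes> g 2 = e 1 \<otimes> (g 2 \<otimes> e 1)"
      using e_e_g[of 1 2] n3 cl by (simp add: adj_def m_assoc)
    then show "e 1 \<otimes> e 2 \<otimes> g 2 = e 1 \<otimes> aij 1 3 \<otimes> g 2" unfolding up using cl by (simp add: m_assoc)
  qed (use cl n3 in auto)
  then show "tie 1 2 \<otimes> tie 2 3 = tie 1 2 \<otimes> tie 1 3" by (simp only: 12 23 13)
qed (use assms in auto)

sublocale ties B n g tie
proof unfold_locales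
  fix i j k assume i: "i \<in> {1..n}" "j \<in> {1..n}" "k \<in> {1..n}"
  consider "i = j" | "j = k" | "i = k" | "distinct [i, j, k]" by auto
  then show "tie i j \<otimes> tie j k = tie i j \<otimes> tie i k"
  proof cases
    case 1 then show ?thesis by simp
  next
    case 2 then show ?thesis using i tie_idem by (simp add: tie_def)
  next
    case 3 then show ?thesis using i tie_idem[of i j] tie_sym[of i j] by (simp add: tie_def[of k k])
  next
    case 4 then show ?thesis using tie_trans_distinct i by simp
  qed
qed (auto simp: tie_conj tie_idem tie_sym tie_def[of x x for x] intro: tie_comm)

end

section \<open>A spanning set\<close>

text \<open>Reduced words for the symmetric group: every permutation of \<open>{1..Suc m}\<close> is uniquely
  \<open>s\<^sub>k s\<^sub>k\<^sub>+\<^sub>1 \<dots> s\<^sub>m u\<close> with \<open>1 \<le> k \<le> m + 1\<close> and \<open>u\<close> a permutation of \<open>{1..m}\<close>.\<close>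

fun normal_words :: "nat \<Rightarrow> nat list set" where
  "normal_words 0 = {[]}"
| "normal_words (Suc m) = (\<lambda>(k, u). [k..<Suc m] @ u) ` ({1..Suc m} \<times> normal_words m)"

lemma normal_words_SucI: "k \<in> {1..Suc m} \<Longrightarrow> u \<in> normal_words m \<Longrightarrow> [k..<Suc m] @ u \<in> normal_words (Suc m)"
  by (auto simp: image_iff simp del: upt_Suc)

lemma Nil_normal_word: "[] \<in> normal_words m"
proof (induction m)
  case (Suc m)
  then show ?case using normal_words_SucI[of "Suc m" m "[]"] by simp
qed simp

lemma finite_normal_words: "finite (normal_words m)"
  by (induction m) auto

lemma normal_words_letters: "u \<in> normal_words m \<Longrightarrow> set u \<subseteq> {1..<m}"
  by (induction m arbitrary: u) (force+)

section \<open>Linear spans inside the algebra\<close>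

locale bt_span = ties B n g e + K: cring K
  for B :: "('b, 'm) ring_scheme" (structure) and n g e and K :: "('k, 'p) ring_scheme" +
  fixes \<theta> :: "'k \<Rightarrow> 'b" and z :: 'k
  assumes \<theta>_hom: "\<theta> \<in> ring_hom K B"
    and \<theta>_central: "k \<in> carrier K \<Longrightarrow> x \<in> carrier B \<Longrightarrow> \<theta> k \<otimes> x = x \<otimes> \<theta> k"
    and z_closed: "z \<in> carrier K"
    and g_far: "i \<in> {1..<n} \<Longrightarrow> j \<in> {1..<n} \<Longrightarrow> \<bar>int i - int j\<bar> > 1 \<Longrightarrow> g i \<otimes> g j = g j \<otimes> g i"
    and g_braid: "i \<in> {1..<n} \<Longrightarrow> Suc i \<in> {1..<n} \<Longrightarrow> g i \<otimes> g (Suc i) \<otimes> g i = g (Suc i) \<otimes> g i \<otimes> g (Suc i)"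
    and g_sq: "i \<in> {1..<n} \<Longrightarrow> g i \<otimes> g i = \<one> \<oplus> \<theta> z \<otimes> (e i (Suc i) \<otimes> g i)"
begin

lemma \<theta>_closed [simp]: "k \<in> carrier K \<Longrightarrow> \<theta> k \<in> carrier B"
  by (rule ring_hom_closed[OF \<theta>_hom])

lemma \<theta>_one [simp]: "\<theta> \<one>\<^bsub>K\<^esub> = \<one>" by (rule ring_hom_one[OF \<theta>_hom])
lemma \<theta>_zero [simp]: "\<theta> \<zero>\<^bsub>K\<^esub> = \<zero>"
  by (rule ring_hom_zero[OF \<theta>_hom K.ring_axioms ring_axioms])

text \<open>Linear combinations grow by one term at a time, so that closure properties are
  inductions; repeated terms are collected only in \<open>kspan_finite\<close>.\<close>

inductive_set kspan :: "'b set \<Rightarrow> 'b set" for S where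
  kspan_zero: "\<zero> \<in> kspan S"
| kspan_step: "k \<in> carrier K \<Longrightarrow> s \<in> S \<Longrightarrow> x \<in> kspan S \<Longrightarrow> \<theta> k \<otimes> s \<oplus> x \<in> kspan S"

lemma kspan_closed: "x \<in> kspan S \<Longrightarrow> S \<subseteq> carrier B \<Longrightarrow> x \<in> carrier B"
  by (induction rule: kspan.induct) auto

lemma kspan_base: "s \<in> S \<Longrightarrow> S \<subseteq> carrier B \<Longrightarrow> s \<in> kspan S"
  using kspan_step[OF K.one_closed, of s S \<zero>] kspan_zero by auto

lemma kspan_add:
  assumes S: "S \<subseteq> carrier B" and y: "y \<in> kspan S" and x: "x \<in> kspan S"
  shows "x \<oplus> y \<in> kspan S"
  using x
proof (induction rule: kspan.induct)
  case kspan_zero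
  then show ?case using y kspan_closed[OF y S] by simp
next
  case (kspan_step k s x)
  then have "\<theta> k \<otimes> s \<oplus> (x \<oplus> y) \<in> kspan S" by (intro kspan.kspan_step)
  moreover have "s \<in> carrier B" "x \<in> carrier B" "y \<in> carrier B"
    using kspan_step S y kspan_closed by auto
  ultimately show ?case using kspan_step by (simp add: a_assoc)
qed

lemma kspan_scale:
  assumes S: "S \<subseteq> carrier B" and k: "k \<in> carrier K" and x: "x \<in> kspan S"
  shows "\<theta> k \<otimes> x \<in> kspan S"
  using x
proof (induction rule: kspan.induct)
  case kspan_zero
  then show ?case using k kspan.kspan_zero by simp
next
  case (kspan_step l s x)
  then have "\<theta> (k \<otimes>\<^bsub>K\<^esub> l) \<otimes> s \<oplus> \<theta> k \<otimes> x \<in> kspan S" using k by (intro kspan.kspan_step) auto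
  moreover have "s \<in> carrier B" "x \<in> carrier B"
    using kspan_step S kspan_closed by auto
  ultimately show ?case using kspan_step k by (simp add: r_distr ring_hom_mult[OF \<theta>_hom] m_assoc)
qed

lemma kspan_mult:
  assumes S: "S \<subseteq> carrier B" and S': "S' \<subseteq> carrier B" and h: "h \<in> carrier B"
    and hs: "\<And>s. s \<in> S \<Longrightarrow> h \<otimes> s \<in> kspan S'" and x: "x \<in> kspan S"
  shows "h \<otimes> x \<in> kspan S'"
  using x
proof (induction rule: kspan.induct)
  case kspan_zero
  then show ?case using h kspan.kspan_zero by simp
next
  case (kspan_step k s x)
  have c: "s \<in> carrier B" "x \<in> carrier B" "\<theta> k \<in> carrier B"
    using kspan_step S kspan_closed by auto
  have "h \<otimes> (\<theta> k \<otimes> s \<oplus> x) = \<theta> k \<otimes> (h \<otimes> s) \<oplus> h \<otimes> x"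
    using c h \<theta>_central[OF kspan_step(1) h] by (simp add: r_distr flip: m_assoc)
  then show ?case using kspan_add[OF S' kspan_step(4) kspan_scale[OF S' kspan_step(1) hs[OF kspan_step(2)]]] by simp
qed

lemma kspan_finite:
  assumes I: "finite I" and b: "b \<in> I \<rightarrow> carrier B" and x: "x \<in> kspan (b ` I)"
  shows "\<exists>c \<in> I \<rightarrow> carrier K. x = (\<Oplus>i\<in>I. \<theta> (c i) \<otimes> b i)"
  using x
proof (induction rule: kspan.induct)
  case kspan_zero
  have "(\<Oplus>i\<in>I. \<theta> \<zero>\<^bsub>K\<^esub> \<otimes> b i) = (\<Oplus>i\<in>I. \<zero>)" using b by (intro finsum_cong') (auto simp: Pi_iff)
  then show ?case by (intro bexI[of _ "\<lambda>_. \<zero>\<^bsub>K\<^esub>"]) auto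
next
  case (kspan_step k s x)
  then obtain c j where c: "c \<in> I \<rightarrow> carrier K" "x = (\<Oplus>i\<in>I. \<theta> (c i) \<otimes> b i)" and j: "j \<in> I" "s = b j" by auto
  \<comment> \<open>The family \<open>b\<close> may take one value at several indices; the new
    scalar is added at a single index \<open>j\<close> with \<open>s = b j\<close>.\<close>
  define c' where "c' = c(j := k \<oplus>\<^bsub>K\<^esub> c j)"
  have c': "c' \<in> I \<rightarrow> carrier K" using c(1) kspan_step(1) j by (auto simp: c'_def Pi_iff)
  have Ij: "I = insert j (I - {j})" using j by auto
  have split: "(\<Oplus>i\<in>I. \<theta> (d i) \<otimes> b i) = \<theta> (d j) \<otimes> b j \<oplus> (\<Oplus>i\<in>I - {j}. \<theta> (d i) \<otimes> b i)"
    if d: "d \<in> I \<rightarrow> carrier K" for d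
    by (subst Ij, subst finsum_insert) (use d b j I in \<open>auto simp: Pi_iff\<close>)
  have "(\<Oplus>i\<in>I - {j}. \<theta> (c' i) \<otimes> b i) = (\<Oplus>i\<in>I - {j}. \<theta> (c i) \<otimes> b i)"
    using b c by (intro finsum_cong') (auto simp: c'_def Pi_iff)
  moreover have "(\<Oplus>i\<in>I - {j}. \<theta> (c i) \<otimes> b i) \<in> carrier B"
    using b c by (intro finsum_closed) (auto simp: Pi_iff)
  moreover have "c j \<in> carrier K" "b j \<in> carrier B" using c b j by (auto simp: Pi_iff)
  ultimately have "(\<Oplus>i\<in>I. \<theta> (c' i) \<otimes> b i) = \<theta> k \<otimes> s \<oplus> x"
    unfolding split[OF c'] c(2) split[OF c(1)] using kspan_step(1) j
    by (simp add: c'_def ring_hom_add[OF \<theta>_hom] l_distr a_assoc)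
  then show ?case using c' by (intro bexI[of _ c']) auto
qed

section \<open>Monomials, and rewriting a generator times a monomial\<close>

definition wprod :: "nat list \<Rightarrow> 'b" where "wprod w = foldr (\<lambda>k y. g k \<otimes> y) w \<one>"
definition eprod :: "(nat \<times> nat) list \<Rightarrow> 'b" where "eprod L = foldr (\<lambda>p y. e (fst p) (snd p) \<otimes> y) L \<one>"

lemma wprod_simps [simp]: "wprod [] = \<one>" "wprod (k # w) = g k \<otimes> wprod w"
  by (simp_all add: wprod_def)

lemma eprod_simps [simp]: "eprod [] = \<one>" "eprod (p # L) = e (fst p) (snd p) \<otimes> eprod L"
  by (simp_all add: eprod_def)

lemma wprod_closed [simp]: "set w \<subseteq> {1..<n} \<Longrightarrow> wprod w \<in> carrier B"
  by (induction w) auto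

abbreviation "pairs \<equiv> {1..n} \<times> {1..n}"

lemma e_pair_closed [simp]: "p \<in> pairs \<Longrightarrow> e (fst p) (snd p) \<in> carrier B"
  by (auto simp del: atLeastAtMost_iff)

lemma eprod_closed [simp]: "set L \<subseteq> pairs \<Longrightarrow> eprod L \<in> carrier B"
  by (induction L) (auto simp del: atLeastAtMost_iff)

lemma wprod_append: "set v \<subseteq> {1..<n} \<Longrightarrow> set w \<subseteq> {1..<n} \<Longrightarrow> wprod (v @ w) = wprod v \<otimes> wprod w"
  by (induction v) (auto simp: m_assoc)

lemma eprod_append: "set L \<subseteq> pairs \<Longrightarrow> set L' \<subseteq> pairs \<Longrightarrow> eprod (L @ L') = eprod L \<otimes> eprod L'"
  by (induction L) (auto simp: m_assoc simp del: atLeastAtMost_iff)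

lemma e_eprod: "p \<in> pairs \<Longrightarrow> set L \<subseteq> pairs \<Longrightarrow> e (fst p) (snd p) \<otimes> eprod L = eprod L \<otimes> e (fst p) (snd p)"
proof (induction L)
  case (Cons q L)
  let ?e = "\<lambda>p. e (fst p) (snd p)"
  have c: "?e p \<in> carrier B" "?e q \<in> carrier B" "eprod L \<in> carrier B" using Cons by auto
  have "?e p \<otimes> ?e q = ?e q \<otimes> ?e p" using Cons(2,3) by (intro e_comm) (auto simp del: atLeastAtMost_iff)
  then have "?e p \<otimes> (?e q \<otimes> eprod L) = ?e q \<otimes> (?e p \<otimes> eprod L)" using c by (simp flip: m_assoc)
  then show ?case using Cons c by (simp add: m_assoc)
qed simp

lemma eprod_comm: "set L \<subseteq> pairs \<Longrightarrow> set L' \<subseteq> pairs \<Longrightarrow> eprod L \<otimes> eprod L' = eprod L' \<otimes> eprod L"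
proof (induction L)
  case (Cons p L)
  let ?e = "e (fst p) (snd p)"
  have c: "?e \<in> carrier B" "eprod L \<in> carrier B" "eprod L' \<in> carrier B" using Cons by auto
  have "?e \<otimes> eprod L \<otimes> eprod L' = (?e \<otimes> eprod L') \<otimes> eprod L" using Cons c by (simp add: m_assoc)
  also have "\<dots> = eprod L' \<otimes> (?e \<otimes> eprod L)" using Cons e_eprod[of p L'] c by (simp add: m_assoc)
  finally show ?case by simp
qed simp

lemma g_eprod:
  assumes k: "k \<in> {1..<n}"
  shows "set L \<subseteq> pairs \<Longrightarrow> g k \<otimes> eprod L = eprod (map (map_prod (sw k) (sw k)) L) \<otimes> g k"
proof (induction L)
  case (Cons p L)
  let ?f = "map_prod (sw k) (sw k)"
  have p: "fst p \<in> {1..n}" "snd p \<in> {1..n}" using Cons(2) by (auto simp del: atLeastAtMost_iff)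
  have L: "set (map ?f L) \<subseteq> pairs" using Cons(2) sw_in[OF k] by (auto simp del: atLeastAtMost_iff)
  have s: "sw k (fst p) \<in> {1..n}" "sw k (snd p) \<in> {1..n}" using p sw_in[OF k] by blast+
  have "g k \<otimes> (e (fst p) (snd p) \<otimes> eprod L) = e (sw k (fst p)) (sw k (snd p)) \<otimes> (g k \<otimes> eprod L)"
    using e_conj[OF k p] k p s Cons(2) by (simp flip: m_assoc del: atLeastAtMost_iff)
  also have "\<dots> = e (sw k (fst p)) (sw k (snd p)) \<otimes> eprod (map ?f L) \<otimes> g k"
    using Cons k s L by (simp add: m_assoc del: atLeastAtMost_iff)
  finally show ?case by simp
qed (use k in simp)

lemma pairs_sw: "k \<in> {1..<n} \<Longrightarrow> set L \<subseteq> pairs \<Longrightarrow> set (map (map_prod (sw k) (sw k)) L) \<subseteq> pairs"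
  using sw_in[of k n] by (auto simp del: atLeastAtMost_iff)

lemma wprod_eprod:
  assumes "set w \<subseteq> {1..<n}" "set L \<subseteq> pairs"
  shows "\<exists>L'. set L' \<subseteq> pairs \<and> wprod w \<otimes> eprod L = eprod L' \<otimes> wprod w"
  using assms(1)
proof (induction w)
  case Nil
  then show ?case using assms(2) by auto
next
  case (Cons k w)
  then obtain L' where L': "set L' \<subseteq> pairs" "wprod w \<otimes> eprod L = eprod L' \<otimes> wprod w" by auto
  have k: "k \<in> {1..<n}" "set w \<subseteq> {1..<n}" using Cons by auto
  let ?L = "map (map_prod (sw k) (sw k)) L'"
  have "g k \<otimes> wprod w \<otimes> eprod L = (g k \<otimes> eprod L') \<otimes> wprod w"
    using k L' assms(2) by (simp add: m_assoc)
  also have "\<dots> = eprod ?L \<otimes> (g k \<otimes> wprod w)"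
    using k L' pairs_sw[OF k(1) L'(1)] by (simp add: g_eprod m_assoc del: set_map)
  finally show ?case using pairs_sw[OF k(1) L'(1)] by (intro exI[of _ ?L]) simp
qed

lemma g_wprod_commute:
  assumes "i \<in> {1..<n}"
  shows "set w \<subseteq> {1..<n} \<Longrightarrow> (\<And>k. k \<in> set w \<Longrightarrow> \<bar>int i - int k\<bar> > 1) \<Longrightarrow> g i \<otimes> wprod w = wprod w \<otimes> g i"
proof (induction w)
  case (Cons k w)
  have k: "k \<in> {1..<n}" "g i \<in> carrier B" "g k \<in> carrier B" "wprod w \<in> carrier B" using Cons assms by auto
  have "g i \<otimes> g k = g k \<otimes> g i" using Cons k assms by (intro g_far) auto
  then have "g i \<otimes> (g k \<otimes> wprod w) = g k \<otimes> (g i \<otimes> wprod w)" using k by (simp flip: m_assoc)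
  then show ?case using Cons k by (simp add: m_assoc)
qed (use assms in simp)

text \<open>\<open>g i\<close> passes the letters far below it, meets the adjacent letters
  \<open>i - 1\<close> and \<open>i\<close>, becomes \<open>g (i - 1)\<close> by the braid relation,
  and then passes the letters above \<open>i\<close>.\<close>

lemma g_run:
  assumes i: "1 \<le> k" "k < i" "i \<le> m" "m < n"
  shows "g i \<otimes> wprod [k..<Suc m] = wprod [k..<Suc m] \<otimes> g (i - 1)"
proof -
  define j where "j = i - 1"
  have ij: "i = Suc j" "i \<in> {1..<n}" "j \<in> {1..<n}" "Suc j \<in> {1..<n}" using i by (auto simp: j_def)
  have s: "[k..<Suc m] = [k..<j] @ (j # Suc j # [Suc (Suc j)..<Suc m])"
    using i upt_add_eq_append[of k j "Suc m - j"] by (simp add: upt_conv_Cons j_def)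
  define P Q u v where "P = wprod [k..<j]" and "Q = wprod [Suc (Suc j)..<Suc m]" and "u = g j" and "v = g (Suc j)"
  have [simp]: "P \<in> carrier B" "Q \<in> carrier B" "u \<in> carrier B" "v \<in> carrier B"
    using ij i by (auto simp: P_def Q_def u_def v_def intro!: wprod_closed)
  have w: "wprod [k..<Suc m] = P \<otimes> (u \<otimes> (v \<otimes> Q))"
    unfolding s using ij i by (subst wprod_append) (auto simp: P_def Q_def u_def v_def)
  have vP: "v \<otimes> P = P \<otimes> v" unfolding v_def P_def using ij i by (intro g_wprod_commute) auto
  have uQ: "u \<otimes> Q = Q \<otimes> u" unfolding u_def Q_def using ij i by (intro g_wprod_commute) auto
  have b: "u \<otimes> v \<otimes> u = v \<otimes> u \<otimes> v" unfolding u_def v_def using ij g_braid by blast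
  have "v \<otimes> (P \<otimes> (u \<otimes> (v \<otimes> Q))) = (v \<otimes> P) \<otimes> (u \<otimes> (v \<otimes> Q))" by (simp add: m_assoc)
  also have "\<dots> = P \<otimes> ((v \<otimes> u \<otimes> v) \<otimes> Q)" unfolding vP by (simp add: m_assoc)
  also have "\<dots> = P \<otimes> (u \<otimes> (v \<otimes> (u \<otimes> Q)))" unfolding b[symmetric] by (simp add: m_assoc)
  also have "\<dots> = P \<otimes> (u \<otimes> (v \<otimes> Q)) \<otimes> u" unfolding uQ by (simp add: m_assoc)
  finally show ?thesis unfolding w using ij by (simp add: u_def v_def)
qed

definition monomials :: "nat \<Rightarrow> 'b set" where
  "monomials m = {eprod L \<otimes> wprod u | L u. set L \<subseteq> pairs \<and> u \<in> normal_words m}"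

lemma monomialsI: "set L \<subseteq> pairs \<Longrightarrow> u \<in> normal_words m \<Longrightarrow> eprod L \<otimes> wprod u \<in> monomials m"
  unfolding monomials_def by blast

lemma normal_letters': "u \<in> normal_words m \<Longrightarrow> m \<le> n \<Longrightarrow> set u \<subseteq> {1..<n}"
  using normal_words_letters[of u m] by auto

lemma monomials_closed: "m \<le> n \<Longrightarrow> monomials m \<subseteq> carrier B"
  unfolding monomials_def using normal_letters' by fastforce

lemma eprod_span:
  assumes m: "m \<le> n" and L: "set L \<subseteq> pairs" and x: "x \<in> kspan (monomials m)"
  shows "eprod L \<otimes> x \<in> kspan (monomials m)"
proof (rule kspan_mult[OF monomials_closed[OF m] monomials_closed[OF m] eprod_closed[OF L] _ x])
  fix s assume "s \<in> monomials m"
  then obtain L' u where s: "s = eprod L' \<otimes> wprod u" "set L' \<subseteq> pairs" "u \<in> normal_words m"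
    unfolding monomials_def by blast
  have "eprod L \<otimes> s = eprod (L @ L') \<otimes> wprod u"
    using s L normal_letters'[OF s(3) m] by (simp add: eprod_append m_assoc)
  then show "eprod L \<otimes> s \<in> kspan (monomials m)"
    using monomialsI[of "L @ L'" u m] s L by (auto intro!: kspan_base monomials_closed[OF m] simp del: atLeastAtMost_iff)
qed

text \<open>A normal word is a run starting at \<open>k\<close> followed by a normal word in fewer
  letters. According to the position of \<open>i\<close>, the new letter commutes with the run,
  lengthens it, squares its first letter, or passes it as \<open>g (i - 1)\<close>. In the first and
  last case the induction hypothesis applies to the shorter word.\<close>

lemma g_normal_word:
  "m \<le> n \<Longrightarrow> i \<in> {1..<m} \<Longrightarrow> u \<in> normal_words m \<Longrightarrow> g i \<otimes> wprod u \<in> kspan (monomials m)"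
proof (induction m arbitrary: i u)
  case (Suc m)
  obtain k v where k: "k \<in> {1..Suc m}" and v: "v \<in> normal_words m" and u: "u = [k..<Suc m] @ v"
    using Suc.prems(3) by auto
  have m: "m \<le> n" and i: "i \<in> {1..<n}" using Suc.prems by auto
  have vl: "set v \<subseteq> {1..<n}" by (rule normal_letters'[OF v m])
  have sub: "set [l..<Suc m] \<subseteq> {1..<n}" if "l \<ge> 1" for l using that Suc.prems by auto
  have kl: "set [k..<Suc m] \<subseteq> {1..<n}" using sub k by auto
  have wu: "wprod u = wprod [k..<Suc m] \<otimes> wprod v" unfolding u by (rule wprod_append[OF kl vl])
  \<comment> \<open>Ties created in front of the shorter word can be pushed to the left of the run,
    so multiplication by the run maps one span into the other.\<close>
  have run: "wprod [k..<Suc m] \<otimes> x \<in> kspan (monomials (Suc m))" if x: "x \<in> kspan (monomials m)" for x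
  proof (rule kspan_mult[OF monomials_closed[OF m] monomials_closed[OF Suc.prems(1)] wprod_closed[OF kl] _ x])
    fix s assume "s \<in> monomials m"
    then obtain L v' where s: "s = eprod L \<otimes> wprod v'" "set L \<subseteq> pairs" "v' \<in> normal_words m"
      unfolding monomials_def by blast
    have v': "set v' \<subseteq> {1..<n}" by (rule normal_letters'[OF s(3) m])
    obtain L' where L': "set L' \<subseteq> pairs" "wprod [k..<Suc m] \<otimes> eprod L = eprod L' \<otimes> wprod [k..<Suc m]"
      using wprod_eprod[OF kl s(2)] by blast
    have "wprod [k..<Suc m] \<otimes> s = (wprod [k..<Suc m] \<otimes> eprod L) \<otimes> wprod v'"
      unfolding s(1) by (rule m_assoc[symmetric, OF wprod_closed[OF kl] eprod_closed[OF s(2)] wprod_closed[OF v']])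
    also have "\<dots> = eprod L' \<otimes> wprod ([k..<Suc m] @ v')"
      unfolding L'(2) wprod_append[OF kl v']
      by (rule m_assoc[OF eprod_closed[OF L'(1)] wprod_closed[OF kl] wprod_closed[OF v']])
    finally have *: "wprod [k..<Suc m] \<otimes> s = eprod L' \<otimes> wprod ([k..<Suc m] @ v')" .
    show "wprod [k..<Suc m] \<otimes> s \<in> kspan (monomials (Suc m))" unfolding *
      by (intro kspan_base monomials_closed Suc.prems(1) monomialsI L'(1) normal_words_SucI k s(3))
  qed
  have normal: "wprod ([l..<Suc m] @ v) \<in> kspan (monomials (Suc m))" if "l \<in> {1..Suc m}" for l
  proof -
    have "[l..<Suc m] @ v \<in> normal_words (Suc m)" using that v by (rule normal_words_SucI)
    from monomialsI[OF _ this, of "[]"] normal_letters'[OF this Suc.prems(1)] show ?thesis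
      by (auto intro!: kspan_base monomials_closed[OF Suc.prems(1)] simp del: upt_Suc)
  qed
  have comm: "wprod [k..<Suc m] \<otimes> g j \<otimes> wprod v \<in> kspan (monomials (Suc m))" if j: "j \<in> {1..<m}" for j
  proof -
    have "j \<in> {1..<n}" using j Suc.prems by auto
    then have "wprod [k..<Suc m] \<otimes> g j \<otimes> wprod v = wprod [k..<Suc m] \<otimes> (g j \<otimes> wprod v)"
      by (intro m_assoc wprod_closed[OF kl] wprod_closed[OF vl] g_closed)
    then show ?thesis using run[OF Suc.IH[OF m j v]] by simp
  qed
  have assoc: "g i \<otimes> wprod u = g i \<otimes> wprod [k..<Suc m] \<otimes> wprod v"
    unfolding wu by (rule m_assoc[symmetric, OF g_closed[OF i] wprod_closed[OF kl] wprod_closed[OF vl]])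
  consider "Suc i < k" | "Suc i = k" | "i = k" | "k < i" by linarith
  then show ?case
  proof cases
    case 1
    have "g i \<otimes> wprod [k..<Suc m] = wprod [k..<Suc m] \<otimes> g i"
      using 1 by (intro g_wprod_commute[OF i kl]) auto
    moreover have "i \<in> {1..<m}" using 1 k i by auto
    ultimately show ?thesis unfolding assoc using comm by simp
  next
    case 2
    have "[i..<Suc m] = i # [k..<Suc m]" using 2 k by (simp add: upt_conv_Cons)
    then have "wprod ([i..<Suc m] @ v) = g i \<otimes> wprod u" unfolding u by simp
    then show ?thesis using normal[of i] i 2 k by (auto simp del: upt_Suc)
  next
    case 3
    define h where "h = wprod ([Suc k..<Suc m] @ v)"
    have hl: "set ([Suc k..<Suc m] @ v) \<subseteq> {1..<n}" using sub[of "Suc k"] vl by auto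
    have hc: "h \<in> carrier B" unfolding h_def by (rule wprod_closed[OF hl])
    have kn: "k \<in> {1..<n}" "k \<le> m" using 3 i Suc.prems(2) by auto
    have "[k..<Suc m] = k # [Suc k..<Suc m]" using kn by (simp add: upt_conv_Cons)
    then have wh: "wprod u = g k \<otimes> h" unfolding u h_def by simp
    have kk: "(k, Suc k) \<in> pairs" using kn by auto
    have "g i \<otimes> wprod u = (g k \<otimes> g k) \<otimes> h" unfolding wh using 3 kn hc by (simp add: m_assoc)
    \<comment> \<open>The quadratic relation returns the same word with the tie of \<open>k\<close>
      and \<open>Suc k\<close> in front, plus the word whose run has lost its first letter (an empty
      run if k = m).\<close>
    also have "\<dots> = \<theta> z \<otimes> (eprod [(k, Suc k)] \<otimes> wprod u) \<oplus> h"
      unfolding g_sq[OF kn(1)] wh using kn hc z_closed by (simp add: l_distr m_assoc a_comm)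
    also have "\<dots> \<in> kspan (monomials (Suc m))"
    proof (rule kspan_step[OF z_closed])
      show "eprod [(k, Suc k)] \<otimes> wprod u \<in> monomials (Suc m)"
        by (rule monomialsI) (use kk Suc.prems in simp_all)
      show "h \<in> kspan (monomials (Suc m))" unfolding h_def by (rule normal) (use kn in auto)
    qed
    finally show ?thesis .
  next
    case 4
    have "g i \<otimes> wprod [k..<Suc m] = wprod [k..<Suc m] \<otimes> g (i - 1)"
      using 4 k Suc.prems by (intro g_run) auto
    moreover have "i - 1 \<in> {1..<m}" using 4 k Suc.prems(2) by auto
    ultimately show ?thesis unfolding assoc using comm by simp
  qed
qed simp

lemma g_span:
  assumes k: "k \<in> {1..<n}" and x: "x \<in> kspan (monomials n)"
  shows "g k \<otimes> x \<in> kspan (monomials n)"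
proof (rule kspan_mult[OF monomials_closed[OF order_refl] monomials_closed[OF order_refl] g_closed[OF k] _ x])
  fix s assume "s \<in> monomials n"
  then obtain L u where s: "s = eprod L \<otimes> wprod u" "set L \<subseteq> pairs" "u \<in> normal_words n"
    unfolding monomials_def by blast
  let ?L = "map (map_prod (sw k) (sw k)) L"
  have L: "set ?L \<subseteq> pairs" by (rule pairs_sw[OF k s(2)])
  have u: "wprod u \<in> carrier B" by (rule wprod_closed[OF normal_letters'[OF s(3) order_refl]])
  have "g k \<otimes> s = eprod ?L \<otimes> (g k \<otimes> wprod u)"
    unfolding s(1) using k s(2) u g_eprod[OF k s(2)] eprod_closed[OF L] by (simp flip: m_assoc)
  then show "g k \<otimes> s \<in> kspan (monomials n)"
    using eprod_span[OF order_refl L g_normal_word[OF order_refl k s(3)]] by simp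
qed

lemma e_span:
  assumes k: "k \<in> {1..<n}" and x: "x \<in> kspan (monomials n)"
  shows "e k (Suc k) \<otimes> x \<in> kspan (monomials n)"
  using eprod_span[OF order_refl _ x, of "[(k, Suc k)]"] k by auto

lemma one_span: "\<one> \<in> kspan (monomials n)"
  using monomialsI[of "[]" "[]" n] Nil_normal_word
  by (auto intro!: kspan_base monomials_closed)

text \<open>The equivalence relation of a product of ties is read off inside the algebra, as the set
  of pairs that the product absorbs. Even where absorption yields more than the relation generated
  by \<open>L\<close>, the product of all absorbed ties is still \<open>eprod L\<close>.\<close>

definition tie_closure :: "(nat \<times> nat) list \<Rightarrow> (nat \<times> nat) set" where
  "tie_closure L = {p \<in> pairs. eprod L \<otimes> e (fst p) (snd p) = eprod L}"

text \<open>Products are formed over lists; since ties are commuting idempotents any enumeration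
  serves, and one is fixed for each set.\<close>

definition listing :: "(nat \<times> nat) set \<Rightarrow> (nat \<times> nat) list" where
  "listing Y = (SOME L. set L = Y)"

lemma set_listing: "Y \<subseteq> pairs \<Longrightarrow> set (listing Y) = Y"
  unfolding listing_def by (rule someI_ex) (meson finite_SigmaI finite_atLeastAtMost finite_list finite_subset)

text \<open>Transitivity is \<open>e_trans\<close> multiplied by the product: absorbing
  \<open>e i j\<close> and \<open>e j k\<close> forces absorbing \<open>e i k\<close>.\<close>

lemma tie_closure_equiv:
  assumes L: "set L \<subseteq> pairs"
  shows "equiv {1..n} (tie_closure L)"
proof (rule equivI)
  show "tie_closure L \<subseteq> {1..n} \<times> {1..n}" by (auto simp: tie_closure_def simp del: atLeastAtMost_iff)
  show "refl_on {1..n} (tie_closure L)"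
    using L by (auto simp: refl_on_def tie_closure_def e_refl simp del: atLeastAtMost_iff)
  show "sym (tie_closure L)"
    by (rule symI) (auto simp: tie_closure_def e_sym simp del: atLeastAtMost_iff)
  show "trans (tie_closure L)"
  proof (rule transI)
    fix i j k assume "(i, j) \<in> tie_closure L" "(j, k) \<in> tie_closure L"
    then have i: "i \<in> {1..n}" "j \<in> {1..n}" "k \<in> {1..n}" and
      a: "eprod L \<otimes> e i j = eprod L" "eprod L \<otimes> e j k = eprod L" by (auto simp: tie_closure_def simp del: atLeastAtMost_iff)
    have c: "e i j \<in> carrier B" "e j k \<in> carrier B" "e i k \<in> carrier B" "eprod L \<in> carrier B" using i L by auto
    have "eprod L \<otimes> e i k = eprod L \<otimes> e i j \<otimes> e i k" unfolding a ..
    also have "\<dots> = eprod L \<otimes> (e i j \<otimes> e i k)" using c by (simp add: m_assoc)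
    also have "\<dots> = eprod L \<otimes> (e i j \<otimes> e j k)" using e_trans[OF i] by simp
    also have "\<dots> = eprod L \<otimes> e i j \<otimes> e j k" using c by (simp add: m_assoc)
    also have "\<dots> = eprod L" unfolding a ..
    finally show "(i, k) \<in> tie_closure L" using i by (simp add: tie_closure_def)
  qed
qed

lemma self_tie_closure: "set L \<subseteq> pairs \<Longrightarrow> set L \<subseteq> tie_closure L"
proof
  fix p assume L: "set L \<subseteq> pairs" and p: "p \<in> set L"
  have pp: "p \<in> pairs" using L p by blast
  have "eprod L \<otimes> e (fst p) (snd p) = eprod L" using L p
  proof (induction L)
    case (Cons q L)
    have c: "set L \<subseteq> pairs" "q \<in> pairs" using Cons by auto
    have cl: "e (fst p) (snd p) \<in> carrier B" "e (fst q) (snd q) \<in> carrier B" "eprod L \<in> carrier B" using c pp by auto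
    show ?case
    proof (cases "p \<in> set L")
      case True
      then show ?thesis using Cons.IH[OF c(1)] cl by (simp add: m_assoc)
    next
      case False
      then have "q = p" using Cons by simp
      moreover have "e (fst p) (snd p) \<otimes> e (fst p) (snd p) = e (fst p) (snd p)"
        using pp by (intro e_idem) (auto simp del: atLeastAtMost_iff)
      ultimately show ?thesis using cl e_eprod[OF pp c(1)] by (simp add: m_assoc)
    qed
  qed simp
  then show "p \<in> tie_closure L" using pp by (simp add: tie_closure_def)
qed

lemma eprod_absorb:
  assumes L: "set L \<subseteq> pairs"
  shows "set L' \<subseteq> tie_closure L \<Longrightarrow> eprod L \<otimes> eprod L' = eprod L"
proof (induction L')
  case (Cons p L')
  have p: "p \<in> pairs" "eprod L \<otimes> e (fst p) (snd p) = eprod L" using Cons(2) by (auto simp: tie_closure_def)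
  have L': "set L' \<subseteq> pairs" using Cons(2) by (auto simp: tie_closure_def)
  have "eprod L \<otimes> (e (fst p) (snd p) \<otimes> eprod L') = eprod L \<otimes> e (fst p) (snd p) \<otimes> eprod L'"
    using L L' p(1) by (intro m_assoc[symmetric] eprod_closed e_pair_closed)
  then show ?case using Cons.IH Cons.prems p(2) by simp
qed (use L in simp)

text \<open>Each of the two products absorbs the other, and products of ties commute.\<close>

lemma eprod_listing:
  assumes L: "set L \<subseteq> pairs"
  shows "eprod (listing (tie_closure L)) = eprod L"
proof -
  have sub: "tie_closure L \<subseteq> pairs" by (auto simp: tie_closure_def)
  note s = set_listing[OF sub]
  have L': "set (listing (tie_closure L)) \<subseteq> pairs" using s sub by simp
  have "eprod L \<otimes> eprod (listing (tie_closure L)) = eprod L" using s by (intro eprod_absorb[OF L]) simp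
  moreover have "eprod (listing (tie_closure L)) \<otimes> eprod L = eprod (listing (tie_closure L))"
    using s self_tie_closure[OF L'] self_tie_closure[OF L] by (intro eprod_absorb[OF L']) simp
  ultimately show ?thesis using eprod_comm[OF L L'] by simp
qed

definition index :: "((nat \<times> nat) set \<times> nat list) set" where
  "index = {Y. equiv {1..n} Y} \<times> normal_words n"

definition normal_elem :: "(nat \<times> nat) set \<times> nat list \<Rightarrow> 'b" where
  "normal_elem i = eprod (listing (fst i)) \<otimes> wprod (snd i)"

lemma index_pairs: "i \<in> index \<Longrightarrow> fst i \<subseteq> pairs"
  by (auto simp: index_def equiv_def)

lemma finite_index: "finite index"
proof -
  have "{Y. equiv {1..n} Y} \<subseteq> Pow pairs" by (auto simp: equiv_def)
  then have "finite {Y. equiv {1..n} Y}" by (rule finite_subset) simp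
  then show ?thesis unfolding index_def by (simp add: finite_normal_words)
qed

lemma normal_elem_closed: "normal_elem \<in> index \<rightarrow> carrier B"
proof
  fix i assume i: "i \<in> index"
  show "normal_elem i \<in> carrier B"
    unfolding normal_elem_def using set_listing[OF index_pairs[OF i]] index_pairs[OF i] i
    by (intro m_closed eprod_closed wprod_closed normal_letters'[OF _ order_refl]) (auto simp: index_def)
qed

lemma monomials_normal_elem: "monomials n \<subseteq> normal_elem ` index"
proof
  fix s assume "s \<in> monomials n"
  then obtain L u where s: "s = eprod L \<otimes> wprod u" "set L \<subseteq> pairs" "u \<in> normal_words n"
    unfolding monomials_def by blast
  have "(tie_closure L, u) \<in> index" using tie_closure_equiv[OF s(2)] s(3) by (simp add: index_def)
  moreover have "s = normal_elem (tie_closure L, u)" using eprod_listing[OF s(2)] by (simp add: normal_elem_def s(1))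
  ultimately show "s \<in> normal_elem ` index" by blast
qed

lemma span_expand:
  assumes "x \<in> kspan (monomials n)"
  shows "\<exists>c \<in> index \<rightarrow> carrier K. x = (\<Oplus>i\<in>index. \<theta> (c i) \<otimes> normal_elem i)"
proof (rule kspan_finite[OF finite_index normal_elem_closed])
  have S: "normal_elem ` index \<subseteq> carrier B" using normal_elem_closed by auto
  have "\<one> \<otimes> x \<in> kspan (normal_elem ` index)"
    by (rule kspan_mult[OF monomials_closed[OF order_refl] S one_closed _ assms])
      (use monomials_closed[OF order_refl] monomials_normal_elem S in \<open>auto simp: subset_eq intro!: kspan_base\<close>)
  then show "x \<in> kspan (normal_elem ` index)" using kspan_closed[OF assms monomials_closed[OF order_refl]] by simp
qed

end

section \<open>Coloured permutation modules\<close>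

locale fun_space = cring K for K :: "('k, 'm) ring_scheme" (structure) + fixes Pt :: "'p set"
begin

definition V :: "('p \<Rightarrow> 'k) set" where
  "V = {f. (\<forall>p. f p \<in> carrier K) \<and> (\<forall>p. p \<notin> Pt \<longrightarrow> f p = \<zero>)}"

text \<open>Operators are set to zero outside \<open>V\<close>, so that they are equal as soon as they agree on \<open>V\<close>.\<close>

definition linear_op :: "(('p \<Rightarrow> 'k) \<Rightarrow> 'p \<Rightarrow> 'k) \<Rightarrow> bool" where
  "linear_op T \<longleftrightarrow> (\<forall>f\<in>V. T f \<in> V) \<and> (\<forall>f. f \<notin> V \<longrightarrow> T f = (\<lambda>_. \<zero>)) \<and>
     (\<forall>f\<in>V. \<forall>g\<in>V. T (\<lambda>p. f p \<oplus> g p) = (\<lambda>p. T f p \<oplus> T g p)) \<and>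
     (\<forall>k\<in>carrier K. \<forall>f\<in>V. T (\<lambda>p. k \<otimes> f p) = (\<lambda>p. k \<otimes> T f p))"

definition D :: "(('p \<Rightarrow> 'k) \<Rightarrow> 'p \<Rightarrow> 'k) ring" where
  "D = \<lparr>carrier = {T. linear_op T}, monoid.mult = (\<circ>), one = (\<lambda>f. if f \<in> V then f else (\<lambda>_. \<zero>)),
        ring.zero = (\<lambda>_ _. \<zero>), add = (\<lambda>S T f p. S f p \<oplus> T f p)\<rparr>"

lemma D_simps [simp]:
  "T \<in> carrier D \<longleftrightarrow> linear_op T" "S \<otimes>\<^bsub>D\<^esub> T = S \<circ> T" "\<one>\<^bsub>D\<^esub> = (\<lambda>f. if f \<in> V then f else (\<lambda>_. \<zero>))"
  "\<zero>\<^bsub>D\<^esub> = (\<lambda>_ _. \<zero>)" "S \<oplus>\<^bsub>D\<^esub> T = (\<lambda>f p. S f p \<oplus> T f p)"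
  by (simp_all add: D_def)

lemma V_zero [simp]: "(\<lambda>_. \<zero>) \<in> V" by (simp add: V_def)
lemma V_add [simp]: "f \<in> V \<Longrightarrow> g \<in> V \<Longrightarrow> (\<lambda>p. f p \<oplus> g p) \<in> V" by (simp add: V_def)
lemma V_scale [simp]: "k \<in> carrier K \<Longrightarrow> f \<in> V \<Longrightarrow> (\<lambda>p. k \<otimes> f p) \<in> V" by (simp add: V_def)
lemma V_minus [simp]: "f \<in> V \<Longrightarrow> (\<lambda>p. \<ominus> f p) \<in> V" by (simp add: V_def)
lemma V_outside: "f \<in> V \<Longrightarrow> p \<notin> Pt \<Longrightarrow> f p = \<zero>" by (simp add: V_def)
lemma V_coeff [simp]: "f \<in> V \<Longrightarrow> f p \<in> carrier K" by (simp add: V_def)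

lemma linear_opD:
  assumes "linear_op T"
  shows "f \<in> V \<Longrightarrow> T f \<in> V" "f \<notin> V \<Longrightarrow> T f = (\<lambda>_. \<zero>)"
    "f \<in> V \<Longrightarrow> g \<in> V \<Longrightarrow> T (\<lambda>p. f p \<oplus> g p) = (\<lambda>p. T f p \<oplus> T g p)"
    "k \<in> carrier K \<Longrightarrow> f \<in> V \<Longrightarrow> T (\<lambda>p. k \<otimes> f p) = (\<lambda>p. k \<otimes> T f p)"
  using assms by (simp_all add: linear_op_def)

lemma op_closed [simp]: "linear_op T \<Longrightarrow> T f \<in> V"
  by (cases "f \<in> V") (simp_all add: linear_opD)

lemma op_zero: "linear_op T \<Longrightarrow> T (\<lambda>_. \<zero>) = (\<lambda>_. \<zero>)"
  using linear_opD(4)[of T \<zero> "\<lambda>_. \<zero>"] op_closed[of T "\<lambda>_. \<zero>"] by simp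

lemma D_ring: "ring D"
proof (rule ringI)
  show "abelian_group D"
  proof (rule abelian_groupI)
    fix S T U assume "S \<in> carrier D" "T \<in> carrier D"
    then have l: "linear_op S" "linear_op T" by simp_all
    then have "linear_op (\<lambda>f p. S f p \<oplus> T f p)"
      by (auto simp: linear_op_def a_ac r_distr)
    then show "S \<oplus>\<^bsub>D\<^esub> T \<in> carrier D" by simp
    show "S \<oplus>\<^bsub>D\<^esub> T = T \<oplus>\<^bsub>D\<^esub> S" using l by (simp add: a_comm)
    { assume "U \<in> carrier D"
      then show "S \<oplus>\<^bsub>D\<^esub> T \<oplus>\<^bsub>D\<^esub> U = S \<oplus>\<^bsub>D\<^esub> (T \<oplus>\<^bsub>D\<^esub> U)" using l by (simp add: a_assoc) }
  next
    show "\<zero>\<^bsub>D\<^esub> \<in> carrier D" by (simp add: linear_op_def)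
  next
    fix T assume "T \<in> carrier D"
    then have T: "linear_op T" by simp
    show "\<zero>\<^bsub>D\<^esub> \<oplus>\<^bsub>D\<^esub> T = T" using T by simp
    have "linear_op (\<lambda>f p. \<ominus> T f p)"
      using T by (auto simp: linear_op_def minus_add r_minus)
    then show "\<exists>S\<in>carrier D. S \<oplus>\<^bsub>D\<^esub> T = \<zero>\<^bsub>D\<^esub>"
      using T by (intro bexI[of _ "\<lambda>f p. \<ominus> T f p"]) (auto simp: l_neg)
  qed
  show "monoid D"
  proof (rule monoidI)
    fix S T assume "S \<in> carrier D" "T \<in> carrier D"
    then show "S \<otimes>\<^bsub>D\<^esub> T \<in> carrier D"
      by (auto simp: linear_op_def op_zero)
  next
    fix T assume "T \<in> carrier D"
    then have T: "linear_op T" by simp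
    show "\<one>\<^bsub>D\<^esub> \<otimes>\<^bsub>D\<^esub> T = T" using T by (auto simp: fun_eq_iff)
    show "T \<otimes>\<^bsub>D\<^esub> \<one>\<^bsub>D\<^esub> = T" using T by (auto simp: fun_eq_iff linear_opD(2) op_zero)
  qed (auto simp: linear_op_def)
next
  fix S T U assume "S \<in> carrier D" "T \<in> carrier D" "U \<in> carrier D"
  then show "U \<otimes>\<^bsub>D\<^esub> (S \<oplus>\<^bsub>D\<^esub> T) = U \<otimes>\<^bsub>D\<^esub> S \<oplus>\<^bsub>D\<^esub> U \<otimes>\<^bsub>D\<^esub> T"
    "(S \<oplus>\<^bsub>D\<^esub> T) \<otimes>\<^bsub>D\<^esub> U = S \<otimes>\<^bsub>D\<^esub> U \<oplus>\<^bsub>D\<^esub> T \<otimes>\<^bsub>D\<^esub> U"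
    by (auto simp: fun_eq_iff linear_opD(3))
qed

sublocale D: ring D by (rule D_ring)

lemma D_eqI:
  assumes "linear_op S" "linear_op T" "\<And>f p. f \<in> V \<Longrightarrow> p \<in> Pt \<Longrightarrow> S f p = T f p"
  shows "S = T"
proof (intro ext)
  fix f p
  consider "f \<notin> V" | "f \<in> V" "p \<notin> Pt" | "f \<in> V" "p \<in> Pt" by blast
  then show "S f p = T f p"
    by cases (use assms in \<open>simp_all add: linear_opD(2) V_outside[OF op_closed]\<close>)
qed

section \<open>Diagonal operators and the action of scalars\<close>

definition diag :: "('p \<Rightarrow> 'k) \<Rightarrow> ('p \<Rightarrow> 'k) \<Rightarrow> 'p \<Rightarrow> 'k" where
  "diag \<phi> f = (if f \<in> V then (\<lambda>p. \<phi> p \<otimes> f p) else (\<lambda>_. \<zero>))"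

lemma diag_closed [simp]: "(\<And>p. \<phi> p \<in> carrier K) \<Longrightarrow> linear_op (diag \<phi>)"
  by (auto simp: linear_op_def diag_def r_distr m_ac fun_eq_iff) (auto simp: V_def simp del: V_coeff)

lemma diag_apply: "f \<in> V \<Longrightarrow> diag \<phi> f p = \<phi> p \<otimes> f p"
  by (simp add: diag_def)

lemma diag_one: "\<one>\<^bsub>D\<^esub> = diag (\<lambda>_. \<one>)"
  by (auto simp: diag_def fun_eq_iff)

lemma diag_add: "(\<And>p. \<phi> p \<in> carrier K) \<Longrightarrow> (\<And>p. \<psi> p \<in> carrier K) \<Longrightarrow>
    diag \<phi> \<oplus>\<^bsub>D\<^esub> diag \<psi> = diag (\<lambda>p. \<phi> p \<oplus> \<psi> p)"
  by (auto simp: diag_def fun_eq_iff l_distr)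

lemma diag_mult:
  assumes "\<And>p. \<phi> p \<in> carrier K" "\<And>p. \<psi> p \<in> carrier K"
  shows "diag \<phi> \<otimes>\<^bsub>D\<^esub> diag \<psi> = diag (\<lambda>p. \<phi> p \<otimes> \<psi> p)"
proof (rule D_eqI)
  show "linear_op (diag \<phi> \<otimes>\<^bsub>D\<^esub> diag \<psi>)"
    using D.m_closed[of "diag \<phi>" "diag \<psi>"] assms by simp
  fix f p assume "f \<in> V"
  moreover from this have "diag \<psi> f \<in> V" using assms by simp
  ultimately show "(diag \<phi> \<otimes>\<^bsub>D\<^esub> diag \<psi>) f p = diag (\<lambda>p. \<phi> p \<otimes> \<psi> p) f p"
    using assms by (simp add: diag_apply m_assoc)
qed (use assms in simp)

lemma diag_pow:
  assumes "\<And>p. \<phi> p \<in> carrier K"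
  shows "diag \<phi> [^]\<^bsub>D\<^esub> (m::nat) = diag (\<lambda>p. \<phi> p [^] m)"
proof (induction m)
  case 0
  then show ?case using diag_one by simp
next
  case (Suc m)
  then show ?case using diag_mult[of "\<lambda>p. \<phi> p [^] m" \<phi>] assms by simp
qed

lemma diag_zero: "diag (\<lambda>_. \<zero>) = \<zero>\<^bsub>D\<^esub>"
  by (auto simp: diag_def fun_eq_iff)

lemma diag_finsum:
  assumes "finite A" "\<And>a p. a \<in> A \<Longrightarrow> \<phi> a p \<in> carrier K"
  shows "(\<Oplus>\<^bsub>D\<^esub>a\<in>A. diag (\<phi> a)) = diag (\<lambda>p. \<Oplus>a\<in>A. \<phi> a p)"
  using assms
proof (induction A)
  case empty
  then show ?case by (simp add: diag_zero del: D_simps(4))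
next
  case (insert a A)
  have "(\<Oplus>\<^bsub>D\<^esub>b\<in>insert a A. diag (\<phi> b)) = diag (\<phi> a) \<oplus>\<^bsub>D\<^esub> (\<Oplus>\<^bsub>D\<^esub>b\<in>A. diag (\<phi> b))"
    using insert by (intro D.finsum_insert) (auto intro!: diag_closed)
  also have "\<dots> = diag (\<phi> a) \<oplus>\<^bsub>D\<^esub> diag (\<lambda>p. \<Oplus>b\<in>A. \<phi> b p)"
    using insert by simp
  also have "\<dots> = diag (\<lambda>p. \<phi> a p \<oplus> (\<Oplus>b\<in>A. \<phi> b p))"
    using insert by (intro diag_add finsum_closed) auto
  also have "(\<lambda>p. \<phi> a p \<oplus> (\<Oplus>b\<in>A. \<phi> b p)) = (\<lambda>p. \<Oplus>b\<in>insert a A. \<phi> b p)"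
    using insert by (intro ext, subst finsum_insert) auto
  finally show ?case .
qed

abbreviation "scal k \<equiv> diag (\<lambda>_. k)"

lemma scal_hom: "scal \<in> ring_hom K D"
proof (rule ring_hom_memI)
  fix x y assume "x \<in> carrier K" "y \<in> carrier K"
  then show "scal x \<in> carrier D" "scal (x \<otimes> y) = scal x \<otimes>\<^bsub>D\<^esub> scal y" "scal (x \<oplus> y) = scal x \<oplus>\<^bsub>D\<^esub> scal y"
    using diag_mult[of "\<lambda>_. x" "\<lambda>_. y"] diag_add[of "\<lambda>_. x" "\<lambda>_. y"] by simp_all
qed (use diag_one in simp)

lemma scal_central:
  assumes k: "k \<in> carrier K" and T: "linear_op T"
  shows "scal k \<otimes>\<^bsub>D\<^esub> T = T \<otimes>\<^bsub>D\<^esub> scal k"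
proof
  fix f
  show "(scal k \<otimes>\<^bsub>D\<^esub> T) f = (T \<otimes>\<^bsub>D\<^esub> scal k) f"
    using k T by (cases "f \<in> V") (simp_all add: diag_def linear_opD(2,4) op_zero)
qed

end

text \<open>The points are all injective maps on the natural numbers rather than permutations of
  {1..n}: every \<open>sw i\<close> acts on them, so the relations hold without index bounds, and
  adjacent labels always differ. The last assumption is the form in which the invertible product of
  differences enters.\<close>

locale colour_rep = fun_space K "{p :: nat \<Rightarrow> nat. inj p}" for K :: "('k, 'm) ring_scheme" (structure) +
  fixes r :: nat and c z \<xi> :: 'k and col :: "nat \<Rightarrow> nat"
  assumes c_closed [simp]: "c \<in> carrier K" and z_closed [simp]: "z \<in> carrier K" and \<xi>_closed [simp]: "\<xi> \<in> carrier K"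
    and col: "col a < r"
    and \<xi>_pow: "\<xi> [^] r = \<one>"
    and c_inv: "c \<otimes> [r] \<cdot> \<one> = \<one>"
    and \<xi>_unit: "i < j \<Longrightarrow> j < r \<Longrightarrow> \<xi> [^] i \<ominus> \<xi> [^] j \<in> Units K"
begin

text \<open>Placing the correction at descents rather than ascents is what lets reduced words act at
  the identity by pure permutation.\<close>

definition \<zeta> :: "nat \<Rightarrow> nat \<Rightarrow> 'k" where
  "\<zeta> a b = (if a > b \<and> col a = col b then z else \<zero>)"

lemma \<zeta>_closed [simp]: "\<zeta> a b \<in> carrier K" by (simp add: \<zeta>_def)

definition gop :: "nat \<Rightarrow> ((nat \<Rightarrow> nat) \<Rightarrow> 'k) \<Rightarrow> (nat \<Rightarrow> nat) \<Rightarrow> 'k" where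
  "gop i f = (if f \<in> V then (\<lambda>p. f (p \<circ> sw i) \<oplus> \<zeta> (p i) (p (Suc i)) \<otimes> f p) else (\<lambda>_. \<zero>))"

definition t_op :: "nat \<Rightarrow> ((nat \<Rightarrow> nat) \<Rightarrow> 'k) \<Rightarrow> (nat \<Rightarrow> nat) \<Rightarrow> 'k" where
  "t_op j = diag (\<lambda>p. \<xi> [^] col (p j))"

lemma inj_sw: "inj (p \<circ> sw i) \<longleftrightarrow> inj (p :: nat \<Rightarrow> nat)"
proof
  assume "inj (p \<circ> sw i)"
  then have "inj ((p \<circ> sw i) \<circ> sw i)" by (rule inj_compose) simp
  then show "inj p" by (simp add: comp_assoc)
qed (rule inj_compose, simp_all)

lemma gop_apply: "f \<in> V \<Longrightarrow> gop i f p = f (p \<circ> sw i) \<oplus> \<zeta> (p i) (p (Suc i)) \<otimes> f p"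
  by (simp add: gop_def)

lemma gop_closed [simp]: "linear_op (gop i)"
proof -
  have "gop i f \<in> V" if "f \<in> V" for f
    using that by (simp add: gop_def) (auto simp: V_def inj_sw simp del: V_coeff)
  then show ?thesis
    by (auto simp: linear_op_def gop_def r_distr l_distr a_ac m_ac fun_eq_iff)
qed

lemma t_op_closed [simp]: "linear_op (t_op i)" by (simp add: t_op_def)

text \<open>Comparison of coefficients in the braid relation at a point with labels
  \<open>a\<close>, \<open>b\<close>, \<open>d\<close>: for the value at the point swapped by the
  first generator, swapped by the second, and at the point itself. Each is a case check on order and
  colours.\<close>

lemma \<zeta>_rel:
  assumes "a \<noteq> b" "b \<noteq> d" "a \<noteq> d"
  shows "\<zeta> a d \<otimes> \<zeta> b a \<oplus> \<zeta> a b \<otimes> \<zeta> b d = \<zeta> b d \<otimes> \<zeta> a d"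
    "\<zeta> a b \<otimes> \<zeta> a d = \<zeta> a d \<otimes> \<zeta> d b \<oplus> \<zeta> b d \<otimes> \<zeta> a b"
    "\<zeta> a b \<otimes> (\<zeta> b d \<otimes> \<zeta> a b) = \<zeta> b d \<otimes> (\<zeta> a b \<otimes> \<zeta> b d)"
  using assms by (auto simp: \<zeta>_def)

lemma t_g_rel: "t_op j \<otimes>\<^bsub>D\<^esub> gop i = gop i \<otimes>\<^bsub>D\<^esub> t_op (sw i j)"
proof (rule D_eqI)
  show "linear_op (t_op j \<otimes>\<^bsub>D\<^esub> gop i)" "linear_op (gop i \<otimes>\<^bsub>D\<^esub> t_op (sw i j))"
    using D.m_closed[of "t_op j" "gop i"] D.m_closed[of "gop i" "t_op (sw i j)"] by simp_all
  fix f :: "(nat \<Rightarrow> nat) \<Rightarrow> 'k" and p :: "nat \<Rightarrow> nat" assume f: "f \<in> V"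
  have [simp]: "t_op j f \<in> V" for j by simp
  \<comment> \<open>The correction vanishes unless the exchanged labels share a colour, and then the
    swap does not change the eigenvalue.\<close>
  have *: "\<zeta> (p i) (p (Suc i)) \<otimes> \<xi> [^] col (p (sw i j)) = \<zeta> (p i) (p (Suc i)) \<otimes> \<xi> [^] col (p j)"
    by (auto simp: \<zeta>_def Transposition.transpose_def)
  have "(gop i \<otimes>\<^bsub>D\<^esub> t_op (sw i j)) f p =
     \<xi> [^] col (p j) \<otimes> f (p \<circ> sw i) \<oplus> (\<zeta> (p i) (p (Suc i)) \<otimes> \<xi> [^] col (p (sw i j))) \<otimes> f p"
    using f by (simp add: gop_apply t_op_def diag_apply m_assoc)
  also have "\<dots> = (t_op j \<otimes>\<^bsub>D\<^esub> gop i) f p"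
    unfolding * using f by (simp add: gop_apply t_op_def diag_apply r_distr m_ac)
  finally show "(t_op j \<otimes>\<^bsub>D\<^esub> gop i) f p = (gop i \<otimes>\<^bsub>D\<^esub> t_op (sw i j)) f p" ..
qed

lemma g_far_rel:
  assumes "\<bar>int i - int j\<bar> > 1"
  shows "gop i \<otimes>\<^bsub>D\<^esub> gop j = gop j \<otimes>\<^bsub>D\<^esub> gop i"
proof (rule D_eqI)
  show "linear_op (gop i \<otimes>\<^bsub>D\<^esub> gop j)" "linear_op (gop j \<otimes>\<^bsub>D\<^esub> gop i)"
    using D.m_closed[of "gop i" "gop j"] D.m_closed[of "gop j" "gop i"] by simp_all
  fix f :: "(nat \<Rightarrow> nat) \<Rightarrow> 'k" and p :: "nat \<Rightarrow> nat" assume f: "f \<in> V"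
  have [simp]: "gop j f \<in> V" for j by simp
  have s: "sw i j = j" "sw i (Suc j) = Suc j" "sw j i = i" "sw j (Suc i) = Suc i"
    using assms by (auto simp: Transposition.transpose_def)
  have e: "p \<circ> sw i \<circ> sw j = p \<circ> sw j \<circ> sw i"
    using assms by (auto simp: fun_eq_iff Transposition.transpose_def)
  show "(gop i \<otimes>\<^bsub>D\<^esub> gop j) f p = (gop j \<otimes>\<^bsub>D\<^esub> gop i) f p"
    using f s e by (simp add: gop_apply r_distr) (simp add: a_ac m_ac)
qed

lemma g_braid_rel:
  "gop i \<otimes>\<^bsub>D\<^esub> gop (Suc i) \<otimes>\<^bsub>D\<^esub> gop i = gop (Suc i) \<otimes>\<^bsub>D\<^esub> gop i \<otimes>\<^bsub>D\<^esub> gop (Suc i)"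
proof (rule D_eqI)
  have "gop i \<in> carrier D" for i by simp
  then show "linear_op (gop i \<otimes>\<^bsub>D\<^esub> gop (Suc i) \<otimes>\<^bsub>D\<^esub> gop i)"
    "linear_op (gop (Suc i) \<otimes>\<^bsub>D\<^esub> gop i \<otimes>\<^bsub>D\<^esub> gop (Suc i))"
    using D.m_closed D_simps(1) by metis+
  fix f :: "(nat \<Rightarrow> nat) \<Rightarrow> 'k" and p :: "nat \<Rightarrow> nat" assume f: "f \<in> V" and p: "p \<in> {p. inj p}"
  have V[simp]: "gop j g \<in> V" for j g by simp
  let ?u = "sw i" and ?v = "sw (Suc i)"
  define a b d where "a = p i" and "b = p (Suc i)" and "d = p (Suc (Suc i))"
  have ne: "a \<noteq> b" "b \<noteq> d" "a \<noteq> d"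
    using p by (auto simp: a_def b_def d_def inj_eq)
  have s: "?u i = Suc i" "?u (Suc i) = i" "?u (Suc (Suc i)) = Suc (Suc i)"
    "?v i = i" "?v (Suc i) = Suc (Suc i)" "?v (Suc (Suc i)) = Suc i"
    by (auto simp: Transposition.transpose_def)
  have e: "p \<circ> ?v \<circ> ?u \<circ> ?v = p \<circ> ?u \<circ> ?v \<circ> ?u" "q \<circ> ?u \<circ> ?u = q" "q \<circ> ?v \<circ> ?v = q" for q :: "nat \<Rightarrow> nat"
    by (auto simp: fun_eq_iff Transposition.transpose_def)
  \<comment> \<open>The values of \<open>f\<close> at the six rearrangements of three adjacent
    positions of \<open>p\<close>.\<close>
  define F0 F1 F2 F3 F4 F5 where "F0 = f p" and "F1 = f (p \<circ> ?u)" and "F2 = f (p \<circ> ?v)"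
    and "F3 = f (p \<circ> ?u \<circ> ?v)" and "F4 = f (p \<circ> ?v \<circ> ?u)" and "F5 = f (p \<circ> ?u \<circ> ?v \<circ> ?u)"
  have Fc[simp]: "F0 \<in> carrier K" "F1 \<in> carrier K" "F2 \<in> carrier K" "F3 \<in> carrier K" "F4 \<in> carrier K" "F5 \<in> carrier K"
    using f by (simp_all add: F0_def F1_def F2_def F3_def F4_def F5_def)
  have A: "gop i (gop (Suc i) (gop i f)) p = F5 \<oplus> \<zeta> b d \<otimes> F3 \<oplus> \<zeta> a d \<otimes> (F0 \<oplus> \<zeta> b a \<otimes> F1)
     \<oplus> \<zeta> a b \<otimes> (F4 \<oplus> \<zeta> a d \<otimes> F2 \<oplus> \<zeta> b d \<otimes> (F1 \<oplus> \<zeta> a b \<otimes> F0))"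
    using f by (simp add: gop_apply s e F0_def F1_def F2_def F3_def F4_def F5_def a_def b_def d_def)
  have B: "gop (Suc i) (gop i (gop (Suc i) f)) p = F5 \<oplus> \<zeta> a b \<otimes> F4 \<oplus> \<zeta> a d \<otimes> (F0 \<oplus> \<zeta> d b \<otimes> F2)
     \<oplus> \<zeta> b d \<otimes> (F3 \<oplus> \<zeta> a d \<otimes> F1 \<oplus> \<zeta> a b \<otimes> (F2 \<oplus> \<zeta> b d \<otimes> F0))"
    using f by (simp add: gop_apply s e F0_def F1_def F2_def F3_def F4_def F5_def a_def b_def d_def)
  have "F5 \<oplus> \<zeta> b d \<otimes> F3 \<oplus> \<zeta> a d \<otimes> (F0 \<oplus> \<zeta> b a \<otimes> F1)
     \<oplus> \<zeta> a b \<otimes> (F4 \<oplus> \<zeta> a d \<otimes> F2 \<oplus> \<zeta> b d \<otimes> (F1 \<oplus> \<zeta> a b \<otimes> F0)) =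
     F5 \<oplus> \<zeta> b d \<otimes> F3 \<oplus> \<zeta> a b \<otimes> F4 \<oplus> \<zeta> a d \<otimes> F0 \<oplus> (\<zeta> a d \<otimes> \<zeta> b a \<oplus> \<zeta> a b \<otimes> \<zeta> b d) \<otimes> F1
     \<oplus> (\<zeta> a b \<otimes> \<zeta> a d) \<otimes> F2 \<oplus> (\<zeta> a b \<otimes> (\<zeta> b d \<otimes> \<zeta> a b)) \<otimes> F0"
    by (simp add: r_distr l_distr m_assoc) (simp add: a_ac)
  also have "\<dots> = F5 \<oplus> \<zeta> b d \<otimes> F3 \<oplus> \<zeta> a b \<otimes> F4 \<oplus> \<zeta> a d \<otimes> F0 \<oplus> (\<zeta> b d \<otimes> \<zeta> a d) \<otimes> F1
     \<oplus> (\<zeta> a d \<otimes> \<zeta> d b \<oplus> \<zeta> b d \<otimes> \<zeta> a b) \<otimes> F2 \<oplus> (\<zeta> b d \<otimes> (\<zeta> a b \<otimes> \<zeta> b d)) \<otimes> F0"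
    by (simp only: \<zeta>_rel[OF ne])
  also have "\<dots> = F5 \<oplus> \<zeta> a b \<otimes> F4 \<oplus> \<zeta> a d \<otimes> (F0 \<oplus> \<zeta> d b \<otimes> F2)
     \<oplus> \<zeta> b d \<otimes> (F3 \<oplus> \<zeta> a d \<otimes> F1 \<oplus> \<zeta> a b \<otimes> (F2 \<oplus> \<zeta> b d \<otimes> F0))"
    by (simp add: r_distr l_distr m_assoc) (simp add: a_ac)
  finally show "(gop i \<otimes>\<^bsub>D\<^esub> gop (Suc i) \<otimes>\<^bsub>D\<^esub> gop i) f p = (gop (Suc i) \<otimes>\<^bsub>D\<^esub> gop i \<otimes>\<^bsub>D\<^esub> gop (Suc i)) f p"
    using A B by simp
qed

definition eop :: "nat \<Rightarrow> nat \<Rightarrow> ((nat \<Rightarrow> nat) \<Rightarrow> 'k) \<Rightarrow> (nat \<Rightarrow> nat) \<Rightarrow> 'k" where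
  "eop i j = diag (\<lambda>p. if col (p i) = col (p j) then \<one> else \<zero>)"

lemma eop_closed [simp]: "linear_op (eop i j)" by (simp add: eop_def)

lemma \<xi>_diff_unit:
  assumes "a < r" "b < r" "a \<noteq> b"
  shows "\<xi> [^] a \<ominus> \<xi> [^] b \<in> Units K"
proof (cases "a < b")
  case False
  then have "\<xi> [^] b \<ominus> \<xi> [^] a \<in> Units K" using assms by (intro \<xi>_unit) auto
  moreover have "\<xi> [^] a \<ominus> \<xi> [^] b = (\<ominus> \<one>) \<otimes> (\<xi> [^] b \<ominus> \<xi> [^] a)"
    by (simp add: minus_eq l_minus minus_add a_comm)
  ultimately show ?thesis by (metis Units_m_closed Units_minus_one_closed)
qed (use assms \<xi>_unit in simp)

text \<open>Orthogonality of characters. For \<open>a \<noteq> b\<close> the cyclic shift shows that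
  the sum is annihilated by a difference of powers of \<open>\<xi>\<close>; as \<open>K\<close> may
  have zero divisors, it is the invertibility of this difference that forces zero.\<close>

lemma character_sum:
  assumes a: "a < r" "b < r"
  shows "c \<otimes> (\<Oplus>s\<in>{..<r}. (\<xi> [^] a) [^] s \<otimes> (\<xi> [^] b) [^] (r - s)) = (if a = b then \<one> else \<zero>)"
proof -
  define x y where "x = \<xi> [^] a" and "y = \<xi> [^] b"
  have [simp]: "x \<in> carrier K" "y \<in> carrier K" by (simp_all add: x_def y_def)
  have xr: "x [^] r = \<one>" "y [^] r = \<one>"
    using \<xi>_pow by (simp_all add: x_def y_def nat_pow_pow mult.commute[of _ r]) (simp_all flip: nat_pow_pow)
  define S where "S = (\<Oplus>s\<in>{..<r}. x [^] s \<otimes> y [^] (r - s))"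
  have S[simp]: "S \<in> carrier K" unfolding S_def by (intro finsum_closed) auto
  show ?thesis
  proof (cases "a = b")
    case True
    then have xy: "x = y" by (simp add: x_def y_def)
    have "S = (\<Oplus>s\<in>{..<r}. \<one>)"
      unfolding S_def xy using xr by (intro finsum_cong') (auto simp: nat_pow_mult)
    also have "\<dots> = [r] \<cdot> \<one>" using add.finprod_const[of \<one> "{..<r}"] by (simp add: add_pow_def)
    finally show ?thesis using True c_inv unfolding S_def x_def y_def by simp
  next
    case False
    define f where "f s = x [^] s \<otimes> y [^] (Suc r - s)" for s
    have f: "f s \<in> carrier K" for s by (simp add: f_def)
    have f0: "f 0 = y" "f r = y" using xr by (simp_all add: f_def)
    have "x \<otimes> S = (\<Oplus>s\<in>{..<r}. x \<otimes> (x [^] s \<otimes> y [^] (r - s)))"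
      unfolding S_def by (intro finsum_rdistr) auto
    also have "\<dots> = (\<Oplus>s\<in>{..<r}. f (Suc s))"
      by (intro finsum_cong') (auto simp: f_def m_ac)
    also have "\<dots> = (\<Oplus>s\<in>{..<r}. f s)"
      using finsum_shift[of f r] f f0 by (simp add: finsum_closed Pi_def)
    also have "\<dots> = (\<Oplus>s\<in>{..<r}. y \<otimes> (x [^] s \<otimes> y [^] (r - s)))"
      by (intro finsum_cong') (auto simp: f_def m_ac Suc_diff_le)
    also have "\<dots> = y \<otimes> S"
      unfolding S_def by (intro finsum_rdistr[symmetric]) auto
    finally have "(x \<ominus> y) \<otimes> S = (x \<ominus> y) \<otimes> \<zero>"
      by (simp add: minus_eq l_distr l_minus r_neg)
    moreover have "x \<ominus> y \<in> Units K" unfolding x_def y_def by (rule \<xi>_diff_unit[OF a False])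
    ultimately have "S = \<zero>" using Units_l_cancel S zero_closed by blast
    then show ?thesis using False unfolding S_def x_def y_def by simp
  qed
qed

lemma yh_idem_op: "yh_idem D r (scal c) t_op i = eop i (Suc i)"
proof -
  have "(\<Oplus>\<^bsub>D\<^esub>s\<in>{..<r}. t_op i [^]\<^bsub>D\<^esub> s \<otimes>\<^bsub>D\<^esub> t_op (i + 1) [^]\<^bsub>D\<^esub> (r - s)) =
    (\<Oplus>\<^bsub>D\<^esub>s\<in>{..<r}. diag (\<lambda>p. (\<xi> [^] col (p i)) [^] s \<otimes> (\<xi> [^] col (p (Suc i))) [^] (r - s)))"
    by (intro D.finsum_cong') (auto simp: t_op_def diag_pow diag_mult simp del: D_simps(2))
  also have "\<dots> = diag (\<lambda>p. \<Oplus>s\<in>{..<r}. (\<xi> [^] col (p i)) [^] s \<otimes> (\<xi> [^] col (p (Suc i))) [^] (r - s))"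
    by (intro diag_finsum) auto
  finally have "yh_idem D r (scal c) t_op i =
    diag (\<lambda>p. c \<otimes> (\<Oplus>s\<in>{..<r}. (\<xi> [^] col (p i)) [^] s \<otimes> (\<xi> [^] col (p (Suc i))) [^] (r - s)))"
    unfolding yh_idem_def by (simp add: diag_mult finsum_closed Pi_def del: D_simps(2))
  then show ?thesis unfolding eop_def by (simp add: character_sum col)
qed

lemma g_quad_rel: "gop i [^]\<^bsub>D\<^esub> (2::nat) = \<one>\<^bsub>D\<^esub> \<oplus>\<^bsub>D\<^esub> scal z \<otimes>\<^bsub>D\<^esub> (eop i (Suc i) \<otimes>\<^bsub>D\<^esub> gop i)"
proof -
  have g: "gop i \<in> carrier D" "eop i (Suc i) \<in> carrier D" "scal z \<in> carrier D" by simp_all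
  have sq: "gop i [^]\<^bsub>D\<^esub> (2::nat) = gop i \<otimes>\<^bsub>D\<^esub> gop i"
    using D.l_one[OF g(1)] by (simp add: numeral_2_eq_2 del: D_simps)
  show ?thesis unfolding sq
  proof (rule D_eqI)
    show "linear_op (gop i \<otimes>\<^bsub>D\<^esub> gop i)" "linear_op (\<one>\<^bsub>D\<^esub> \<oplus>\<^bsub>D\<^esub> scal z \<otimes>\<^bsub>D\<^esub> (eop i (Suc i) \<otimes>\<^bsub>D\<^esub> gop i))"
      unfolding D_simps(1)[symmetric] by (rule D.m_closed D.a_closed D.one_closed g)+
    fix f :: "(nat \<Rightarrow> nat) \<Rightarrow> 'k" and p :: "nat \<Rightarrow> nat" assume f: "f \<in> V" and p: "p \<in> {p. inj p}"
    have [simp]: "gop j g \<in> V" "eop j k g \<in> V" for j k g by simp_all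
    define a b where "a = p i" and "b = p (Suc i)"
    have ne: "a \<noteq> b" using p by (auto simp: a_def b_def inj_eq)
    define F0 F1 where "F0 = f p" and "F1 = f (p \<circ> sw i)"
    have [simp]: "F0 \<in> carrier K" "F1 \<in> carrier K" using f by (simp_all add: F0_def F1_def)
    have e: "p \<circ> sw i \<circ> sw i = p" by (simp add: comp_assoc)
    have "(gop i \<otimes>\<^bsub>D\<^esub> gop i) f p = F0 \<oplus> \<zeta> b a \<otimes> F1 \<oplus> \<zeta> a b \<otimes> (F1 \<oplus> \<zeta> a b \<otimes> F0)"
      using f by (simp add: gop_apply e F0_def F1_def a_def b_def)
    also have "\<dots> = F0 \<oplus> z \<otimes> ((if col a = col b then \<one> else \<zero>) \<otimes> (F1 \<oplus> \<zeta> a b \<otimes> F0))"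
    \<comment> \<open>For equal colours exactly one of \<open>\<zeta> a b\<close> and
      \<open>\<zeta> b a\<close> is \<open>z\<close>, because the labels differ.\<close>
    proof (cases "col a = col b")
      case True
      then show ?thesis using ne by (cases "a > b") (auto simp: \<zeta>_def a_assoc)
    qed (simp add: \<zeta>_def)
    also have "\<dots> = (\<one>\<^bsub>D\<^esub> \<oplus>\<^bsub>D\<^esub> scal z \<otimes>\<^bsub>D\<^esub> (eop i (Suc i) \<otimes>\<^bsub>D\<^esub> gop i)) f p"
    proof -
      have "eop i (Suc i) (gop i f) p = (if col a = col b then \<one> else \<zero>) \<otimes> (F1 \<oplus> \<zeta> a b \<otimes> F0)"
        using f by (simp add: eop_def diag_apply gop_apply F0_def F1_def a_def b_def)
      then show ?thesis using f by (simp add: diag_apply F0_def)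
    qed
    finally show "(gop i \<otimes>\<^bsub>D\<^esub> gop i) f p = (\<one>\<^bsub>D\<^esub> \<oplus>\<^bsub>D\<^esub> scal z \<otimes>\<^bsub>D\<^esub> (eop i (Suc i) \<otimes>\<^bsub>D\<^esub> gop i)) f p" .
  qed
qed

lemma yh_relations_op:
  assumes "(u, v) \<in> yh_relations D r n (scal c) (scal z) gop t_op"
  shows "u = v"
proof -
  have tr: "t_op i [^]\<^bsub>D\<^esub> r = \<one>\<^bsub>D\<^esub>" for i
  proof -
    have "(\<xi> [^] col (p i)) [^] r = \<one>" for p :: "nat \<Rightarrow> nat"
      using \<xi>_pow by (simp add: nat_pow_pow mult.commute[of _ r]) (simp flip: nat_pow_pow)
    then show ?thesis by (simp add: t_op_def diag_pow diag_one del: D_simps)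
  qed
  have tt: "t_op i \<otimes>\<^bsub>D\<^esub> t_op j = t_op j \<otimes>\<^bsub>D\<^esub> t_op i" for i j
    by (simp add: t_op_def diag_mult m_comm del: D_simps)
  from assms show ?thesis
    unfolding yh_relations_def Un_iff Suc_eq_plus1[symmetric] yh_idem_op
    using tr tt t_g_rel g_far_rel g_braid_rel g_quad_rel
    by (elim disjE) (simp_all del: D_simps, (elim exE conjE, simp only: prod.inject)+)
qed

lemma eop_conj: "gop k \<otimes>\<^bsub>D\<^esub> eop i j = eop (sw k i) (sw k j) \<otimes>\<^bsub>D\<^esub> gop k"
proof (rule D_eqI)
  show "linear_op (gop k \<otimes>\<^bsub>D\<^esub> eop i j)" "linear_op (eop (sw k i) (sw k j) \<otimes>\<^bsub>D\<^esub> gop k)"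
    using D.m_closed[of "gop k" "eop i j"] D.m_closed[of "eop (sw k i) (sw k j)" "gop k"] by simp_all
  fix f :: "(nat \<Rightarrow> nat) \<Rightarrow> 'k" and p :: "nat \<Rightarrow> nat" assume f: "f \<in> V"
  have [simp]: "gop j g \<in> V" "eop j k g \<in> V" for j k g by simp_all
  define \<epsilon> where "\<epsilon> i j = (if col (p i) = col (p j) then \<one> else \<zero>)" for i j
  have [simp]: "\<epsilon> i j \<in> carrier K" for i j by (simp add: \<epsilon>_def)
  \<comment> \<open>As in \<open>t_g_rel\<close>, the correction survives only between labels of one
    colour, and then both indicators agree.\<close>
  have *: "\<zeta> (p k) (p (Suc k)) \<otimes> \<epsilon> i j = \<epsilon> (sw k i) (sw k j) \<otimes> \<zeta> (p k) (p (Suc k))"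
    by (auto simp: \<zeta>_def \<epsilon>_def Transposition.transpose_def)
  have "(gop k \<otimes>\<^bsub>D\<^esub> eop i j) f p =
     \<epsilon> (sw k i) (sw k j) \<otimes> f (p \<circ> sw k) \<oplus> (\<zeta> (p k) (p (Suc k)) \<otimes> \<epsilon> i j) \<otimes> f p"
    using f by (simp add: gop_apply eop_def diag_apply m_assoc \<epsilon>_def)
  also have "\<dots> = (eop (sw k i) (sw k j) \<otimes>\<^bsub>D\<^esub> gop k) f p"
    unfolding * using f by (simp add: gop_apply eop_def diag_apply r_distr m_assoc flip: \<epsilon>_def)
  finally show "(gop k \<otimes>\<^bsub>D\<^esub> eop i j) f p = (eop (sw k i) (sw k j) \<otimes>\<^bsub>D\<^esub> gop k) f p" .
qed

end

section \<open>Normal words as permutations, and their action at an increasing point\<close>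

definition word_act :: "(nat \<Rightarrow> nat) \<Rightarrow> nat list \<Rightarrow> nat \<Rightarrow> nat" where
  "word_act p u = foldl (\<lambda>p k. p \<circ> sw k) p u"

lemma word_act_simps [simp]: "word_act p [] = p" "word_act p (k # u) = word_act (p \<circ> sw k) u"
  by (simp_all add: word_act_def)

lemma word_act_append [simp]: "word_act p (u @ v) = word_act (word_act p u) v"
  by (simp add: word_act_def)

lemma word_act_outside: "set u \<subseteq> {1..<m} \<Longrightarrow> j > m \<Longrightarrow> word_act p u j = p j"
  by (induction u arbitrary: p) (auto simp: Transposition.transpose_def)

text \<open>A run acts as a cycle: the entry at \<open>k\<close> travels up to position m + 1 and
  the entries it passes move down by one. The empty run k = m + 1 is included.\<close>

lemma word_act_run:
  assumes "k \<le> Suc m"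
  shows "word_act p [k..<Suc m] = (\<lambda>j. if j < k \<or> j > Suc m then p j else if j = Suc m then p k else p (Suc j))"
  using assms
proof (induction k arbitrary: p rule: inc_induct)
  case base
  then show ?case by (auto simp: fun_eq_iff)
next
  case (step k)
  then have "[k..<Suc m] = k # [Suc k..<Suc m]" by (simp add: upt_conv_Cons)
  then have "word_act p [k..<Suc m] = word_act (p \<circ> sw k) [Suc k..<Suc m]" by simp
  then show ?case unfolding step.IH using step(2)
    by (auto simp: fun_eq_iff Transposition.transpose_def less_Suc_eq simp del: upt_Suc)
qed

lemma inj_word_act: "inj p \<Longrightarrow> inj (word_act p u)"
proof (induction u arbitrary: p)
  case (Cons k u)
  have "inj (p \<circ> sw k)" using Cons.prems by (rule inj_compose) simp
  then show ?case using Cons.IH by simp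
qed simp

text \<open>The tail of a normal word fixes position m + 1, so the value there is \<open>p k\<close>
  and recovers the start of the run; the tail is recovered by induction.\<close>

lemma word_act_inj:
  "inj p \<Longrightarrow> u \<in> normal_words m \<Longrightarrow> v \<in> normal_words m \<Longrightarrow> word_act p u = word_act p v \<Longrightarrow> u = v"
proof (induction m arbitrary: p u v)
  case (Suc m)
  obtain k u' where u: "k \<in> {1..Suc m}" "u' \<in> normal_words m" "u = [k..<Suc m] @ u'" using Suc(3) by auto
  obtain l v' where v: "l \<in> {1..Suc m}" "v' \<in> normal_words m" "v = [l..<Suc m] @ v'" using Suc(4) by auto
  have "word_act p u (Suc m) = p k"
    using u word_act_outside[OF normal_words_letters[OF u(2)], of "Suc m"] by (simp add: word_act_run del: upt_Suc)
  moreover have "word_act p v (Suc m) = p l"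
    using v word_act_outside[OF normal_words_letters[OF v(2)], of "Suc m"] by (simp add: word_act_run del: upt_Suc)
  ultimately have kl: "k = l" using Suc(2,5) by (metis injD)
  then have "u' = v'"
    using Suc(5) u v by (intro Suc.IH[OF inj_word_act[OF Suc(2), of "[k..<Suc m]"]]) (simp_all del: upt_Suc)
  then show ?case using kl u v by simp
qed simp

context colour_rep
begin

definition wop :: "nat list \<Rightarrow> ((nat \<Rightarrow> nat) \<Rightarrow> 'k) \<Rightarrow> (nat \<Rightarrow> nat) \<Rightarrow> 'k" where
  "wop u = foldr (\<lambda>k T. gop k \<otimes>\<^bsub>D\<^esub> T) u \<one>\<^bsub>D\<^esub>"

lemma wop_simps: "wop [] = \<one>\<^bsub>D\<^esub>" "wop (k # u) = gop k \<otimes>\<^bsub>D\<^esub> wop u"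
  by (simp_all add: wop_def)

lemma wop_closed [simp]: "linear_op (wop u)"
proof (induction u)
  case Nil
  show ?case using D.one_closed unfolding wop_simps D_simps(1) .
next
  case (Cons k u)
  then show ?case using D.m_closed[of "gop k" "wop u"] by (simp add: wop_simps comp_def)
qed

lemma gop_ascent: "f \<in> V \<Longrightarrow> p k < p (Suc k) \<Longrightarrow> gop k f p = f (p \<circ> sw k)"
  by (simp add: gop_apply \<zeta>_def)

text \<open>The travelling entry \<open>p k\<close> is smaller than every entry it is exchanged
  with, so each letter is applied at an ascent and no correction arises.\<close>

lemma wop_run:
  assumes f: "f \<in> V" and k: "k \<le> Suc m"
  shows "(\<And>j. k < j \<Longrightarrow> j \<le> Suc m \<Longrightarrow> p k < p j) \<Longrightarrow>
    wop ([k..<Suc m] @ v) f p = wop v f (word_act p [k..<Suc m])"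
  using k
proof (induction k arbitrary: p rule: inc_induct)
  case base
  then show ?case by simp
next
  case (step k)
  then have e: "[k..<Suc m] = k # [Suc k..<Suc m]" by (simp add: upt_conv_Cons)
  have "p k < p (Suc k)" using step by simp
  then have "wop ([k..<Suc m] @ v) f p = wop ([Suc k..<Suc m] @ v) f (p \<circ> sw k)"
    unfolding e by (simp add: wop_simps gop_ascent)
  also have "\<dots> = wop v f (word_act (p \<circ> sw k) [Suc k..<Suc m])"
  proof (rule step.IH)
    fix j assume "Suc k < j" "j \<le> Suc m"
    then show "(p \<circ> sw k) (Suc k) < (p \<circ> sw k) j" using step.prems[of j] by (simp add: Transposition.transpose_def)
  qed
  finally show ?case unfolding e by simp
qed

text \<open>After the run, the first m positions hold the old entries without one of them, hence
  still increase, and the induction hypothesis applies to the tail.\<close>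

lemma wop_normal:
  assumes f: "f \<in> V"
  shows "u \<in> normal_words m \<Longrightarrow> (\<And>i j. 1 \<le> i \<Longrightarrow> i < j \<Longrightarrow> j \<le> m \<Longrightarrow> p i < p j) \<Longrightarrow>
    wop u f p = f (word_act p u)"
proof (induction m arbitrary: p u)
  case 0
  then show ?case using f by (simp add: wop_simps)
next
  case (Suc m)
  obtain k u' where u: "k \<in> {1..Suc m}" "u' \<in> normal_words m" "u = [k..<Suc m] @ u'" using Suc(2) by auto
  have k: "k \<le> Suc m" "1 \<le> k" using u by auto
  have "wop u f p = wop u' f (word_act p [k..<Suc m])"
    unfolding u(3) using Suc.prems(2)[of k] k by (intro wop_run[OF f]) auto
  also have "\<dots> = f (word_act (word_act p [k..<Suc m]) u')"
  proof (rule Suc.IH[OF u(2)])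
    fix i j assume "1 \<le> i" "i < j" "j \<le> m"
    then show "word_act p [k..<Suc m] i < word_act p [k..<Suc m] j"
      unfolding word_act_run[OF k(1)] using Suc.prems(2) by auto
  qed
  finally show ?case unfolding u(3) by simp
qed

end

section \<open>Ground rings and transport of relations\<close>

lemma generated_ring_simps:
  "carrier (generated_ring H) = generate_ring ring_of_type_algebra H"
  "x \<otimes>\<^bsub>generated_ring H\<^esub> y = x * y" "x \<oplus>\<^bsub>generated_ring H\<^esub> y = x + y"
  "\<one>\<^bsub>generated_ring H\<^esub> = 1" "\<zero>\<^bsub>generated_ring H\<^esub> = 0"
  by (simp_all add: generated_ring_def ring_of_type_algebra_def)

lemma generated_ring_cring: "cring (generated_ring H)"
proof -
  interpret T: cring "ring_of_type_algebra :: complex poly fract ring" by (rule cring_from_type_algebra)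
  have H: "H \<subseteq> carrier (ring_of_type_algebra :: complex poly fract ring)"
    by (simp add: ring_of_type_algebra_def)
  have "subcring (generate_ring ring_of_type_algebra H) (ring_of_type_algebra :: complex poly fract ring)"
    by (rule T.subcringI'[OF T.generate_ring_is_subring[OF H]])
  then show ?thesis unfolding generated_ring_def
    by (subst (asm) T.subcring_iff) (simp_all add: ring_of_type_algebra_def)
qed

lemma generated_ring_incl: "x \<in> H \<Longrightarrow> x \<in> carrier (generated_ring H)"
  by (simp add: generated_ring_simps generate_ring.incl)

lemma generated_ring_mono: "H \<subseteq> H' \<Longrightarrow> carrier (generated_ring H) \<subseteq> carrier (generated_ring H')"
proof
  interpret T: cring "ring_of_type_algebra :: complex poly fract ring" by (rule cring_from_type_algebra)
  fix x assume H: "H \<subseteq> H'" and "x \<in> carrier (generated_ring H)"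
  then have "x \<in> generate_ring ring_of_type_algebra H" by (simp add: generated_ring_simps)
  then have "x \<in> generate_ring ring_of_type_algebra H'"
    by induction (use H in \<open>auto intro: generate_ring.intros\<close>)
  then show "x \<in> carrier (generated_ring H')" by (simp add: generated_ring_simps)
qed

lemma ring_S_cring: "cring ring_S" and ring_R_cring: "cring (ring_R r)"
  by (simp_all add: ring_S_def ring_R_def generated_ring_cring)

lemma generated_ring_uminus: "x \<in> carrier (generated_ring H) \<Longrightarrow> - x \<in> carrier (generated_ring H)"
proof -
  interpret cring "generated_ring H" by (rule generated_ring_cring)
  assume x: "x \<in> carrier (generated_ring H)"
  have "\<ominus>\<^bsub>generated_ring H\<^esub> x = - x"
    using l_neg[OF x] by (simp add: generated_ring_simps eq_neg_iff_add_eq_0)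
  then show ?thesis using a_inv_closed[OF x] by simp
qed

lemma indet_diff_S: "indet_q - inverse indet_q \<in> carrier ring_S"
proof -
  interpret cring ring_S by (rule ring_S_cring)
  have "indet_q \<in> carrier ring_S" "- inverse indet_q \<in> carrier ring_S"
    unfolding ring_S_def by (auto intro: generated_ring_incl generated_ring_uminus)
  from a_closed[OF this] show ?thesis by (simp add: ring_S_def generated_ring_simps)
qed

lemma S_sub_R: "carrier ring_S \<subseteq> carrier (ring_R r)"
  unfolding ring_S_def ring_R_def by (rule generated_ring_mono) auto

lemma hom_restrict_S:
  assumes h: "h \<in> ring_hom (ring_R r) K"
  shows "h \<in> ring_hom ring_S K"
proof (rule ring_hom_memI)
  have ops: "x \<otimes>\<^bsub>ring_S\<^esub> y = x \<otimes>\<^bsub>ring_R r\<^esub> y" "x \<oplus>\<^bsub>ring_S\<^esub> y = x \<oplus>\<^bsub>ring_R r\<^esub> y" "\<one>\<^bsub>ring_S\<^esub> = \<one>\<^bsub>ring_R r\<^esub>" for x y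
    by (simp_all add: ring_S_def ring_R_def generated_ring_simps)
  fix x y assume xy: "x \<in> carrier ring_S" "y \<in> carrier ring_S"
  then have "x \<in> carrier (ring_R r)" "y \<in> carrier (ring_R r)" using S_sub_R by blast+
  then show "h (x \<otimes>\<^bsub>ring_S\<^esub> y) = h x \<otimes>\<^bsub>K\<^esub> h y" "h (x \<oplus>\<^bsub>ring_S\<^esub> y) = h x \<oplus>\<^bsub>K\<^esub> h y" "h x \<in> carrier K"
    unfolding ops using ring_hom_mult[OF h] ring_hom_add[OF h] ring_hom_closed[OF h] by simp_all
next
  show "h \<one>\<^bsub>ring_S\<^esub> = \<one>\<^bsub>K\<^esub>"
    using ring_hom_one[OF h] by (simp add: ring_S_def ring_R_def generated_ring_simps)
qed

lemma inverse_r_R: "inverse (of_nat r) \<in> carrier (ring_R r)"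
  unfolding ring_R_def by (rule generated_ring_incl) simp

text \<open>A homomorphism sends the natural number r to its multiple of the unit, and r times 1/r
  is 1 among rational functions, where r is nonzero.\<close>

lemma hom_nat_inverse:
  assumes K: "cring K" and h: "h \<in> ring_hom (ring_R r) K" and r: "r \<ge> 1"
  shows "h (inverse (of_nat r)) \<otimes>\<^bsub>K\<^esub> [r] \<cdot>\<^bsub>K\<^esub> \<one>\<^bsub>K\<^esub> = \<one>\<^bsub>K\<^esub>"
proof -
  interpret K: cring K by (rule K)
  interpret R: cring "ring_R r" by (rule ring_R_cring)
  have s: "x \<oplus>\<^bsub>ring_R r\<^esub> y = x + y" "x \<otimes>\<^bsub>ring_R r\<^esub> y = x * y" "\<one>\<^bsub>ring_R r\<^esub> = 1" "\<zero>\<^bsub>ring_R r\<^esub> = 0" for x y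
    by (simp_all add: ring_R_def generated_ring_simps)
  have n: "of_nat m \<in> carrier (ring_R r) \<and> h (of_nat m) = [m] \<cdot>\<^bsub>K\<^esub> \<one>\<^bsub>K\<^esub>" for m
  proof (induction m)
    case 0
    have "(0 :: complex poly fract) \<in> carrier (ring_R r)" using R.zero_closed s by simp
    moreover have "h 0 = \<zero>\<^bsub>K\<^esub>" using ring_hom_zero[OF h R.ring_axioms K.ring_axioms] s by simp
    ultimately show ?case by simp
  next
    case (Suc m)
    have "of_nat m + 1 \<in> carrier (ring_R r)" using R.a_closed[OF _ R.one_closed] Suc s by metis
    moreover have "h (of_nat m + 1) = [m] \<cdot>\<^bsub>K\<^esub> \<one>\<^bsub>K\<^esub> \<oplus>\<^bsub>K\<^esub> \<one>\<^bsub>K\<^esub>"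
      using ring_hom_add[OF h, of "of_nat m" 1] Suc s R.one_closed ring_hom_one[OF h] by simp
    ultimately show ?case by (simp add: add.commute)
  qed
  have nz: "(of_nat r :: complex poly fract) \<noteq> 0" using r
    by (simp add: of_nat_fract Zero_fract_def eq_fract)
  have "h (inverse (of_nat r) \<otimes>\<^bsub>ring_R r\<^esub> of_nat r) = h (inverse (of_nat r)) \<otimes>\<^bsub>K\<^esub> h (of_nat r)"
    using n inverse_r_R by (intro ring_hom_mult[OF h]) auto
  then show ?thesis using n[of r] nz s ring_hom_one[OF h] by simp
qed

section \<open>Homomorphisms carry the two systems of relations along\<close>

lemma finsum_hom:
  assumes "ring F" "ring B" "f \<in> ring_hom F B" "finite A" "\<And>a. a \<in> A \<Longrightarrow> x a \<in> carrier F"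
  shows "f (finsum F x A) = finsum B (\<lambda>a. f (x a)) A"
proof -
  interpret F: ring F by fact
  interpret B: ring B by fact
  show ?thesis using assms(4,5)
  proof (induction A)
    case empty
    then show ?case using ring_hom_zero[OF assms(3,1,2)] by simp
  next
    case (insert a A)
    have "f (finsum F x (insert a A)) = f (x a \<oplus>\<^bsub>F\<^esub> finsum F x A)"
      using insert by (subst F.finsum_insert) auto
    also have "\<dots> = f (x a) \<oplus>\<^bsub>B\<^esub> finsum B (\<lambda>a. f (x a)) A"
      using insert by (subst ring_hom_add[OF assms(3)]) (auto intro!: F.finsum_closed)
    also have "\<dots> = finsum B (\<lambda>a. f (x a)) (insert a A)"
      using insert ring_hom_closed[OF assms(3)] by (subst B.finsum_insert) auto
    finally show ?case .
  qed
qed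

lemma pow_hom:
  assumes "ring F" "ring B" "f \<in> ring_hom F B" "x \<in> carrier F"
  shows "f (x [^]\<^bsub>F\<^esub> (m::nat)) = f x [^]\<^bsub>B\<^esub> m"
proof -
  interpret F: ring F by fact
  interpret B: ring B by fact
  show ?thesis
    by (induction m) (simp_all add: ring_hom_one[OF assms(3)] ring_hom_mult[OF assms(3)] assms(4))
qed

lemma yh_idem_hom:
  assumes F: "ring F" and B: "ring B" and f: "f \<in> ring_hom F B" and c: "c \<in> carrier F"
    and t: "t i \<in> carrier F" "t (Suc i) \<in> carrier F" and t': "f (t i) = t' i" "f (t (Suc i)) = t' (Suc i)"
  shows "f (yh_idem F r c t i) = yh_idem B r (f c) t' i" "yh_idem F r c t i \<in> carrier F"
proof -
  interpret F: ring F by fact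
  interpret B: ring B by fact
  have [simp]: "x \<in> carrier F \<Longrightarrow> f x \<in> carrier B" for x by (rule ring_hom_closed[OF f])
  have t'c: "t' i \<in> carrier B" "t' (Suc i) \<in> carrier B" using t t'[symmetric] by simp_all
  have "f (yh_idem F r c t i) =
     f c \<otimes>\<^bsub>B\<^esub> f (\<Oplus>\<^bsub>F\<^esub>s\<in>{..<r}. t i [^]\<^bsub>F\<^esub> s \<otimes>\<^bsub>F\<^esub> t (Suc i) [^]\<^bsub>F\<^esub> (r - s))"
    unfolding yh_idem_def Suc_eq_plus1[symmetric] using c t
    by (intro ring_hom_mult[OF f]) (auto intro!: F.finsum_closed)
  also have "f (\<Oplus>\<^bsub>F\<^esub>s\<in>{..<r}. t i [^]\<^bsub>F\<^esub> s \<otimes>\<^bsub>F\<^esub> t (Suc i) [^]\<^bsub>F\<^esub> (r - s)) =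
     (\<Oplus>\<^bsub>B\<^esub>s\<in>{..<r}. f (t i [^]\<^bsub>F\<^esub> s \<otimes>\<^bsub>F\<^esub> t (Suc i) [^]\<^bsub>F\<^esub> (r - s)))"
    using t by (intro finsum_hom F B f) auto
  also have "\<dots> = (\<Oplus>\<^bsub>B\<^esub>s\<in>{..<r}. t' i [^]\<^bsub>B\<^esub> s \<otimes>\<^bsub>B\<^esub> t' (Suc i) [^]\<^bsub>B\<^esub> (r - s))"
    using t t'c by (intro B.finsum_cong') (auto simp: ring_hom_mult[OF f] pow_hom[OF F B f] t')
  finally show "f (yh_idem F r c t i) = yh_idem B r (f c) t' i" by (simp add: yh_idem_def)
  show "yh_idem F r c t i \<in> carrier F"
    unfolding yh_idem_def Suc_eq_plus1[symmetric] using c t by (intro F.m_closed F.finsum_closed) auto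
qed

lemma image_pairs1: "(\<lambda>(u, v). (f u, f v)) ` {(a i, b i) |i. P i} = {(f (a i), f (b i)) |i. P i}"
  by auto

lemma image_pairs2: "(\<lambda>(u, v). (f u, f v)) ` {(a i j, b i j) |i j. P i j} = {(f (a i j), f (b i j)) |i j. P i j}"
  by (fastforce simp: image_iff)

text \<open>Stated as an equality of sets of pairs because both inclusions are used: one shows that
  all relations hold in a quotient, the other computes the image of a given relation under a
  homomorphism about to be lifted.\<close>

lemma bt_relations_image:
  assumes F: "ring F" and B: "ring B" and f: "f \<in> ring_hom F B" and z: "z \<in> carrier F"
    and g: "\<And>i. i \<in> {1..<n} \<Longrightarrow> g i \<in> carrier F" "\<And>i. i \<in> {1..<n} \<Longrightarrow> f (g i) = g' i"
    and e: "\<And>i. i \<in> {1..<n} \<Longrightarrow> e i \<in> carrier F" "\<And>i. i \<in> {1..<n} \<Longrightarrow> f (e i) = e' i"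
  shows "bt_relations B n (f z) g' e' = (\<lambda>(u, v). (f u, f v)) ` bt_relations F n z g e"
proof -
  interpret F: ring F by fact
  have [simp]: "f (x [^]\<^bsub>F\<^esub> (2::nat)) = f x [^]\<^bsub>B\<^esub> (2::nat)" if "x \<in> carrier F" for x
    using pow_hom[OF F B f that] .
  note [simp] = ring_hom_mult[OF f] ring_hom_add[OF f] ring_hom_one[OF f] g e z
  show ?thesis
    unfolding bt_relations_def Let_def image_Un image_pairs1 image_pairs2
    by (intro arg_cong2[where f = "(\<union>)"] Collect_cong ex_cong1) (simp_all cong: rev_conj_cong del: atLeastLessThan_iff)
qed

lemma bt_relations_closed:
  assumes F: "ring F" and z: "z \<in> carrier F"
    and g: "\<And>i. i \<in> {1..<n} \<Longrightarrow> g i \<in> carrier F" and e: "\<And>i. i \<in> {1..<n} \<Longrightarrow> e i \<in> carrier F"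
    and "(u, v) \<in> bt_relations F n z g e"
  shows "u \<in> carrier F \<and> v \<in> carrier F"
proof -
  interpret F: ring F by fact
  show ?thesis using assms(5) unfolding bt_relations_def Let_def Un_iff
    by (elim disjE) (use g e z in \<open>auto simp del: atLeastLessThan_iff\<close>)
qed

lemma yh_relations_image:
  assumes F: "ring F" and B: "ring B" and f: "f \<in> ring_hom F B" and c: "c \<in> carrier F" and z: "z \<in> carrier F"
    and g: "\<And>i. i \<in> {1..<n} \<Longrightarrow> g i \<in> carrier F" "\<And>i. i \<in> {1..<n} \<Longrightarrow> f (g i) = g' i"
    and t: "\<And>i. i \<in> {1..n} \<Longrightarrow> t i \<in> carrier F" "\<And>i. i \<in> {1..n} \<Longrightarrow> f (t i) = t' i"
  shows "yh_relations B r n (f c) (f z) g' t' = (\<lambda>(u, v). (f u, f v)) ` yh_relations F r n c z g t"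
proof -
  interpret F: ring F by fact
  have i: "f (yh_idem F r c t i) = yh_idem B r (f c) t' i \<and> yh_idem F r c t i \<in> carrier F" if "i \<in> {1..<n}" for i
    using yh_idem_hom[OF F B f c, of t i t' r] that t by auto
  have s: "t (sw i j) \<in> carrier F \<and> f (t (sw i j)) = t' (sw i j)" if "i \<in> {1..<n}" "j \<in> {1..n}" for i j
    using sw_in[OF that] t by blast
  note [simp] = ring_hom_mult[OF f] ring_hom_add[OF f] ring_hom_one[OF f] pow_hom[OF F B f] g t z c i s
  show ?thesis
    unfolding yh_relations_def Suc_eq_plus1[symmetric] image_Un image_pairs1 image_pairs2
    by (intro arg_cong2[where f = "(\<union>)"] Collect_cong ex_cong1)
      (simp_all cong: rev_conj_cong del: atLeastLessThan_iff atLeastAtMost_iff)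
qed

lemma yh_relations_closed:
  assumes F: "ring F" and c: "c \<in> carrier F" and z: "z \<in> carrier F"
    and g: "\<And>i. i \<in> {1..<n} \<Longrightarrow> g i \<in> carrier F" and t: "\<And>i. i \<in> {1..n} \<Longrightarrow> t i \<in> carrier F"
    and "(u, v) \<in> yh_relations F r n c z g t"
  shows "u \<in> carrier F \<and> v \<in> carrier F"
proof -
  interpret F: ring F by fact
  have i: "yh_idem F r c t i \<in> carrier F" if "i \<in> {1..<n}" for i
    unfolding yh_idem_def Suc_eq_plus1[symmetric] using that t c by (intro F.m_closed F.finsum_closed) auto
  have s: "t (sw i j) \<in> carrier F" if "i \<in> {1..<n}" "j \<in> {1..n}" for i j
    using sw_in[OF that] t by blast
  show ?thesis using assms(6) unfolding yh_relations_def Un_iff Suc_eq_plus1[symmetric]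
    by (elim disjE) (use g t z c i s in \<open>auto simp del: atLeastLessThan_iff atLeastAtMost_iff\<close>)
qed

section \<open>Detecting coefficients\<close>

context fun_space
begin

lemma linear_finsum:
  assumes "finite A" "\<And>a. a \<in> A \<Longrightarrow> linear_op (T a)"
  shows "(\<Oplus>\<^bsub>D\<^esub>a\<in>A. T a) f p = (\<Oplus>a\<in>A. T a f p)"
  using assms
proof (induction A)
  case (insert a A)
  have "(\<Oplus>\<^bsub>D\<^esub>b\<in>insert a A. T b) = T a \<oplus>\<^bsub>D\<^esub> (\<Oplus>\<^bsub>D\<^esub>b\<in>A. T b)"
    using insert by (intro D.finsum_insert) auto
  moreover have "(\<Oplus>b\<in>insert a A. T b f p) = T a f p \<oplus> (\<Oplus>b\<in>A. T b f p)"
    using insert by (intro finsum_insert) auto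
  ultimately show ?case using insert by simp
qed simp

end

locale bt_algebra = bt_rep B n "\<theta> z" g e + K: cring K
  for B :: "('b, 'm) ring_scheme" (structure) and n and K :: "('k, 'p) ring_scheme"
    and \<theta> :: "'k \<Rightarrow> 'b" and z g e +
  assumes \<theta>_hom': "\<theta> \<in> ring_hom K B"
    and \<theta>_central': "k \<in> carrier K \<Longrightarrow> x \<in> carrier B \<Longrightarrow> \<theta> k \<otimes> x = x \<otimes> \<theta> k"
    and z_in_K: "z \<in> carrier K"
begin

sublocale bt_span B n g tie K \<theta> z
proof unfold_locales
  show "\<And>i. i \<in> {1..<n} \<Longrightarrow> Suc i \<in> {1..<n} \<Longrightarrow> g i \<otimes> g (Suc i) \<otimes> g i = g (Suc i) \<otimes> g i \<otimes> g (Suc i)"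
    by (rule g_braid) (simp add: adj_def)
  show "\<And>i. i \<in> {1..<n} \<Longrightarrow> g i \<otimes> g i = \<one> \<oplus> \<theta> z \<otimes> (tie i (Suc i) \<otimes> g i)"
    unfolding tie_Suc by (rule g_sq)
qed (use \<theta>_hom' \<theta>_central' z_in_K g_far in auto)

text \<open>One linear functional applied to a linear relation: the operator acts on the indicator
  of the point reached by \<open>w\<close> and is evaluated at the identity. Ties contribute the
  indicator of colourings constant on classes, words contribute their end point.\<close>

lemma coefficient_sum:
  assumes col: "colour_rep K r c z \<xi> col"
    and \<rho>: "\<rho> \<in> ring_hom B (fun_space.D K {p :: nat \<Rightarrow> nat. inj p})"
    and \<rho>\<theta>: "\<And>k. k \<in> carrier K \<Longrightarrow> \<rho> (\<theta> k) = fun_space.diag K {p. inj p} (\<lambda>_. k)"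
    and \<rho>g: "\<And>i. i \<in> {1..<n} \<Longrightarrow> \<rho> (g i) = colour_rep.gop K z col i"
    and \<rho>e: "\<And>i. i \<in> {1..<n} \<Longrightarrow> \<rho> (e i) = colour_rep.eop K col i (Suc i)"
    and d: "d \<in> index \<rightarrow> carrier K" and kernel: "\<rho> (\<Oplus>i\<in>index. \<theta> (d i) \<otimes> normal_elem i) = (\<lambda>_ _. \<zero>\<^bsub>K\<^esub>)"
    and w: "w \<in> normal_words n"
  shows "(\<Oplus>\<^bsub>K\<^esub>i\<in>index. d i \<otimes>\<^bsub>K\<^esub>
     (if (\<forall>(a, b) \<in> fst i. col a = col b) \<and> snd i = w then \<one>\<^bsub>K\<^esub> else \<zero>\<^bsub>K\<^esub>)) = \<zero>\<^bsub>K\<^esub>"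
proof -
  interpret C: colour_rep K r c z \<xi> col by (rule col)
  note hm = ring_hom_mult[OF \<rho>] ring_hom_one[OF \<rho>] ring_hom_closed[OF \<rho>]
  \<comment> \<open>Ties of distant labels are conjugates of adjacent ones; identifying their images
    requires cancelling images of the \<open>g k\<close>, which are units again.\<close>
  have gu: "C.gop k \<in> Units C.D" if k: "k \<in> {1..<n}" for k
  proof -
    have iv: "inv (g k) \<in> carrier B" "g k \<otimes> inv (g k) = \<one>" "inv (g k) \<otimes> g k = \<one>" using g_unit[OF k] by simp_all
    have "\<rho> (g k) \<in> carrier C.D" "\<rho> (inv (g k)) \<in> carrier C.D" using hm(3) k iv by auto
    moreover have "\<rho> (g k) \<otimes>\<^bsub>C.D\<^esub> \<rho> (inv (g k)) = \<one>\<^bsub>C.D\<^esub>" "\<rho> (inv (g k)) \<otimes>\<^bsub>C.D\<^esub> \<rho> (g k) = \<one>\<^bsub>C.D\<^esub>"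
      using hm(1)[of "g k" "inv (g k)"] hm(1)[of "inv (g k)" "g k"] hm(2) iv k by simp_all
    ultimately show ?thesis unfolding \<rho>g[OF k, symmetric] Units_def by blast
  qed
  have up: "\<rho> (aij i j) = C.eop i j" if ij: "1 \<le> i" "Suc i \<le> j" "j \<le> n" for i j
    using ij(2,3)
  proof (induction j rule: dec_induct)
    case base
    then show ?case using \<rho>e[of i] ij by (simp add: aij_base)
  next
    case (step j)
    have j: "j \<in> {1..<n}" "i < j" using step ij by auto
    have sw: "sw j i = i" "sw j j = Suc j" using j by (auto simp: Transposition.transpose_def)
    have cl: "aij i j \<in> carrier B" "aij i (Suc j) \<in> carrier B" using j ij by auto
    have "\<rho> (aij i (Suc j)) \<otimes>\<^bsub>C.D\<^esub> C.gop j = C.gop j \<otimes>\<^bsub>C.D\<^esub> \<rho> (aij i j)"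
      using aij_up[OF ij(1) j(2)] j cl hm(1)[of "g j" "aij i j"] hm(1)[of "aij i (Suc j)" "g j"] \<rho>g[OF j(1)]
      by (simp del: C.D_simps)
    also have "\<dots> = C.eop i (Suc j) \<otimes>\<^bsub>C.D\<^esub> C.gop j"
      using step C.eop_conj[of j i j] sw by (simp del: C.D_simps)
    finally show ?case
      by (rule C.D.unit_rcancel[rotated 3]) (use gu[OF j(1)] hm(3)[OF cl(2)] in simp_all)
  qed
  have es: "C.eop i j = C.eop j i" for i j by (simp add: C.eop_def eq_commute)
  have tie: "\<rho> (tie i j) = C.eop i j" if "i \<in> {1..n}" "j \<in> {1..n}" for i j
  proof -
    consider "i = j" | "i < j" | "j < i" by linarith
    then show ?thesis
    proof cases
      case 1
      then show ?thesis using hm(2) by (simp add: tie_def C.eop_def C.diag_one del: C.D_simps)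
    next
      case 2
      then show ?thesis using up[of i j] that by (simp add: tie_def)
    next
      case 3
      then show ?thesis using up[of j i] that es[of i j] by (simp add: tie_def)
    qed
  qed
  define ker where "ker L p \<longleftrightarrow> (\<forall>(a, b) \<in> L. col (p a) = col (p b))" for L and p :: "nat \<Rightarrow> nat"
  have ep: "\<rho> (eprod L) = C.diag (\<lambda>p. if ker (set L) p then \<one>\<^bsub>K\<^esub> else \<zero>\<^bsub>K\<^esub>)" if "set L \<subseteq> pairs" for L
    using that
  proof (induction L)
    case Nil
    then show ?case using hm(2) by (simp add: C.diag_one ker_def del: C.D_simps)
  next
    case (Cons q L)
    have q: "q \<in> pairs" "fst q \<in> {1..n}" "snd q \<in> {1..n}" "set L \<subseteq> pairs" using Cons(2) by auto
    have "\<rho> (eprod (q # L)) = C.eop (fst q) (snd q) \<otimes>\<^bsub>C.D\<^esub> \<rho> (eprod L)"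
      using hm(1)[OF e_pair_closed[OF q(1)] eprod_closed[OF q(4)]] tie[OF q(2,3)] by (simp del: C.D_simps)
    also have "\<dots> = C.diag (\<lambda>p. if ker (set (q # L)) p then \<one>\<^bsub>K\<^esub> else \<zero>\<^bsub>K\<^esub>)"
      unfolding Cons.IH[OF q(4)] C.eop_def
      by (subst C.diag_mult) (auto simp: ker_def case_prod_unfold intro!: arg_cong[of _ _ C.diag])
    finally show ?case .
  qed
  have wp: "\<rho> (wprod u) = C.wop u" if "set u \<subseteq> {1..<n}" for u
    using that
  proof (induction u)
    case Nil
    then show ?case using hm(2) by (simp add: C.wop_simps del: C.D_simps)
  next
    case (Cons k u)
    then have k: "k \<in> {1..<n}" "set u \<subseteq> {1..<n}" by auto
    then show ?case using hm(1)[OF g_closed[OF k(1)] wprod_closed[OF k(2)]] \<rho>g Cons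
      by (simp add: C.wop_simps del: C.D_simps)
  qed
  define \<iota> where "\<iota> = (\<lambda>i::nat. i)"
  have \<iota>: "inj \<iota>" by (simp add: \<iota>_def inj_def)
  define q where "q = word_act \<iota> w"
  \<comment> \<open>Distinct normal words lead to distinct points, so this indicator isolates the
    indices with second component \<open>w\<close>.\<close>
  define f where "f = (\<lambda>p. if p = q then \<one>\<^bsub>K\<^esub> else \<zero>\<^bsub>K\<^esub>)"
  have f: "f \<in> C.V" using inj_word_act[OF \<iota>] unfolding C.V_def by (simp add: f_def q_def)
  have val: "\<rho> (\<theta> (d i) \<otimes> normal_elem i) f \<iota> =
      d i \<otimes>\<^bsub>K\<^esub> (if (\<forall>(a, b) \<in> fst i. col a = col b) \<and> snd i = w then \<one>\<^bsub>K\<^esub> else \<zero>\<^bsub>K\<^esub>)" if i: "i \<in> index" for i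
  proof -
    have dc: "d i \<in> carrier K" using d i by auto
    have L: "set (listing (fst i)) = fst i" "set (listing (fst i)) \<subseteq> pairs"
      using set_listing[OF index_pairs[OF i]] index_pairs[OF i] by simp_all
    have u: "snd i \<in> normal_words n" using i by (auto simp: index_def)
    note ul = normal_letters'[OF u order_refl]
    have "\<rho> (\<theta> (d i) \<otimes> normal_elem i) =
      C.scal (d i) \<otimes>\<^bsub>C.D\<^esub> (C.diag (\<lambda>p. if ker (fst i) p then \<one>\<^bsub>K\<^esub> else \<zero>\<^bsub>K\<^esub>) \<otimes>\<^bsub>C.D\<^esub> C.wop (snd i))"
      unfolding normal_elem_def using dc L eprod_closed[OF L(2)] wprod_closed[OF ul]
      by (simp add: hm \<rho>\<theta> ep[OF L(2)] wp[OF ul] del: C.D_simps)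
    then have "\<rho> (\<theta> (d i) \<otimes> normal_elem i) f \<iota> =
      d i \<otimes>\<^bsub>K\<^esub> ((if ker (fst i) \<iota> then \<one>\<^bsub>K\<^esub> else \<zero>\<^bsub>K\<^esub>) \<otimes>\<^bsub>K\<^esub> C.wop (snd i) f \<iota>)"
      by (simp add: C.diag_apply)
    also have "C.wop (snd i) f \<iota> = f (word_act \<iota> (snd i))"
      by (rule C.wop_normal[OF f u]) (simp add: \<iota>_def)
    also have "\<dots> = (if snd i = w then \<one>\<^bsub>K\<^esub> else \<zero>\<^bsub>K\<^esub>)"
      using word_act_inj[OF \<iota> u w] by (auto simp: f_def q_def)
    also have "ker (fst i) \<iota> \<longleftrightarrow> (\<forall>(a, b) \<in> fst i. col a = col b)" by (simp add: ker_def \<iota>_def)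
    finally show ?thesis by simp
  qed
  have bc: "\<theta> (d i) \<otimes> normal_elem i \<in> carrier B" if "i \<in> index" for i
    using that d normal_elem_closed by (auto simp: Pi_iff)
  have lin: "C.linear_op (\<rho> (\<theta> (d i) \<otimes> normal_elem i))" if "i \<in> index" for i
    using hm(3)[OF bc[OF that]] by simp
  have "\<rho> (\<Oplus>i\<in>index. \<theta> (d i) \<otimes> normal_elem i) = (\<Oplus>\<^bsub>C.D\<^esub>i\<in>index. \<rho> (\<theta> (d i) \<otimes> normal_elem i))"
    using bc by (intro finsum_hom ring_axioms C.D_ring \<rho> finite_index) auto
  then have e: "(\<lambda>_ _. \<zero>\<^bsub>K\<^esub>) = (\<Oplus>\<^bsub>C.D\<^esub>i\<in>index. \<rho> (\<theta> (d i) \<otimes> normal_elem i))"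
    unfolding kernel .
  have "\<zero>\<^bsub>K\<^esub> = (\<Oplus>\<^bsub>C.D\<^esub>i\<in>index. \<rho> (\<theta> (d i) \<otimes> normal_elem i)) f \<iota>"
    unfolding e[symmetric] ..
  also have "\<dots> = (\<Oplus>\<^bsub>K\<^esub>i\<in>index. \<rho> (\<theta> (d i) \<otimes> normal_elem i) f \<iota>)"
    by (rule C.linear_finsum[OF finite_index lin])
  also have "\<dots> = (\<Oplus>\<^bsub>K\<^esub>i\<in>index. d i \<otimes>\<^bsub>K\<^esub>
     (if (\<forall>(a, b) \<in> fst i. col a = col b) \<and> snd i = w then \<one>\<^bsub>K\<^esub> else \<zero>\<^bsub>K\<^esub>))"
    using d by (intro K.finsum_cong') (auto simp: val Pi_iff)
  finally show ?thesis ..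
qed

text \<open>A class is coloured by its least element minus one, which lies below n. Labels outside
  {1..n} get colour 0; the bound \<open>max 1 n\<close> leaves room for it when n = 0.\<close>

lemma separating_colouring:
  assumes Y: "equiv {1..n} Y"
  obtains col :: "nat \<Rightarrow> nat"
  where "\<And>a. col a < max 1 n" "\<And>a b. a \<in> {1..n} \<Longrightarrow> b \<in> {1..n} \<Longrightarrow> col a = col b \<longleftrightarrow> (a, b) \<in> Y"
proof -
  define l where "l a = (LEAST b. (a, b) \<in> Y)" for a
  define col where "col a = (if a \<in> {1..n} then l a - 1 else 0)" for a
  have Yn: "Y \<subseteq> {1..n} \<times> {1..n}" using Y by (simp add: equiv_def)
  have l: "(a, l a) \<in> Y" if "a \<in> {1..n}" for a
  proof -
    have "(a, a) \<in> Y" using Y that by (auto simp: equiv_def refl_on_def)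
    then show ?thesis unfolding l_def by (rule LeastI)
  qed
  have ln: "l a \<in> {1..n}" if "a \<in> {1..n}" for a using l[OF that] Yn by blast
  have eq: "l a = l b" if "(a, b) \<in> Y" for a b
  proof -
    have "(a, x) \<in> Y \<longleftrightarrow> (b, x) \<in> Y" for x
      using that Y by (meson equiv_def symE transE)
    then show ?thesis by (simp add: l_def)
  qed
  show thesis
  proof (rule that[of col])
    fix a show "col a < max 1 n"
      using ln[of a] by (auto simp: col_def)
    fix b assume a: "a \<in> {1..n}" and b: "b \<in> {1..n}"
    have "col a = col b \<longleftrightarrow> l a = l b" using ln[OF a] ln[OF b] a b by (auto simp: col_def)
    also have "\<dots> \<longleftrightarrow> (a, b) \<in> Y"
      using eq l[OF a] l[OF b] Y by (metis equiv_def symE transE)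
    finally show "col a = col b \<longleftrightarrow> (a, b) \<in> Y" .
  qed
qed

text \<open>For a colouring whose classes are those of \<open>Y\<close>, the sum at \<open>w\<close>
  runs over the relations contained in \<open>Y\<close>. The system is unitriangular for inclusion,
  so induction on \<open>card Y\<close> isolates \<open>d (Y, w)\<close> without any
  division.\<close>

lemma coefficients_vanish:
  assumes n: "1 \<le> n" and r: "n \<le> r" and d: "d \<in> index \<rightarrow> carrier K"
    and sums: "\<And>col w. (\<And>a. col a < r) \<Longrightarrow> w \<in> normal_words n \<Longrightarrow>
      (\<Oplus>\<^bsub>K\<^esub>i\<in>index. d i \<otimes>\<^bsub>K\<^esub>
        (if (\<forall>(a, b) \<in> fst i. col a = col b) \<and> snd i = w then \<one>\<^bsub>K\<^esub> else \<zero>\<^bsub>K\<^esub>)) = \<zero>\<^bsub>K\<^esub>"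
    and i: "(Y, w) \<in> index"
  shows "d (Y, w) = \<zero>\<^bsub>K\<^esub>"
proof -
  have fY: "finite Y" if "(Y, w) \<in> index" for Y
    using index_pairs[OF that] by (auto intro: finite_subset)
  show ?thesis using i
  proof (induction "card Y" arbitrary: Y rule: less_induct)
    case less
    have Y: "equiv {1..n} Y" and w: "w \<in> normal_words n" using less.prems by (auto simp: index_def)
    obtain col where c: "\<And>a. col a < max 1 n"
      "\<And>a b. a \<in> {1..n} \<Longrightarrow> b \<in> {1..n} \<Longrightarrow> col a = col b \<longleftrightarrow> (a, b) \<in> Y"
      using separating_colouring[OF Y] by blast
    define F where "F i = d i \<otimes>\<^bsub>K\<^esub>
        (if (\<forall>(a, b) \<in> fst i. col a = col b) \<and> snd i = w then \<one>\<^bsub>K\<^esub> else \<zero>\<^bsub>K\<^esub>)" for i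
    have sub: "(\<forall>(a, b) \<in> Z. col a = col b) \<longleftrightarrow> Z \<subseteq> Y" if "Z \<subseteq> pairs" for Z
      using c(2) that by (auto simp: subset_iff simp del: atLeastAtMost_iff)
    have Fc: "F i \<in> carrier K" if "i \<in> index" for i using d that by (auto simp: F_def)
    have z: "F i = \<zero>\<^bsub>K\<^esub>" if i: "i \<in> index" "i \<noteq> (Y, w)" for i
    proof (cases "fst i \<subseteq> Y \<and> snd i = w")
      case True
      then have p: "fst i \<subset> Y" using i by (cases i) auto
      have iw: "(fst i, w) \<in> index" using i True by (cases i) auto
      have "d (fst i, w) = \<zero>\<^bsub>K\<^esub>"
        by (rule less.hyps[OF psubset_card_mono[OF fY[OF less.prems] p] iw])
      moreover have "(fst i, w) = i" using True by (cases i) auto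
      ultimately show ?thesis by (simp add: F_def)
    next
      case False
      have "d i \<in> carrier K" using d i by auto
      then show ?thesis using False sub[OF index_pairs[OF i(1)]] by (auto simp: F_def)
    qed
    \<comment> \<open>Here n colours have to be available: the partition into singletons uses that
      many.\<close>
    have cr: "col a < r" for a using c(1)[of a] n r by simp
    have "\<zero>\<^bsub>K\<^esub> = (\<Oplus>\<^bsub>K\<^esub>i\<in>index. F i)" unfolding F_def by (rule sums[OF cr w, symmetric])
    also have "\<dots> = (\<Oplus>\<^bsub>K\<^esub>i\<in>{(Y, w)}. F i)"
      using less.prems z Fc finite_index by (intro K.add.finprod_mono_neutral_cong_right) auto
    also have "\<dots> = F (Y, w)" using Fc[OF less.prems] by (simp add: K.finsum_insert)
    also have "\<dots> = d (Y, w)"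
    proof -
      have "d (Y, w) \<in> carrier K" using d less.prems by auto
      then show ?thesis using sub[OF index_pairs[OF less.prems]] by (simp add: F_def)
    qed
    finally show ?case ..
  qed
qed

end

section \<open>The homomorphism and its kernel\<close>

lemma BT_gens: "i \<in> {1..<n} \<Longrightarrow> BG i \<in> bt_gens n" "i \<in> {1..<n} \<Longrightarrow> BE i \<in> bt_gens n"
  by (auto simp: bt_gens_def)

lemma YH_gens: "i \<in> {1..<n} \<Longrightarrow> YG i \<in> yh_gens n" "i \<in> {1..n} \<Longrightarrow> YT i \<in> yh_gens n"
  by (auto simp: yh_gens_def)

section \<open>The two concrete presentations are well formed\<close>

lemma BT_presented: "presented ring_S (bt_gens n) (BT_rels n)"
proof -
  interpret A: cring ring_S by (rule ring_S_cring)
  \<comment> \<open>With no relations the locale supplies the free algebra as a ring, which must be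
    known before the relations can be shown to lie in it.\<close>
  interpret P: presented ring_S "bt_gens n" "{}" by unfold_locales auto
  show ?thesis
  proof unfold_locales
    fix u v assume "(u, v) \<in> BT_rels n"
    then show "u \<in> carrier P.F \<and> v \<in> carrier P.F"
      unfolding BT_rels_def
      by (rule bt_relations_closed[rotated 4, OF _ P.R.ring_axioms])
        (simp_all add: BT_gens indet_diff_S P.gen_closed P.const_closed del: atLeastLessThan_iff)
  qed
qed

lemma YH_presented: "presented (ring_R r) (yh_gens n) (YH_rels r n)"
proof -
  interpret A: cring "ring_R r" by (rule ring_R_cring)
  interpret P: presented "ring_R r" "yh_gens n" "{}" by unfold_locales auto
  show ?thesis
  proof unfold_locales
    fix u v assume "(u, v) \<in> YH_rels r n"
    then show "u \<in> carrier P.F \<and> v \<in> carrier P.F"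
      unfolding YH_rels_def
      by (rule yh_relations_closed[rotated 5, OF _ P.R.ring_axioms])
        (use indet_diff_S S_sub_R in \<open>simp_all add: subset_iff inverse_r_R YH_gens P.gen_closed P.const_closed del: atLeastLessThan_iff atLeastAtMost_iff\<close>)
  qed
qed

section \<open>The two algebras over \<open>K\<close> as instances of the abstract setting\<close>

locale specialisation = K: cring K for K :: "'k ring" +
  fixes n r :: nat and h :: "complex poly fract \<Rightarrow> 'k" and \<xi> :: 'k
  assumes n: "1 \<le> n" and r: "n \<le> r" and h: "h \<in> ring_hom (ring_R r) K"
    and \<xi>: "\<xi> \<in> carrier K" "\<xi> [^]\<^bsub>K\<^esub> r = \<one>\<^bsub>K\<^esub>"
    and \<xi>_unit: "\<And>i j. i < j \<Longrightarrow> j < r \<Longrightarrow> \<xi> [^]\<^bsub>K\<^esub> i \<ominus>\<^bsub>K\<^esub> \<xi> [^]\<^bsub>K\<^esub> j \<in> Units K"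
begin

abbreviation "c0 \<equiv> h (inverse (of_nat r))"
abbreviation "z0 \<equiv> h (indet_q - inverse indet_q)"

lemma z_R: "indet_q - inverse indet_q \<in> carrier (ring_R r)"
  using indet_diff_S S_sub_R by blast

lemma c0 [simp]: "c0 \<in> carrier K" and z0 [simp]: "z0 \<in> carrier K"
  using ring_hom_closed[OF h] inverse_r_R z_R by auto

lemma c0_inv: "c0 \<otimes>\<^bsub>K\<^esub> [r] \<cdot>\<^bsub>K\<^esub> \<one>\<^bsub>K\<^esub> = \<one>\<^bsub>K\<^esub>"
  using hom_nat_inverse[OF K.is_cring h] n r by simp

sublocale BTp: presented ring_S "bt_gens n" "BT_rels n" by (rule BT_presented)
sublocale YHp: presented "ring_R r" "yh_gens n" "YH_rels r n" by (rule YH_presented)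

lemma BT_eqs: "BTp.P = BT n" "BTp.cls = BT_class n"
  by (simp_all add: BT_def BT_class_def)

lemma YH_eqs: "YHp.P = YH r n" "YHp.cls = YH_class r n"
  by (simp_all add: YH_def YH_class_def)

sublocale E: base_change_alg ring_S "BT n" "BT_scalar n" K h
proof -
  have "BT_scalar n \<in> ring_hom ring_S (BT n)"
    using BTp.scalar_hom unfolding BT_eqs by (simp add: BT_scalar_def[abs_def])
  moreover have "ring (BT n)" using BTp.P.ring_axioms unfolding BT_eqs .
  ultimately show "base_change_alg ring_S (BT n) (BT_scalar n) K h"
    using hom_restrict_S[OF h] BTp.A.ring_axioms K.is_cring
    by (simp add: base_change_alg_def base_change_alg_axioms_def)
qed

sublocale Y: base_change_alg "ring_R r" "YH r n" "YH_scalar r n" K h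
proof -
  have "YH_scalar r n \<in> ring_hom (ring_R r) (YH r n)"
    using YHp.scalar_hom unfolding YH_eqs by (simp add: YH_scalar_def[abs_def])
  moreover have "ring (YH r n)" using YHp.P.ring_axioms unfolding YH_eqs .
  ultimately show "base_change_alg (ring_R r) (YH r n) (YH_scalar r n) K h"
    using h YHp.A.ring_axioms K.is_cring
    by (simp add: base_change_alg_def base_change_alg_axioms_def)
qed

lemma BT_closed [simp]: "i \<in> {1..<n} \<Longrightarrow> BT_g n i \<in> carrier (BT n)" "i \<in> {1..<n} \<Longrightarrow> BT_e n i \<in> carrier (BT n)"
  using BTp.cls.hom_closed[OF BTp.gen_closed[OF BT_gens(1)]] BTp.cls.hom_closed[OF BTp.gen_closed[OF BT_gens(2)]]
  by (simp_all add: BT_g_def BT_e_def BT_eqs)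

lemma YH_closed [simp]: "i \<in> {1..<n} \<Longrightarrow> YH_g r n i \<in> carrier (YH r n)" "i \<in> {1..n} \<Longrightarrow> YH_t r n i \<in> carrier (YH r n)"
  using YHp.cls.hom_closed[OF YHp.gen_closed[OF YH_gens(1)]] YHp.cls.hom_closed[OF YHp.gen_closed[OF YH_gens(2)]]
  by (simp_all add: YH_g_def YH_t_def YH_eqs)

lemma E_hom: "(\<lambda>u. E.\<iota> (BT_class n u)) \<in> ring_hom BTp.F E.T"
  using ring_hom_trans[OF BTp.cls_hom[unfolded BT_eqs] E.\<iota>_hom] by (simp add: comp_def)

lemma Y_hom: "(\<lambda>u. Y.\<iota> (YH_class r n u)) \<in> ring_hom YHp.F Y.T"
  using ring_hom_trans[OF YHp.cls_hom[unfolded YH_eqs] Y.\<iota>_hom] by (simp add: comp_def)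

lemma E_const: "a \<in> carrier ring_S \<Longrightarrow> E.\<iota> (BT_class n (free_const ring_S a)) = E.\<kappa> (h a)"
  using E.\<iota>_\<eta>[of a] by (simp add: BT_scalar_def)

lemma Y_const: "a \<in> carrier (ring_R r) \<Longrightarrow> Y.\<iota> (YH_class r n (free_const (ring_R r) a)) = Y.\<kappa> (h a)"
  using Y.\<iota>_\<eta>[of a] by (simp add: YH_scalar_def)

sublocale EB: bt_algebra E.T n K "\<lambda>k. E.\<kappa> k" z0 "\<lambda>i. E.\<iota> (BT_g n i)" "\<lambda>i. E.\<iota> (BT_e n i)"
proof -
  have "bt_relations E.T n (E.\<kappa> z0) (\<lambda>i. E.\<iota> (BT_g n i)) (\<lambda>i. E.\<iota> (BT_e n i)) =
    (\<lambda>(u, v). (E.\<iota> (BT_class n u), E.\<iota> (BT_class n v))) ` BT_rels n"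
    unfolding BT_rels_def E_const[OF indet_diff_S, symmetric]
    by (rule bt_relations_image[OF BTp.R.ring_axioms E.T.ring_axioms E_hom])
      (simp_all add: indet_diff_S BTp.const_closed BTp.gen_closed BT_gens BT_g_def BT_e_def del: atLeastLessThan_iff)
  then have rels: "u = v" if "(u, v) \<in> bt_relations E.T n (E.\<kappa> z0) (\<lambda>i. E.\<iota> (BT_g n i)) (\<lambda>i. E.\<iota> (BT_e n i))" for u v
    using that BTp.cls_rel unfolding BT_eqs by force
  show "bt_algebra E.T n K (\<lambda>k. E.\<kappa> k) z0 (\<lambda>i. E.\<iota> (BT_g n i)) (\<lambda>i. E.\<iota> (BT_e n i))"
  proof unfold_locales
    show "\<And>x. x \<in> carrier E.T \<Longrightarrow> E.\<kappa> z0 \<otimes>\<^bsub>E.T\<^esub> x = x \<otimes>\<^bsub>E.T\<^esub> E.\<kappa> z0"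
      by (rule E.\<kappa>_central) simp
    show "\<And>u v. (u, v) \<in> bt_relations E.T n (E.\<kappa> z0) (\<lambda>i. E.\<iota> (BT_g n i)) (\<lambda>i. E.\<iota> (BT_e n i)) \<Longrightarrow> u = v"
      by (rule rels)
    show "(\<lambda>k. E.\<kappa> k) \<in> ring_hom K E.T" by (rule E.\<kappa>_hom)
    show "\<And>k x. k \<in> carrier K \<Longrightarrow> x \<in> carrier E.T \<Longrightarrow> E.\<kappa> k \<otimes>\<^bsub>E.T\<^esub> x = x \<otimes>\<^bsub>E.T\<^esub> E.\<kappa> k"
      by (rule E.\<kappa>_central)
  qed (simp_all del: atLeastLessThan_iff)
qed

sublocale YB: yh_rep Y.T r n "Y.\<kappa> c0" "Y.\<kappa> z0" "\<lambda>i. Y.\<iota> (YH_g r n i)" "\<lambda>i. Y.\<iota> (YH_t r n i)"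
proof -
  have "yh_relations Y.T r n (Y.\<kappa> c0) (Y.\<kappa> z0) (\<lambda>i. Y.\<iota> (YH_g r n i)) (\<lambda>i. Y.\<iota> (YH_t r n i)) =
    (\<lambda>(u, v). (Y.\<iota> (YH_class r n u), Y.\<iota> (YH_class r n v))) ` YH_rels r n"
    unfolding YH_rels_def Y_const[OF z_R, symmetric] Y_const[OF inverse_r_R, symmetric]
    by (rule yh_relations_image[OF YHp.R.ring_axioms Y.T.ring_axioms Y_hom])
      (simp_all add: z_R inverse_r_R YHp.const_closed YHp.gen_closed YH_gens YH_g_def YH_t_def del: atLeastLessThan_iff atLeastAtMost_iff)
  then have rels: "u = v" if "(u, v) \<in> yh_relations Y.T r n (Y.\<kappa> c0) (Y.\<kappa> z0) (\<lambda>i. Y.\<iota> (YH_g r n i)) (\<lambda>i. Y.\<iota> (YH_t r n i))" for u v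
    using that YHp.cls_rel unfolding YH_eqs by force
  have "Y.\<kappa> c0 \<otimes>\<^bsub>Y.T\<^esub> [r] \<cdot>\<^bsub>Y.T\<^esub> \<one>\<^bsub>Y.T\<^esub> = Y.\<kappa> (c0 \<otimes>\<^bsub>K\<^esub> [r] \<cdot>\<^bsub>K\<^esub> \<one>\<^bsub>K\<^esub>)"
  proof -
    have "Y.\<kappa> ([m] \<cdot>\<^bsub>K\<^esub> \<one>\<^bsub>K\<^esub>) = [m] \<cdot>\<^bsub>Y.T\<^esub> \<one>\<^bsub>Y.T\<^esub>" for m :: nat
    proof (induction m)
      case 0
      then show ?case using ring_hom_zero[OF Y.\<kappa>_hom K.ring_axioms Y.T.ring_axioms] by simp
    next
      case (Suc m)
      then show ?case by (simp add: Y.pt_add_right Y.T_one)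
    qed
    then show ?thesis using ring_hom_mult[OF Y.\<kappa>_hom, of c0 "[r] \<cdot>\<^bsub>K\<^esub> \<one>\<^bsub>K\<^esub>"] by simp
  qed
  then have inv: "Y.\<kappa> c0 \<otimes>\<^bsub>Y.T\<^esub> [r] \<cdot>\<^bsub>Y.T\<^esub> \<one>\<^bsub>Y.T\<^esub> = \<one>\<^bsub>Y.T\<^esub>"
    by (simp add: c0_inv Y.T_one)
  show "yh_rep Y.T r n (Y.\<kappa> c0) (Y.\<kappa> z0) (\<lambda>i. Y.\<iota> (YH_g r n i)) (\<lambda>i. Y.\<iota> (YH_t r n i))"
  proof unfold_locales
    show "\<And>x. x \<in> carrier Y.T \<Longrightarrow> Y.\<kappa> c0 \<otimes>\<^bsub>Y.T\<^esub> x = x \<otimes>\<^bsub>Y.T\<^esub> Y.\<kappa> c0"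
      by (rule Y.\<kappa>_central) simp
  qed (use rels inv in \<open>simp_all del: atLeastLessThan_iff atLeastAtMost_iff\<close>)
qed

text \<open>\<open>YH_e\<close> is formed before extension of scalars. Homomorphisms respect the
  averaging formula, so its image is the average of the images with \<open>c0\<close> as
  1/r.\<close>

lemma YH_e_image:
  assumes "i \<in> {1..<n}"
  shows "Y.\<iota> (YH_e r n i) = yh_idem Y.T r (Y.\<kappa> c0) (\<lambda>i. Y.\<iota> (YH_t r n i)) i" "YH_e r n i \<in> carrier (YH r n)"
proof -
  have i: "i \<in> {1..n}" "Suc i \<in> {1..n}" using assms by auto
  have s: "YH_scalar r n (inverse (of_nat r)) \<in> carrier (YH r n)"
    by (rule ring_hom_closed[OF Y.\<eta>_hom inverse_r_R])
  note H = yh_idem_hom[OF Y.B.ring_axioms Y.T.ring_axioms Y.\<iota>_hom s, of "YH_t r n" i "\<lambda>i. Y.\<iota> (YH_t r n i)" r]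
  show "Y.\<iota> (YH_e r n i) = yh_idem Y.T r (Y.\<kappa> c0) (\<lambda>i. Y.\<iota> (YH_t r n i)) i"
    using H(1) i Y.\<iota>_\<eta>[OF inverse_r_R] by (simp add: YH_e_def del: atLeastAtMost_iff)
  show "YH_e r n i \<in> carrier (YH r n)"
    using H(2) i by (simp add: YH_e_def del: atLeastAtMost_iff)
qed

text \<open>Induction over the presentation inside induction over pure tensors. Scalars of the small
  ground ring act through \<open>h\<close>, which leaves scalars from \<open>K\<close> as the only
  scalar case.\<close>

lemma E_induct [consumes 1, case_names one add scal g e]:
  assumes x: "x \<in> carrier E.T"
    and one: "Q \<one>\<^bsub>E.T\<^esub>"
    and add: "\<And>x y. x \<in> carrier E.T \<Longrightarrow> y \<in> carrier E.T \<Longrightarrow> Q x \<Longrightarrow> Q y \<Longrightarrow> Q (x \<oplus>\<^bsub>E.T\<^esub> y)"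
    and scal: "\<And>k x. k \<in> carrier K \<Longrightarrow> x \<in> carrier E.T \<Longrightarrow> Q x \<Longrightarrow> Q (E.\<kappa> k \<otimes>\<^bsub>E.T\<^esub> x)"
    and g: "\<And>i x. i \<in> {1..<n} \<Longrightarrow> x \<in> carrier E.T \<Longrightarrow> Q x \<Longrightarrow> Q (E.\<iota> (BT_g n i) \<otimes>\<^bsub>E.T\<^esub> x)"
    and e: "\<And>i x. i \<in> {1..<n} \<Longrightarrow> x \<in> carrier E.T \<Longrightarrow> Q x \<Longrightarrow> Q (E.\<iota> (BT_e n i) \<otimes>\<^bsub>E.T\<^esub> x)"
  shows "Q x"
proof -
  have \<iota>: "Q (E.\<iota> y)" if "y \<in> carrier (BT n)" for y
  proof -
    have "y \<in> carrier BTp.P" using that by (simp only: BT_eqs)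
    then show ?thesis
    proof (induction rule: BTp.presented_induct)
      case one
      show ?case using assms(2) unfolding BT_eqs E.T_one .
    next
      case (add x y)
      then have "x \<in> carrier (BT n)" "y \<in> carrier (BT n)" by (simp_all only: BT_eqs)
      then show ?case using assms(3)[OF _ _ add(3,4)] unfolding BT_eqs by (simp add: E.pt_add_left)
    next
      case (const a x)
      have a: "h a \<in> carrier K" by (rule ring_hom_closed[OF E.h_hom const(1)])
      have x: "x \<in> carrier (BT n)" using const(2) by (simp only: BT_eqs)
      have "E.\<iota> (BT_class n (free_const ring_S a) \<otimes>\<^bsub>BT n\<^esub> x) = E.\<kappa> (h a) \<otimes>\<^bsub>E.T\<^esub> E.\<iota> x"
        using ring_hom_mult[OF E.\<iota>_hom ring_hom_closed[OF E.\<eta>_hom const(1)] x] E.\<iota>_\<eta>[OF const(1)]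
        unfolding BT_scalar_def by (simp only:)
      then show ?case using scal[OF a _ const(3)] const(2) unfolding BT_eqs by simp
    next
      case (gen b x)
      have x: "x \<in> carrier (BT n)" using gen(2) by (simp only: BT_eqs)
      then have x: "x \<in> carrier (BT n)" "E.\<iota> x \<in> carrier E.T" by simp_all
      consider i where "b = BG i" "i \<in> {1..<n}" | i where "b = BE i" "i \<in> {1..<n}"
        using gen(1) by (auto simp: bt_gens_def)
      then show ?case
      proof cases
        case (1 i)
        have "E.\<iota> (BT_g n i \<otimes>\<^bsub>BT n\<^esub> x) = E.\<iota> (BT_g n i) \<otimes>\<^bsub>E.T\<^esub> E.\<iota> x"
          using 1 x by (intro ring_hom_mult[OF E.\<iota>_hom]) auto
        then show ?thesis using g[OF 1(2) x(2) gen(3)] unfolding 1(1) BT_eqs BT_g_def by (simp only:)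
      next
        case (2 i)
        have "E.\<iota> (BT_e n i \<otimes>\<^bsub>BT n\<^esub> x) = E.\<iota> (BT_e n i) \<otimes>\<^bsub>E.T\<^esub> E.\<iota> x"
          using 2 x by (intro ring_hom_mult[OF E.\<iota>_hom]) auto
        then show ?thesis using e[OF 2(2) x(2) gen(3)] unfolding 2(1) BT_eqs BT_e_def by (simp only:)
      qed
    qed
  qed
  show ?thesis using x
  proof (induction rule: E.tensor_induct)
    case (add x y)
    then show ?case by (rule assms(3))
  next
    case (pure x k)
    have "Q (E.\<kappa> k \<otimes>\<^bsub>E.T\<^esub> E.\<iota> x)"
      by (rule scal[OF pure(2) E.pt_closed[OF pure(1) K.one_closed] \<iota>[OF pure(1)]])
    then show ?case unfolding E.pt_eq[OF pure, symmetric] .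
  qed
qed

text \<open>The span contains the unit and is stable under sums and under left multiplication by
  scalars and generators, which is all that \<open>E_induct\<close> asks for.\<close>

lemma E_span: "x \<in> carrier E.T \<Longrightarrow> x \<in> EB.kspan (EB.monomials n)"
proof (induction rule: E_induct)
  case (e i x)
  then show ?case using EB.e_span[OF e(1,3)] by (simp add: EB.tie_Suc)
qed (blast intro: EB.one_span EB.kspan_add[OF EB.monomials_closed[OF order_refl]]
    EB.kspan_scale[OF EB.monomials_closed[OF order_refl]] EB.g_span)+

lemma E_hom_unique:
  assumes C: "ring C" and \<phi>: "\<phi> \<in> ring_hom E.T C" and \<psi>: "\<psi> \<in> ring_hom E.T C"
    and k: "\<And>k. k \<in> carrier K \<Longrightarrow> \<psi> (E.\<kappa> k) = \<phi> (E.\<kappa> k)"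
    and g: "\<And>i. i \<in> {1..<n} \<Longrightarrow> \<psi> (E.\<iota> (BT_g n i)) = \<phi> (E.\<iota> (BT_g n i))"
    and e: "\<And>i. i \<in> {1..<n} \<Longrightarrow> \<psi> (E.\<iota> (BT_e n i)) = \<phi> (E.\<iota> (BT_e n i))"
    and x: "x \<in> carrier E.T"
  shows "\<psi> x = \<phi> x"
  using x
  by (induction rule: E_induct)
    (simp_all add: ring_hom_one[OF \<phi>] ring_hom_one[OF \<psi>] ring_hom_add[OF \<phi>] ring_hom_add[OF \<psi>]
      ring_hom_mult[OF \<phi>] ring_hom_mult[OF \<psi>] k g e del: atLeastLessThan_iff)

text \<open>The universal properties of the presentation and of the tensor product are applied in
  turn; the relations are met because averages of powers of the \<open>t i\<close> obey the tie
  axioms (\<open>YB.bt_hold\<close>).\<close>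

lemma phi_exists:
  obtains \<phi> where "\<phi> \<in> ring_hom E.T Y.T" "\<And>k. k \<in> carrier K \<Longrightarrow> \<phi> (E.\<kappa> k) = Y.\<kappa> k"
    "\<And>i. i \<in> {1..<n} \<Longrightarrow> \<phi> (E.\<iota> (BT_g n i)) = Y.\<iota> (YH_g r n i)"
    "\<And>i. i \<in> {1..<n} \<Longrightarrow> \<phi> (E.\<iota> (BT_e n i)) = Y.\<iota> (YH_e r n i)"
proof -
  define \<gamma> where "\<gamma> x = (case x of BG i \<Rightarrow> Y.\<iota> (YH_g r n i) | BE i \<Rightarrow> Y.\<iota> (YH_e r n i))" for x
  have \<gamma>c: "\<gamma> x \<in> carrier Y.T" if "x \<in> bt_gens n" for x
    using that YH_e_image(2) by (auto simp: bt_gens_def \<gamma>_def)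
  have \<eta>: "(\<lambda>a. Y.\<kappa> (h a)) \<in> ring_hom ring_S Y.T"
    using ring_hom_trans[OF E.h_hom Y.\<kappa>_hom] by (simp add: comp_def)
  obtain \<alpha> where \<alpha>: "\<alpha> \<in> ring_hom BTp.P Y.T" "\<And>a. a \<in> carrier ring_S \<Longrightarrow> \<alpha> (BTp.cls (free_const ring_S a)) = Y.\<kappa> (h a)"
    "\<And>x. x \<in> bt_gens n \<Longrightarrow> \<alpha> (BTp.cls (free_gen ring_S x)) = \<gamma> x"
  proof (rule BTp.presented_lift[OF Y.T.ring_axioms \<eta> \<gamma>c])
    fix a x assume "a \<in> carrier ring_S" "x \<in> bt_gens n"
    then show "Y.\<kappa> (h a) \<otimes>\<^bsub>Y.T\<^esub> \<gamma> x = \<gamma> x \<otimes>\<^bsub>Y.T\<^esub> Y.\<kappa> (h a)"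
      using ring_hom_closed[OF E.h_hom] \<gamma>c by (intro Y.\<kappa>_central) auto
  next
    fix \<Phi> u v
    assume \<Phi>: "\<Phi> \<in> ring_hom BTp.F Y.T" and c: "\<And>a. a \<in> carrier ring_S \<Longrightarrow> \<Phi> (free_const ring_S a) = Y.\<kappa> (h a)"
      and gn: "\<And>x. x \<in> bt_gens n \<Longrightarrow> \<Phi> (free_gen ring_S x) = \<gamma> x" and uv: "(u, v) \<in> BT_rels n"
    have "bt_relations Y.T n (\<Phi> (free_const ring_S (indet_q - inverse indet_q))) (\<lambda>i. Y.\<iota> (YH_g r n i))
        (yh_idem Y.T r (Y.\<kappa> c0) (\<lambda>i. Y.\<iota> (YH_t r n i))) = (\<lambda>(u, v). (\<Phi> u, \<Phi> v)) ` BT_rels n"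
      unfolding BT_rels_def
      by (rule bt_relations_image[OF BTp.R.ring_axioms Y.T.ring_axioms \<Phi>])
        (simp_all add: indet_diff_S BTp.const_closed BTp.gen_closed BT_gens gn \<gamma>_def YH_e_image del: atLeastLessThan_iff)
    then have "(\<Phi> u, \<Phi> v) \<in> bt_relations Y.T n (Y.\<kappa> z0) (\<lambda>i. Y.\<iota> (YH_g r n i))
        (yh_idem Y.T r (Y.\<kappa> c0) (\<lambda>i. Y.\<iota> (YH_t r n i)))"
      unfolding c[OF indet_diff_S] using uv by auto
    then show "\<Phi> u = \<Phi> v" by (rule YB.bt_hold)
  qed (assumption | rule that)+
  have \<alpha>h: "\<alpha> \<in> ring_hom (BT n) Y.T" using \<alpha>(1) unfolding BT_eqs .
  note \<alpha>c = ring_hom_closed[OF \<alpha>h]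
  obtain \<phi> where \<phi>: "\<phi> \<in> ring_hom E.T Y.T"
    "\<And>x k. x \<in> carrier (BT n) \<Longrightarrow> k \<in> carrier K \<Longrightarrow> \<phi> (E.pt x k) = \<alpha> x \<otimes>\<^bsub>Y.T\<^esub> Y.\<kappa> k"
  proof (rule E.base_change_lift[OF Y.T.ring_axioms \<alpha>h Y.\<kappa>_hom])
    show "\<And>x k. x \<in> carrier (BT n) \<Longrightarrow> k \<in> carrier K \<Longrightarrow> \<alpha> x \<otimes>\<^bsub>Y.T\<^esub> Y.\<kappa> k = Y.\<kappa> k \<otimes>\<^bsub>Y.T\<^esub> \<alpha> x"
      using Y.\<kappa>_central \<alpha>c by simp
    show "\<And>a. a \<in> carrier ring_S \<Longrightarrow> \<alpha> (BT_scalar n a) = Y.\<kappa> (h a)"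
      using \<alpha>(2) by (simp add: BT_eqs BT_scalar_def)
  qed (rule that)
  show thesis
  proof (rule that[OF \<phi>(1)])
    fix k assume "k \<in> carrier K"
    then show "\<phi> (E.\<kappa> k) = Y.\<kappa> k" using \<phi>(2)[OF E.B.one_closed] ring_hom_one[OF \<alpha>h] by simp
  next
    fix i assume i: "i \<in> {1..<n}"
    have 1: "Y.\<kappa> \<one>\<^bsub>K\<^esub> = \<one>\<^bsub>Y.T\<^esub>" by (simp add: Y.T_one)
    have "\<alpha> (BT_g n i) = Y.\<iota> (YH_g r n i)" "\<alpha> (BT_e n i) = Y.\<iota> (YH_e r n i)"
      using \<alpha>(3)[OF BT_gens(1)[OF i]] \<alpha>(3)[OF BT_gens(2)[OF i]] by (simp_all add: BT_eqs BT_g_def BT_e_def \<gamma>_def)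
    then show "\<phi> (E.\<iota> (BT_g n i)) = Y.\<iota> (YH_g r n i)" "\<phi> (E.\<iota> (BT_e n i)) = Y.\<iota> (YH_e r n i)"
      using \<phi>(2)[OF BT_closed(1)[OF i] K.one_closed] \<phi>(2)[OF BT_closed(2)[OF i] K.one_closed]
        \<alpha>c[OF BT_closed(1)[OF i]] \<alpha>c[OF BT_closed(2)[OF i]] by (simp_all add: 1)
  qed
qed

text \<open>Extends the coloured module from generators to the specialised Yokonuma-Hecke algebra,
  again by presentation and then tensor product. The last conclusion hands on the setting in which
  the operators were computed.\<close>

lemma colouring_hom:
  assumes col: "\<And>a. col a < r"
  defines "D \<equiv> fun_space.D K {p :: nat \<Rightarrow> nat. inj p}"
  obtains \<Psi> where "\<Psi> \<in> ring_hom Y.T D" "\<And>k. k \<in> carrier K \<Longrightarrow> \<Psi> (Y.\<kappa> k) = fun_space.diag K {p. inj p} (\<lambda>_. k)"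
    "\<And>i. i \<in> {1..<n} \<Longrightarrow> \<Psi> (Y.\<iota> (YH_g r n i)) = colour_rep.gop K z0 col i"
    "\<And>i. i \<in> {1..<n} \<Longrightarrow> \<Psi> (Y.\<iota> (YH_e r n i)) = colour_rep.eop K col i (Suc i)"
    "colour_rep K r c0 z0 \<xi> col"
proof -
  interpret C: colour_rep K r c0 z0 \<xi> col
    by unfold_locales (use col \<xi> \<xi>_unit c0_inv in auto)
  have D: "D = C.D" by (simp add: D_def)
  define \<gamma> where "\<gamma> x = (case x of YG i \<Rightarrow> C.gop i | YT i \<Rightarrow> C.t_op i)" for x
  have \<gamma>c: "\<gamma> x \<in> carrier C.D" for x by (cases x) (simp_all add: \<gamma>_def)
  have \<eta>: "(\<lambda>a. C.scal (h a)) \<in> ring_hom (ring_R r) C.D"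
    using ring_hom_trans[OF h C.scal_hom] by (simp add: comp_def)
  obtain \<alpha> where \<alpha>: "\<alpha> \<in> ring_hom YHp.P C.D"
    "\<And>a. a \<in> carrier (ring_R r) \<Longrightarrow> \<alpha> (YHp.cls (free_const (ring_R r) a)) = C.scal (h a)"
    "\<And>x. x \<in> yh_gens n \<Longrightarrow> \<alpha> (YHp.cls (free_gen (ring_R r) x)) = \<gamma> x"
  proof (rule YHp.presented_lift[OF C.D_ring \<eta> \<gamma>c])
    fix a x assume "a \<in> carrier (ring_R r)"
    then show "C.scal (h a) \<otimes>\<^bsub>C.D\<^esub> \<gamma> x = \<gamma> x \<otimes>\<^bsub>C.D\<^esub> C.scal (h a)"
      using ring_hom_closed[OF h] \<gamma>c[of x] by (intro C.scal_central) auto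
  next
    fix \<Phi> u v
    assume \<Phi>: "\<Phi> \<in> ring_hom YHp.F C.D"
      and c: "\<And>a. a \<in> carrier (ring_R r) \<Longrightarrow> \<Phi> (free_const (ring_R r) a) = C.scal (h a)"
      and gn: "\<And>x. x \<in> yh_gens n \<Longrightarrow> \<Phi> (free_gen (ring_R r) x) = \<gamma> x" and uv: "(u, v) \<in> YH_rels r n"
    have "yh_relations C.D r n (\<Phi> (free_const (ring_R r) (inverse (of_nat r))))
        (\<Phi> (free_const (ring_R r) (indet_q - inverse indet_q))) C.gop C.t_op = (\<lambda>(u, v). (\<Phi> u, \<Phi> v)) ` YH_rels r n"
      unfolding YH_rels_def
      by (rule yh_relations_image[OF YHp.R.ring_axioms C.D_ring \<Phi>])
        (simp_all add: z_R inverse_r_R YHp.const_closed YHp.gen_closed YH_gens gn \<gamma>_def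
          del: atLeastLessThan_iff atLeastAtMost_iff)
    then have "(\<Phi> u, \<Phi> v) \<in> yh_relations C.D r n (C.scal c0) (C.scal z0) C.gop C.t_op"
      unfolding c[OF z_R] c[OF inverse_r_R] using uv by auto
    then show "\<Phi> u = \<Phi> v" by (rule C.yh_relations_op)
  qed (rule that)
  have \<alpha>h: "\<alpha> \<in> ring_hom (YH r n) C.D" using \<alpha>(1) unfolding YH_eqs .
  note \<alpha>c = ring_hom_closed[OF \<alpha>h]
  obtain \<Psi> where \<Psi>: "\<Psi> \<in> ring_hom Y.T C.D"
    "\<And>x k. x \<in> carrier (YH r n) \<Longrightarrow> k \<in> carrier K \<Longrightarrow> \<Psi> (Y.pt x k) = \<alpha> x \<otimes>\<^bsub>C.D\<^esub> C.scal k"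
  proof (rule Y.base_change_lift[OF C.D_ring \<alpha>h C.scal_hom])
    show "\<And>x k. x \<in> carrier (YH r n) \<Longrightarrow> k \<in> carrier K \<Longrightarrow> \<alpha> x \<otimes>\<^bsub>C.D\<^esub> C.scal k = C.scal k \<otimes>\<^bsub>C.D\<^esub> \<alpha> x"
      using C.scal_central \<alpha>c by (metis C.D_simps(1))
    show "\<And>a. a \<in> carrier (ring_R r) \<Longrightarrow> \<alpha> (YH_scalar r n a) = C.scal (h a)"
      using \<alpha>(2) by (simp add: YH_eqs YH_scalar_def)
  qed (rule that)
  have \<iota>: "\<Psi> (Y.\<iota> x) = \<alpha> x" if "x \<in> carrier (YH r n)" for x
    using \<Psi>(2)[OF that K.one_closed] C.D.r_one[OF \<alpha>c[OF that]] C.diag_one by (simp del: C.D_simps)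
  have sc: "\<Psi> (Y.\<kappa> k) = C.scal k" if "k \<in> carrier K" for k
    using \<Psi>(2)[OF Y.B.one_closed that] C.D.l_one[OF ring_hom_closed[OF C.scal_hom that]] ring_hom_one[OF \<alpha>h]
    by (simp del: C.D_simps)
  have g: "\<Psi> (Y.\<iota> (YH_g r n i)) = C.gop i" if i: "i \<in> {1..<n}" for i
    using \<iota>[OF YH_closed(1)[OF i]] \<alpha>(3)[OF YH_gens(1)[OF i]] by (simp add: YH_eqs YH_g_def \<gamma>_def)
  have t: "\<Psi> (Y.\<iota> (YH_t r n i)) = C.t_op i" if i: "i \<in> {1..n}" for i
    using \<iota>[OF YH_closed(2)[OF i]] \<alpha>(3)[OF YH_gens(2)[OF i]] by (simp add: YH_eqs YH_t_def \<gamma>_def)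
  have e: "\<Psi> (Y.\<iota> (YH_e r n i)) = C.eop i (Suc i)" if i: "i \<in> {1..<n}" for i
  proof -
    have i': "i \<in> {1..n}" "Suc i \<in> {1..n}" using i by auto
    have "\<Psi> (Y.\<iota> (YH_e r n i)) = yh_idem C.D r (\<Psi> (Y.\<kappa> c0)) C.t_op i"
      unfolding YH_e_image(1)[OF i]
      using i' t by (intro yh_idem_hom(1)[OF Y.T.ring_axioms C.D_ring \<Psi>(1)]) (auto simp del: atLeastAtMost_iff)
    then show ?thesis using C.yh_idem_op[of i] by (simp add: sc)
  qed
  show thesis
    by (rule that[of \<Psi>]) (use \<Psi>(1) sc g e C.colour_rep_axioms D in auto)
qed

text \<open>For every colouring, the composite of \<open>\<phi>\<close> with its representation
  kills the expansion of \<open>x\<close>; the resulting equations, over all colourings and words,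
  leave only zero coefficients.\<close>

lemma phi_kernel:
  assumes \<phi>: "\<phi> \<in> ring_hom E.T Y.T" and k: "\<And>k. k \<in> carrier K \<Longrightarrow> \<phi> (E.\<kappa> k) = Y.\<kappa> k"
    and g: "\<And>i. i \<in> {1..<n} \<Longrightarrow> \<phi> (E.\<iota> (BT_g n i)) = Y.\<iota> (YH_g r n i)"
    and e: "\<And>i. i \<in> {1..<n} \<Longrightarrow> \<phi> (E.\<iota> (BT_e n i)) = Y.\<iota> (YH_e r n i)"
    and x: "x \<in> carrier E.T" "\<phi> x = \<zero>\<^bsub>Y.T\<^esub>"
  shows "x = \<zero>\<^bsub>E.T\<^esub>"
proof -
  obtain d where d: "d \<in> EB.index \<rightarrow> carrier K" "x = (\<Oplus>\<^bsub>E.T\<^esub>i\<in>EB.index. E.\<kappa> (d i) \<otimes>\<^bsub>E.T\<^esub> EB.normal_elem i)"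
    using EB.span_expand[OF E_span[OF x(1)]] by blast
  have "d i = \<zero>\<^bsub>K\<^esub>" if i: "i \<in> EB.index" for i
  proof -
    have "d (fst i, snd i) = \<zero>\<^bsub>K\<^esub>"
    proof (rule EB.coefficients_vanish[OF n r d(1)])
      fix col :: "nat \<Rightarrow> nat" and w assume col: "\<And>a. col a < r" and w: "w \<in> normal_words n"
      obtain \<Psi> where \<Psi>: "\<Psi> \<in> ring_hom Y.T (fun_space.D K {p :: nat \<Rightarrow> nat. inj p})"
        "\<And>k. k \<in> carrier K \<Longrightarrow> \<Psi> (Y.\<kappa> k) = fun_space.diag K {p. inj p} (\<lambda>_. k)"
        "\<And>i. i \<in> {1..<n} \<Longrightarrow> \<Psi> (Y.\<iota> (YH_g r n i)) = colour_rep.gop K z0 col i"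
        "\<And>i. i \<in> {1..<n} \<Longrightarrow> \<Psi> (Y.\<iota> (YH_e r n i)) = colour_rep.eop K col i (Suc i)"
        "colour_rep K r c0 z0 \<xi> col"
        using colouring_hom[of col] col by blast
      have "(\<Psi> \<circ> \<phi>) (\<Oplus>\<^bsub>E.T\<^esub>i\<in>EB.index. E.\<kappa> (d i) \<otimes>\<^bsub>E.T\<^esub> EB.normal_elem i) = (\<lambda>_ _. \<zero>\<^bsub>K\<^esub>)"
      proof -
        interpret C: colour_rep K r c0 z0 \<xi> col by (rule \<Psi>(5))
        show ?thesis unfolding d(2)[symmetric] using x(2) ring_hom_zero[OF \<Psi>(1) Y.T.ring_axioms C.D_ring] by simp
      qed
      then show "(\<Oplus>\<^bsub>K\<^esub>i\<in>EB.index. d i \<otimes>\<^bsub>K\<^esub>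
        (if (\<forall>(a, b) \<in> fst i. col a = col b) \<and> snd i = w then \<one>\<^bsub>K\<^esub> else \<zero>\<^bsub>K\<^esub>)) = \<zero>\<^bsub>K\<^esub>"
        by (rule EB.coefficient_sum[OF \<Psi>(5) ring_hom_trans[OF \<phi> \<Psi>(1)] _ _ _ d(1) _ w, rotated 3])
          (simp_all add: k g e \<Psi>(2-4) del: atLeastLessThan_iff)
    qed (use i in simp)
    then show ?thesis by simp
  qed
  then have "x = (\<Oplus>\<^bsub>E.T\<^esub>i\<in>EB.index. \<zero>\<^bsub>E.T\<^esub>)"
    unfolding d(2) using EB.normal_elem_closed EB.\<theta>_zero by (intro E.T.finsum_cong') (auto simp: Pi_iff)
  then show ?thesis by simp
qed

lemma is_phi_iff:
  "is_phi r n K h \<phi> \<longleftrightarrow> \<phi> \<in> ring_hom E.T Y.T \<and> (\<forall>k\<in>carrier K. \<phi> (E.\<kappa> k) = Y.\<kappa> k) \<and>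
     (\<forall>i\<in>{1..<n}. \<phi> (E.\<iota> (BT_g n i)) = Y.\<iota> (YH_g r n i) \<and> \<phi> (E.\<iota> (BT_e n i)) = Y.\<iota> (YH_e r n i))"
  by (simp add: is_phi_def algebra_hom_def BTK_def YHK_def BTK_tensor_def YHK_tensor_def)

lemma phi_embedding:
  "\<exists>\<phi>. is_phi r n K h \<phi> \<and>
     (\<forall>\<psi>. is_phi r n K h \<psi> \<longrightarrow> (\<forall>x \<in> carrier (BTK n K h). \<psi> x = \<phi> x)) \<and>
     inj_on \<phi> (carrier (BTK n K h))"
proof -
  have T: "BTK n K h = E.T" by (simp add: BTK_def)
  obtain \<phi> where \<phi>: "\<phi> \<in> ring_hom E.T Y.T" "\<And>k. k \<in> carrier K \<Longrightarrow> \<phi> (E.\<kappa> k) = Y.\<kappa> k"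
    "\<And>i. i \<in> {1..<n} \<Longrightarrow> \<phi> (E.\<iota> (BT_g n i)) = Y.\<iota> (YH_g r n i)"
    "\<And>i. i \<in> {1..<n} \<Longrightarrow> \<phi> (E.\<iota> (BT_e n i)) = Y.\<iota> (YH_e r n i)"
    by (rule phi_exists, rule that)
  have "is_phi r n K h \<phi>" unfolding is_phi_iff using \<phi> by blast
  moreover have "\<psi> x = \<phi> x" if \<psi>: "is_phi r n K h \<psi>" and x: "x \<in> carrier (BTK n K h)" for \<psi> x
  proof (rule E_hom_unique[OF Y.T.ring_axioms \<phi>(1)])
    show "\<psi> \<in> ring_hom E.T Y.T" using \<psi> unfolding is_phi_iff by blast
    show "x \<in> carrier E.T" using x unfolding T .
  qed (use \<psi> \<phi> in \<open>simp_all add: is_phi_iff\<close>)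
  moreover have "inj_on \<phi> (carrier (BTK n K h))" unfolding T
  proof (rule inj_onI)
    fix x y assume xy: "x \<in> carrier E.T" "y \<in> carrier E.T" "\<phi> x = \<phi> y"
    have "\<phi> (x \<ominus>\<^bsub>E.T\<^esub> y) = \<phi> x \<ominus>\<^bsub>Y.T\<^esub> \<phi> y"
      by (rule ring_hom_a_minus[OF E.T.ring_axioms Y.T.ring_axioms \<phi>(1) xy(1,2)])
    also have "\<dots> = \<zero>\<^bsub>Y.T\<^esub>"
      unfolding xy(3) Y.T.minus_eq by (rule Y.T.r_neg[OF ring_hom_closed[OF \<phi>(1) xy(2)]])
    finally have zero: "\<phi> (x \<ominus>\<^bsub>E.T\<^esub> y) = \<zero>\<^bsub>Y.T\<^esub>" .
    have "x \<ominus>\<^bsub>E.T\<^esub> y = \<zero>\<^bsub>E.T\<^esub>"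
      by (rule phi_kernel[OF \<phi> E.T.minus_closed[OF xy(1,2)] zero])
    then show "x = y" using xy(1,2) E.T.r_right_minus_eq by blast
  qed
  ultimately show ?thesis by blast
qed

end

text \<open>A factor of a unit in a commutative ring is a unit; this extracts the single differences
  of powers of \<open>\<xi>\<close> from the invertible product.\<close>

lemma (in cring) finprod_Units_factor:
  assumes "finite A" "f \<in> A \<rightarrow> carrier R" "finprod R f A \<in> Units R" "a \<in> A"
  shows "f a \<in> Units R"
proof -
  have "finprod R f A = f a \<otimes> finprod R f (A - {a})"
    using assms finprod_insert[of "A - {a}" a f] by (auto simp: insert_absorb Pi_iff)
  moreover have "f a \<in> carrier R" "finprod R f (A - {a}) \<in> carrier R"
    using assms by (auto simp: Pi_iff intro!: finprod_closed)
  ultimately show ?thesis using assms(3) unit_factor by metis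
qed

theorem theorem14:
  fixes n r :: nat and K :: "'k ring" and q \<xi> :: 'k and h :: "complex poly fract \<Rightarrow> 'k"
  assumes "n \<ge> 1" and "r \<ge> 1"
    and "cring K"
    and "q \<in> Units K" and "\<xi> \<in> Units K"
    and "\<xi> [^]\<^bsub>K\<^esub> r = \<one>\<^bsub>K\<^esub>"
    and "[r] \<cdot>\<^bsub>K\<^esub> \<one>\<^bsub>K\<^esub> \<in> Units K"
    and "finprod K (\<lambda>(i, j). \<xi> [^]\<^bsub>K\<^esub> i \<ominus>\<^bsub>K\<^esub> \<xi> [^]\<^bsub>K\<^esub> j) {(i, j). i < j \<and> j < r} \<in> Units K"
    and "h \<in> ring_hom (ring_R r) K"
    and "h indet_q = q" and "h (const_fract (root_xi r)) = \<xi>"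
    and "r \<ge> n"
  shows "\<exists>\<phi>. is_phi r n K h \<phi> \<and>
             (\<forall>\<psi>. is_phi r n K h \<psi> \<longrightarrow> (\<forall>x \<in> carrier (BTK n K h). \<psi> x = \<phi> x)) \<and>
             inj_on \<phi> (carrier (BTK n K h))"
proof -
  interpret K: cring K by fact
  have \<xi>: "\<xi> \<in> carrier K" using assms(5) by (rule K.Units_closed)
  have fin: "finite {(i, j). i < j \<and> j < r}"
    by (rule finite_subset[of _ "{..<r} \<times> {..<r}"]) auto
  have carr: "(\<lambda>(i, j). \<xi> [^]\<^bsub>K\<^esub> i \<ominus>\<^bsub>K\<^esub> \<xi> [^]\<^bsub>K\<^esub> j) \<in> {(i, j). i < j \<and> j < r} \<rightarrow> carrier K"
    using \<xi> by (auto simp: Pi_iff)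
  have unit: "\<xi> [^]\<^bsub>K\<^esub> i \<ominus>\<^bsub>K\<^esub> \<xi> [^]\<^bsub>K\<^esub> j \<in> Units K" if "i < j" "j < r" for i j :: nat
    using K.finprod_Units_factor[OF fin carr assms(8), of "(i, j)"] that by simp
  interpret S: specialisation K n r h \<xi>
    by (intro specialisation.intro specialisation_axioms.intro assms \<xi> unit)
  show ?thesis by (rule S.phi_embedding)
qed

end
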